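(* Let $\Delta = 1-2x-2y-2xy+x^2+y^2$. The generating function of bimodal 2-convex polygons (with their single depth-2 vertical indent on the top), counting half the number of horizontal edges by $x$ and half the number of vertical edges by $y$, is $$-\left(\frac{2x^2 A^{(2)}_c}{(1-x)^3((1-x)^2-y)\Delta^{5/2}} + \frac{x^2 B^{(2)}_c}{(1-x)^5((1-x)^2-y)^3\Delta^3}\right),$$ where $A^{(2)}_c = -4(1-x)^{11} + 2 (1-x)^9 (10+9x) y - 2 (1-x)^7 (20+21x+15x^2) y^2 + (1-x)^5 (40+17x+18x^2+21x^3) y^3 - (1-x)^3 (20-26x-31x^2-14x^3+3x^4) y^4 + (1-x) (2+x) (2-13x+5x^2-7x^3-3x^4) y^5 + x (4-11x-3x^2-5x^3-x^4) y^6 + x(1+x)^2 y^7$ and $B^{(2)}_c = 8(1-x)^{18} - 4 (1-x)^{16}(16+11x) y + 8(1-x)^{14}(28+29x+12x^2) y^2 - 2 (1-x)^{12} (224+233 x+158 x^2+51 x^3) y^3 + 2 (1-x)^{10} (280+189 x+144 x^2+95 x^3+24 x^4) y^4 - (1-x)^8 (448-57 x-56 x^2+36 x^4+x^5) y^5 - (1-x)^6 (-224+345 x+182 x^2+336 x^3+292 x^4+75 x^5+6 x^6) y^6 + (1-x)^4 (-64+265 x+30 x^2+128 x^3-496 x^4-267 x^5+66 x^6+2 x^7) y^7 - (1-x)^2 (-8+89 x-132 x^2-634 x^3-558 x^4+593 x^5-248 x^6-64 x^7+2 x^8) y^8 + x (7-236 x-476 x^2+962 x^3-388 x^4-296 x^5+248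 x^6-78 x^7+x^8) y^9 + x (13+188 x+99 x^2-288 x^3+247 x^4-84 x^5+17 x^6) y^{10} - x (11+58 x-28 x^2+6 x^3+x^4) y^{11}-(-3+x) x (1+x) y^{12}.$
   Context: A self-avoiding polygon (SAP) is a simple closed lattice walk on the square lattice $\mathbb{Z}^2$, regarded as a set of edges without root or orientation and considered up to translation. Its minimum bounding rectangle (MBR) is the smallest axis-parallel rectangle containing it. An $m$-convex polygon is a SAP whose perimeter equals the perimeter of its MBR plus $2m$. A bimodal $m$-convex polygon is one whose concavity consists of a single vertical indent of depth $m$; here the indent is on the top. Explicitly, such a polygon of width $w$ is the boundary of a union of columns $i=1,\dots,w$, column $i$ occupying the unit cells with heights in an interval $[b_i,t_i]$, $b_i<t_i$ integers, consecutive columns overlapping in at least one cell ($\max(b_i,b_{i+1})<\min(t_i,t_{i+1})$), such that the bottoms $b_1,\dots,b_w$ are weakly decreasing and then weakly increasing, and there are indices $i<j<k$ such that $t_1\le\dots\le t_i$, $t_i\ge\dots\ge t_j$, $t_j\le\dots\le t_k$, $t_k\ge\dots\ge t_w$, and $\min(t_i,t_k)-t_j=m$. For such a polygon with MBR of width $w$ and height $h$, half the number of horizontal edges is $w$ and half the number of vertical edges is $h+m$. The identity is between formal power series in $x,y$, with $\Delta^{1/2}$ the power series square root with constant term $1$. *)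

theory Defs
  imports "HOL-Computational_Algebra.Formal_Power_Series"
begin

type_synonym point = "int \<times> int"
type_synonym edge = "point set"

definition horizontal :: "edge \<Rightarrow> bool" where
  "horizontal e \<longleftrightarrow> (\<exists>a b. e = {(a, b), (a + 1, b)})"

definition vertical :: "edge \<Rightarrow> bool" where
  "vertical e \<longleftrightarrow> (\<exists>a b. e = {(a, b), (a, b + 1)})"

definition translate :: "point \<Rightarrow> edge set \<Rightarrow> edge set" where
  "translate v E = (\<lambda>e. (\<lambda>p. (fst p + fst v, snd p + snd v)) ` e) ` E"

definition translation_class :: "edge set \<Rightarrow> edge set set" where
  "translation_class E = range (\<lambda>v. translate v E)"

text \<open>A unit cell is named by its lower left corner.\<close>

definition cell_edges :: "point \<Rightarrow> edge set" where
  "cell_edges = (\<lambda>(a, b).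
     {{(a, b), (a + 1, b)}, {(a, b + 1), (a + 1, b + 1)},
      {(a, b), (a, b + 1)}, {(a + 1, b), (a + 1, b + 1)}})"

text \<open>Every lattice edge is a side of two unit cells; it lies on the boundary of a union of
  cells if exactly one of them belongs to the union.\<close>

definition boundary :: "point set \<Rightarrow> edge set" where
  "boundary C = {e. \<exists>!c. c \<in> C \<and> e \<in> cell_edges c}"

definition column_cells :: "nat \<Rightarrow> (nat \<Rightarrow> int) \<Rightarrow> (nat \<Rightarrow> int) \<Rightarrow> point set" where
  "column_cells w b t = {(int i, h) | i h. i \<in> {1..w} \<and> b i \<le> h \<and> h < t i}"

definition bimodal_profile :: "nat \<Rightarrow> nat \<Rightarrow> (nat \<Rightarrow> int) \<Rightarrow> (nat \<Rightarrow> int) \<Rightarrow> bool" where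
  "bimodal_profile m w b t \<longleftrightarrow>
     (\<forall>i\<in>{1..w}. b i < t i) \<and>
     (\<forall>i\<in>{1..<w}. max (b i) (b (i + 1)) < min (t i) (t (i + 1))) \<and>
     (\<exists>l\<in>{1..w}. antimono_on {1..l} b \<and> mono_on {l..w} b) \<and>
     (\<exists>i j k. 1 \<le> i \<and> i < j \<and> j < k \<and> k \<le> w \<and>
        mono_on {1..i} t \<and> antimono_on {i..j} t \<and>
        mono_on {j..k} t \<and> antimono_on {k..w} t \<and>
        min (t i) (t k) - t j = int m)"

text \<open>Polygons are considered up to translation, so a polygon is a translation class of edge
  sets. As consecutive columns share a full unit side, the boundary is a single simple closed
  lattice walk; it has \<open>2 * w\<close> horizontal and \<open>2 * (h + m)\<close> vertical edges, where
  \<open>w\<close> and \<open>h\<close> are the width and height of its bounding rectangle.\<close>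

definition bimodal_polygons :: "nat \<Rightarrow> edge set set set" where
  "bimodal_polygons m =
     {translation_class (boundary (column_cells w b t)) | w b t. bimodal_profile m w b t}"

definition bimodal_count :: "nat \<Rightarrow> nat \<Rightarrow> nat \<Rightarrow> nat" where
  "bimodal_count m p q = card {P \<in> bimodal_polygons m.
     \<forall>E\<in>P. card {e \<in> E. horizontal e} = 2 * p \<and> card {e \<in> E. vertical e} = 2 * q}"

text \<open>Power series in two variables are power series in \<open>x\<close> whose coefficients are
  power series in \<open>y\<close>.\<close>

definition var_x :: "rat fps fps" where "var_x = fps_X"

definition var_y :: "rat fps fps" where "var_y = fps_const fps_X"

definition bimodal_gf :: "nat \<Rightarrow> rat fps fps" where
  "bimodal_gf m = Abs_fps (\<lambda>p. Abs_fps (\<lambda>q. of_nat (bimodal_count m p q)))"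

definition sqrt_series :: "rat fps fps \<Rightarrow> rat fps fps" where
  "sqrt_series f = (THE g. g ^ 2 = f \<and> fps_nth (fps_nth g 0) 0 = 1)"

definition Delta :: "'a::comm_ring_1 \<Rightarrow> 'a \<Rightarrow> 'a" where
  "Delta x y = 1 - 2 * x - 2 * y - 2 * x * y + x ^ 2 + y ^ 2"

definition A2c :: "'a::comm_ring_1 \<Rightarrow> 'a \<Rightarrow> 'a" where
  "A2c x y =
    - 4 * (1 - x) ^ 11
    + 2 * (1 - x) ^ 9 * (10 + 9 * x) * y
    - 2 * (1 - x) ^ 7 * (20 + 21 * x + 15 * x ^ 2) * y ^ 2
    + (1 - x) ^ 5 * (40 + 17 * x + 18 * x ^ 2 + 21 * x ^ 3) * y ^ 3
    - (1 - x) ^ 3 * (20 - 26 * x - 31 * x ^ 2 - 14 * x ^ 3 + 3 * x ^ 4) * y ^ 4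
    + (1 - x) * (2 + x) * (2 - 13 * x + 5 * x ^ 2 - 7 * x ^ 3 - 3 * x ^ 4) * y ^ 5
    + x * (4 - 11 * x - 3 * x ^ 2 - 5 * x ^ 3 - x ^ 4) * y ^ 6
    + x * (1 + x) ^ 2 * y ^ 7"

definition B2c :: "'a::comm_ring_1 \<Rightarrow> 'a \<Rightarrow> 'a" where
  "B2c x y =
    8 * (1 - x) ^ 18
    - 4 * (1 - x) ^ 16 * (16 + 11 * x) * y
    + 8 * (1 - x) ^ 14 * (28 + 29 * x + 12 * x ^ 2) * y ^ 2
    - 2 * (1 - x) ^ 12 * (224 + 233 * x + 158 * x ^ 2 + 51 * x ^ 3) * y ^ 3
    + 2 * (1 - x) ^ 10 * (280 + 189 * x + 144 * x ^ 2 + 95 * x ^ 3 + 24 * x ^ 4) * y ^ 4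
    - (1 - x) ^ 8 * (448 - 57 * x - 56 * x ^ 2 + 36 * x ^ 4 + x ^ 5) * y ^ 5
    - (1 - x) ^ 6 * (- 224 + 345 * x + 182 * x ^ 2 + 336 * x ^ 3 + 292 * x ^ 4
        + 75 * x ^ 5 + 6 * x ^ 6) * y ^ 6
    + (1 - x) ^ 4 * (- 64 + 265 * x + 30 * x ^ 2 + 128 * x ^ 3 - 496 * x ^ 4
        - 267 * x ^ 5 + 66 * x ^ 6 + 2 * x ^ 7) * y ^ 7
    - (1 - x) ^ 2 * (- 8 + 89 * x - 132 * x ^ 2 - 634 * x ^ 3 - 558 * x ^ 4
        + 593 * x ^ 5 - 248 * x ^ 6 - 64 * x ^ 7 + 2 * x ^ 8) * y ^ 8
    + x * (7 - 236 * x - 476 * x ^ 2 + 962 * x ^ 3 - 388 * x ^ 4 - 296 * x ^ 5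
        + 248 * x ^ 6 - 78 * x ^ 7 + x ^ 8) * y ^ 9
    + x * (13 + 188 * x + 99 * x ^ 2 - 288 * x ^ 3 + 247 * x ^ 4 - 84 * x ^ 5
        + 17 * x ^ 6) * y ^ 10
    - x * (11 + 58 * x - 28 * x ^ 2 + 6 * x ^ 3 + x ^ 4) * y ^ 11
    - (- 3 + x) * x * (1 + x) * y ^ 12"

text \<open>The square root is well defined on \<open>Delta\<close>, and division by a series with
  constant term \<open>1\<close> is genuine division.\<close>

lemma series_divide_mult:
  fixes f g :: "rat fps fps"
  assumes "fps_nth (fps_nth g 0) 0 = 1"
  shows "f / g * g = f"
proof -
  have u: "fps_nth g 0 * inverse (fps_nth g 0) = 1"
    using assms by (simp add: inverse_mult_eq_1')
  have ig: "g * inverse g = 1"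
    by (subst fps_inverse_def) (rule fps_right_inverse[OF u])
  have "fps_nth g 0 \<noteq> 0" using assms by auto
  then have "f / g = f * inverse g" by (rule fps_divide_unit)
  then show ?thesis using ig by (simp add: mult.assoc mult.commute)
qed

lemma sqrt_series_unique:
  fixes g h :: "rat fps fps"
  assumes "g ^ 2 = h ^ 2" "fps_nth (fps_nth g 0) 0 = 1" "fps_nth (fps_nth h 0) 0 = 1"
  shows "g = h"
proof -
  have "g = h \<or> g = - h" using assms(1) by (simp add: power2_eq_iff)
  moreover have "g \<noteq> - h" using assms(2,3) by auto
  ultimately show ?thesis by blast
qed

lemma sqrt_one_plus_X:
  "\<exists>s :: rat fps fps. s ^ 2 = 1 + fps_X \<and> fps_nth s 0 = 1"
proof -
  define r :: "rat fps" where "r = fps_binomial (1/2)"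
  define s :: "rat fps fps" where "s = Abs_fps (\<lambda>n. fps_const (fps_nth r n))"
  have r2: "r * r = 1 + fps_X"
    using fps_binomial_add_mult[of "1/2::rat" "1/2"] by (simp add: r_def fps_binomial_1)
  have hom: "(\<Sum>i\<in>I. fps_const (f i)) = fps_const (sum f I)"
    for f :: "nat \<Rightarrow> rat" and I
    by (induction I rule: infinite_finite_induct) auto
  have "fps_nth (s * s) n = fps_const (fps_nth (r * r) n)" for n
    by (simp add: s_def fps_mult_nth hom)
  then have "s * s = 1 + fps_X"
    unfolding r2 by (intro fps_ext) auto
  moreover have "fps_nth s 0 = 1" by (simp add: s_def r_def)
  ultimately show ?thesis by (auto simp: power2_eq_square)
qed

lemma sqrt_series_Delta:
  "sqrt_series (Delta var_x var_y) ^ 2 = Delta var_x var_y"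
  "fps_nth (fps_nth (sqrt_series (Delta var_x var_y)) 0) 0 = 1"
proof -
  let ?D = "Delta var_x var_y"
  define c :: "rat fps" where "c = 1 - fps_X"
  obtain s :: "rat fps fps" where s: "s ^ 2 = 1 + fps_X" "fps_nth s 0 = 1"
    using sqrt_one_plus_X by blast
  have c: "inverse c * c = 1" by (simp add: c_def inverse_mult_eq_1)
  have cc: "fps_const c * fps_const (inverse c) = 1"
    using c by (simp add: mult.commute)
  have D0: "fps_nth ?D 0 = c ^ 2"
    by (simp add: Delta_def var_x_def var_y_def c_def power2_eq_square algebra_simps
        fps_numeral_fps_const)
  define u where "u = fps_const (inverse c) ^ 2 * ?D - 1"
  have u0: "fps_nth u 0 = 0"
    using c by (simp add: u_def D0 power_mult_distrib[symmetric])
  define g where "g = fps_const c * (s oo u)"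
  have "(s oo u) ^ 2 = (s ^ 2) oo u"
    by (simp add: fps_compose_power[OF u0])
  also have "\<dots> = 1 + u" by (simp add: s fps_compose_add_distrib u0)
  finally have "g ^ 2 = fps_const c ^ 2 * fps_const (inverse c) ^ 2 * ?D"
    by (simp add: g_def power_mult_distrib u_def del: fps_const_mult fps_const_power)
  also have "\<dots> = ?D"
    by (simp only: power_mult_distrib[symmetric] cc) simp
  finally have g: "g ^ 2 = ?D" .
  have g0: "fps_nth (fps_nth g 0) 0 = 1" by (simp add: g_def s c_def)
  have "sqrt_series ?D = g" unfolding sqrt_series_def
    by (rule the_equality) (use g g0 sqrt_series_unique in auto)
  with g g0 show "sqrt_series ?D ^ 2 = ?D" "fps_nth (fps_nth (sqrt_series ?D) 0) 0 = 1"
    by auto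
qed

end

theory Submission
  imports Defs "HOL-Computational_Algebra.Formal_Laurent_Series"
    "HOL-Computational_Algebra.Polynomial_Factorial"
begin

text \<open>Cut a polygon by the horizontal line through the floor of its indent. The rows below the
  line, stacked with the rows of either tower above it, form a convex polygon, and the lower tower
  has exactly \<open>m\<close> rows; conversely any two such stacks that agree below the line and leave a gap
  at it come from a polygon. Adding one row at a time, and remembering only the width of the
  current row and whether either side may still widen, turns this into functional equations
  for series in an extra variable \<open>s\<close> marking that width. They are solved by the kernel
  method: while one side may still widen, the kernel vanishes at
  \<open>s = (1 + x - y - \<Delta>\<^sup>1\<^sup>/\<^sup>2) / 2\<close>, while both may, at \<open>s = x / (1 \<plusminus> v)\<close> with \<open>v\<^sup>2 = y\<close>. Summing the
  two values of the right-hand side at \<open>x / (1 \<plusminus> v)\<close> eliminates the second unknown series,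
  and the rest is an identity between rational functions of \<open>x\<close>, \<open>v\<close> and \<open>\<Delta>\<^sup>1\<^sup>/\<^sup>2\<close>.\<close>

section \<open>Polygons as sets of cells\<close>

text \<open>The depth of the indent compares the heights of columns that may be far apart. Between
  rows it only prescribes the length of the shorter of two lists, so for \<open>m = 2\<close> it
  costs a bounded number of explicit steps; inclusion and exclusion turns it into products of series
  for towers with exactly two and with at least two rows. A side moving outward by any number of
  cells acts on a series as a difference quotient between \<open>s\<close> and \<open>x\<close>,
  which makes the value at \<open>s = x\<close> an unknown. If both sides move, the quotient is
  iterated and there are two unknowns, hence the need for two points. These points are series in
  \<open>x\<close> and \<open>v\<close> but not in \<open>x\<close> and \<open>y\<close>, and
  factors such as \<open>v\<close> and \<open>s\<close> that have to be cancelled are not units; so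
  the equations are mapped injectively into a fraction field after replacing \<open>y\<close> by
  \<open>v ^ 2\<close>. Evaluated at its root, the kernel equation for one side yields only the
  value at \<open>s = x\<close>. The next stage also needs the series at the root itself, where that
  equation degenerates, so a linear factor is divided out before evaluating.\<close>

definition shift :: "point \<Rightarrow> point set \<Rightarrow> point set" where
  "shift v C = (\<lambda>p. (fst p + fst v, snd p + snd v)) ` C"

definition bottoms :: "point set \<Rightarrow> nat" where
  "bottoms C = card {c \<in> C. (fst c, snd c - 1) \<notin> C}"

definition lefts :: "point set \<Rightarrow> nat" where
  "lefts C = card {c \<in> C. (fst c - 1, snd c) \<notin> C}"

lemma mem_shift: "(a, b) \<in> shift v C \<longleftrightarrow> (a - fst v, b - snd v) \<in> C"
proof
  assume "(a - fst v, b - snd v) \<in> C"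
  then show "(a, b) \<in> shift v C"
    unfolding shift_def by (rule rev_image_eqI) simp
qed (auto simp: shift_def)

section \<open>Lattice edges and the two cells beside them\<close>

lemma horizontal_edge_eq:
  "{(a, b), (a + 1, b)} = {(c, d), (c + 1, d)} \<longleftrightarrow> c = a \<and> d = b" for a b c d :: int
  unfolding doubleton_eq_iff prod.inject by presburger

lemma vertical_edge_eq:
  "{(a, b), (a, b + 1)} = {(c, d), (c, d + 1)} \<longleftrightarrow> c = a \<and> d = b" for a b c d :: int
  unfolding doubleton_eq_iff prod.inject by presburger

lemma horizontal_neq_vertical:
  "{(a, b), (a + 1, b)} \<noteq> {(c, d), (c, d + 1)}" for a b c d :: int
  unfolding doubleton_eq_iff prod.inject by presburger

lemma horizontal_in_cell:
  "{(a, b), (a + 1, b)} \<in> cell_edges c \<longleftrightarrow> c = (a, b) \<or> c = (a, b - 1)"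
proof (cases c)
  case (Pair p q)
  show ?thesis unfolding Pair cell_edges_def case_prod_conv insert_iff empty_iff
      horizontal_edge_eq prod.inject by (auto simp: horizontal_neq_vertical)
qed

lemma vertical_in_cell:
  "{(a, b), (a, b + 1)} \<in> cell_edges c \<longleftrightarrow> c = (a, b) \<or> c = (a - 1, b)"
proof (cases c)
  case (Pair p q)
  show ?thesis unfolding Pair cell_edges_def case_prod_conv insert_iff empty_iff
      vertical_edge_eq prod.inject by (auto simp: horizontal_neq_vertical[symmetric])
qed

lemma ex1_mem_pair: "p \<noteq> q \<Longrightarrow> (\<exists>!c. c \<in> C \<and> (c = p \<or> c = q)) \<longleftrightarrow> (p \<in> C) \<noteq> (q \<in> C)"
  by (cases "p \<in> C"; cases "q \<in> C"; simp; blast)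

lemma horizontal_boundary:
  "{(a, b), (a + 1, b)} \<in> boundary C \<longleftrightarrow> ((a, b) \<in> C) \<noteq> ((a, b - 1) \<in> C)"
  unfolding boundary_def mem_Collect_eq horizontal_in_cell by (rule ex1_mem_pair) simp

lemma vertical_boundary:
  "{(a, b), (a, b + 1)} \<in> boundary C \<longleftrightarrow> ((a, b) \<in> C) \<noteq> ((a - 1, b) \<in> C)"
  unfolding boundary_def mem_Collect_eq vertical_in_cell by (rule ex1_mem_pair) simp

lemma boundary_cases:
  assumes "e \<in> boundary C"
  obtains a b where "e = {(a, b), (a + 1, b)}" | a b where "e = {(a, b), (a, b + 1)}"
proof -
  obtain a b where "e \<in> cell_edges (a, b)" using assms unfolding boundary_def by fast
  then consider "e = {(a, b), (a + 1, b)}" | "e = {(a, b + 1), (a + 1, b + 1)}"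
    | "e = {(a, b), (a, b + 1)}" | "e = {(a + 1, b), (a + 1, b + 1)}"
    unfolding cell_edges_def by auto
  then show ?thesis by cases (rule that; assumption)+
qed

text \<open>If a vertical edge lies on both boundaries or on neither, the two cells beside it are
  both in the symmetric difference or both outside. So the symmetric difference is closed under
  steps to the left, and a finite set with this property is empty.\<close>

lemma boundary_inj:
  assumes "finite C" "finite C'" "boundary C = boundary C'"
  shows "C = C'"
proof (rule ccontr)
  assume "C \<noteq> C'"
  define S where "S = {c. (c \<in> C) \<noteq> (c \<in> C')}"
  have fin: "finite S" by (rule finite_subset[of _ "C \<union> C'"]) (use assms in \<open>auto simp: S_def\<close>)
  obtain a b where ab: "(a, b) \<in> S" using \<open>C \<noteq> C'\<close> by (auto simp: S_def)
  have step: "(a - 1, b) \<in> S" if "(a, b) \<in> S" for a b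
    using that vertical_boundary[of a b C] vertical_boundary[of a b C']
    unfolding assms(3) S_def mem_Collect_eq by blast
  have "(a - int n, b) \<in> S" for n
  proof (induction n)
    case (Suc n)
    then show ?case using step[of "a - int n" b] by (simp add: algebra_simps)
  qed (use ab in simp)
  then have "range (\<lambda>n. (a - int n, b)) \<subseteq> S" by auto
  moreover have "infinite (range (\<lambda>n. (a - int n, b)))"
    using finite_imageD[of "\<lambda>n. (a - int n, b)" UNIV] infinite_UNIV_nat
    by (auto simp: inj_on_def)
  ultimately show False using finite_subset[OF _ fin] by blast
qed

lemma translate_boundary: "translate v (boundary C) = boundary (shift v C)"
proof -
  define T where "T = (\<lambda>v p. (fst p + fst v, snd p + snd v) :: point)"
  have TT: "T (- fst v, - snd v) ` T v ` e = e" "T v ` T (- fst v, - snd v) ` e = e" for e v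
    by (simp_all add: T_def image_image)
  have *: "T v ` e \<in> boundary (shift v C)" if "e \<in> boundary C" for e v C
    using that
  proof (cases rule: boundary_cases)
    case (1 a b)
    have im: "T v ` {(a, b), (a + 1, b)} = {(a + fst v, b + snd v), (a + fst v + 1, b + snd v)}"
      by (simp add: T_def algebra_simps)
    have "b + snd v - 1 - snd v = b - 1" by simp
    then show ?thesis
      using that horizontal_boundary[of a b C]
        horizontal_boundary[of "a + fst v" "b + snd v" "shift v C"]
      unfolding 1 im mem_shift by simp
  next
    case (2 a b)
    have im: "T v ` {(a, b), (a, b + 1)} = {(a + fst v, b + snd v), (a + fst v, b + snd v + 1)}"
      by (simp add: T_def algebra_simps)
    have "a + fst v - 1 - fst v = a - 1" by simp
    then show ?thesis
      using that vertical_boundary[of a b C]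
        vertical_boundary[of "a + fst v" "b + snd v" "shift v C"]
      unfolding 2 im mem_shift by simp
  qed
  have undo: "shift (- fst v, - snd v) (shift v C) = C"
    by (auto simp: mem_shift)
  have sup: "e \<in> (`) (T v) ` boundary C" if "e \<in> boundary (shift v C)" for e
    using *[OF that, of "(- fst v, - snd v)"] TT(2)[of v e] unfolding undo by (metis imageI)
  have sub: "(`) (T v) ` boundary C \<subseteq> boundary (shift v C)"
    using *[of _ C v] by (simp add: image_subset_iff)
  have "translate v (boundary C) = (`) (T v) ` boundary C"
    by (simp add: translate_def T_def)
  also have "\<dots> = boundary (shift v C)"
    using sub subsetI[of _ "(`) (T v) ` boundary C", OF sup] by (rule subset_antisym)
  finally show ?thesis .
qed

lemma finite_shift: "finite C \<Longrightarrow> finite (shift v C)"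
  by (simp add: shift_def)

lemma shift_shift: "shift u (shift v C) = shift (fst u + fst v, snd u + snd v) C"
  by (auto simp: mem_shift algebra_simps)

lemma card_shift: "card (shift v C) = card C"
  unfolding shift_def by (rule card_image) (simp add: inj_on_def prod_eq_iff)

lemma bottoms_shift: "bottoms (shift v C) = bottoms C"
proof -
  have eq: "p - 1 - q = p - q - 1" for p q :: int by simp
  have "c \<in> {c \<in> shift v C. (fst c, snd c - 1) \<notin> shift v C}
      \<longleftrightarrow> c \<in> shift v {c \<in> C. (fst c, snd c - 1) \<notin> C}" for c
    by (cases c) (simp add: mem_shift eq)
  then have "{c \<in> shift v C. (fst c, snd c - 1) \<notin> shift v C}
      = shift v {c \<in> C. (fst c, snd c - 1) \<notin> C}"
    by (rule set_eqI)
  then show ?thesis unfolding bottoms_def by (simp add: card_shift)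
qed

lemma lefts_shift: "lefts (shift v C) = lefts C"
proof -
  have eq: "p - 1 - q = p - q - 1" for p q :: int by simp
  have "c \<in> {c \<in> shift v C. (fst c - 1, snd c) \<notin> shift v C}
      \<longleftrightarrow> c \<in> shift v {c \<in> C. (fst c - 1, snd c) \<notin> C}" for c
    by (cases c) (simp add: mem_shift eq)
  then have "{c \<in> shift v C. (fst c - 1, snd c) \<notin> shift v C}
      = shift v {c \<in> C. (fst c - 1, snd c) \<notin> C}"
    by (rule set_eqI)
  then show ?thesis unfolding lefts_def by (simp add: card_shift)
qed

section \<open>Half-perimeters as numbers of cells\<close>

lemma card_filter_split:
  assumes "finite A"
  shows "card A = card {c \<in> A. P c} + card {c \<in> A. \<not> P c}"
  using assms by (subst card_Un_disjoint[symmetric]) (auto intro!: arg_cong[of _ _ card])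

text \<open>Along every line in direction \<open>d\<close>, a finite set is entered as often as it is left.\<close>

lemma card_boundary_dir:
  fixes d :: point
  assumes "finite C" "d \<noteq> (0, 0)"
  defines "m \<equiv> (\<lambda>c. (fst c - fst d, snd c - snd d))"
  shows "card {c. (c \<in> C) \<noteq> (m c \<in> C)} = 2 * card {c \<in> C. m c \<notin> C}"
proof -
  have inj: "inj m" by (auto simp: m_def inj_def prod_eq_iff)
  have fin: "finite {c. m c \<in> C}"
    using finite_vimageI[OF assms(1) inj] by (simp add: vimage_def)
  have "card {c. m c \<in> C} = card C"
  proof -
    have "m ` {c. m c \<in> C} = C"
    proof -
      have "c \<in> m ` {c. m c \<in> C}" if "c \<in> C" for c
        by (rule image_eqI[of _ _ "(fst c + fst d, snd c + snd d)"]) (use that in \<open>auto simp: m_def\<close>)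
      then show ?thesis by auto
    qed
    then show ?thesis by (metis card_image inj inj_on_subset subset_UNIV)
  qed
  moreover have "card {c. m c \<in> C} = card {c. m c \<in> C \<and> c \<in> C} + card {c. m c \<in> C \<and> c \<notin> C}"
    using card_filter_split[OF fin, of "\<lambda>c. c \<in> C"] by simp
  moreover have "card C = card {c. m c \<in> C \<and> c \<in> C} + card {c \<in> C. m c \<notin> C}"
    using card_filter_split[OF assms(1), of "\<lambda>c. m c \<in> C"] by (simp add: conj_commute)
  moreover have "card {c. (c \<in> C) \<noteq> (m c \<in> C)}
      = card {c \<in> C. m c \<notin> C} + card {c. m c \<in> C \<and> c \<notin> C}"
  proof -
    have "finite {c. (c \<in> C) \<noteq> (m c \<in> C)}"
      by (rule finite_subset[of _ "C \<union> {c. m c \<in> C}"]) (use assms(1) fin in auto)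
    from card_filter_split[OF this, of "\<lambda>c. c \<in> C"] show ?thesis
      by (smt (verit) Collect_cong mem_Collect_eq)
  qed
  ultimately show ?thesis by simp
qed

text \<open>An edge is named by its left endpoint, which is also the name of the cell above it. It
  is on the boundary if exactly one of this cell and the cell below belongs to \<open>C\<close>, and
  by \<open>card_boundary_dir\<close> half of these edges are lower sides.\<close>

lemma card_horizontal:
  assumes "finite C"
  shows "card {e \<in> boundary C. horizontal e} = 2 * bottoms C"
proof -
  have "{e \<in> boundary C. horizontal e}
      = (\<lambda>c. {c, (fst c + 1, snd c)}) ` {c. (c \<in> C) \<noteq> ((fst c, snd c - 1) \<in> C)}"
  proof (intro set_eqI iffI)
    fix e assume "e \<in> {e \<in> boundary C. horizontal e}"
    then obtain a b where "e = {(a, b), (a + 1, b)}" "e \<in> boundary C"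
      by (auto simp: horizontal_def)
    then show "e \<in> (\<lambda>c. {c, (fst c + 1, snd c)}) ` {c. (c \<in> C) \<noteq> ((fst c, snd c - 1) \<in> C)}"
      using horizontal_boundary[of a b C] by (intro image_eqI[of _ _ "(a, b)"]) auto
  qed (auto simp: horizontal_boundary horizontal_def; intro exI; rule refl)
  moreover have "inj_on (\<lambda>c :: point. {c, (fst c + 1, snd c)}) A" for A
    by (auto simp: inj_on_def doubleton_eq_iff)
  ultimately show ?thesis
    using card_boundary_dir[of C "(0, 1)"] assms by (simp add: card_image bottoms_def)
qed

lemma card_vertical:
  assumes "finite C"
  shows "card {e \<in> boundary C. vertical e} = 2 * lefts C"
proof -
  have "{e \<in> boundary C. vertical e}
      = (\<lambda>c. {c, (fst c, snd c + 1)}) ` {c. (c \<in> C) \<noteq> ((fst c - 1, snd c) \<in> C)}"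
  proof (intro set_eqI iffI)
    fix e assume "e \<in> {e \<in> boundary C. vertical e}"
    then obtain a b where "e = {(a, b), (a, b + 1)}" "e \<in> boundary C"
      by (auto simp: vertical_def)
    then show "e \<in> (\<lambda>c. {c, (fst c, snd c + 1)}) ` {c. (c \<in> C) \<noteq> ((fst c - 1, snd c) \<in> C)}"
      using vertical_boundary[of a b C] by (intro image_eqI[of _ _ "(a, b)"]) auto
  qed (auto simp: vertical_boundary vertical_def; intro exI; rule refl)
  moreover have "inj_on (\<lambda>c :: point. {c, (fst c, snd c + 1)}) A" for A
    by (auto simp: inj_on_def doubleton_eq_iff)
  ultimately show ?thesis
    using card_boundary_dir[of C "(1, 0)"] assms by (simp add: card_image lefts_def)
qed

section \<open>Translation classes\<close>

definition cell_class :: "point set \<Rightarrow> edge set set" where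
  "cell_class C = translation_class (boundary C)"

lemma cell_class_eq_iff:
  assumes "finite C" "finite C'"
  shows "cell_class C = cell_class C' \<longleftrightarrow> (\<exists>v. C' = shift v C)"
proof
  assume "cell_class C = cell_class C'"
  moreover have "boundary C' \<in> cell_class C'"
    unfolding cell_class_def translation_class_def
    by (rule range_eqI[of _ _ "(0, 0)"]) (simp add: translate_def)
  ultimately have "boundary C' \<in> cell_class C" by simp
  then obtain v where "boundary C' = boundary (shift v C)"
    unfolding cell_class_def translation_class_def translate_boundary by (rule rangeE)
  then show "\<exists>v. C' = shift v C" using boundary_inj assms finite_shift by blast
next
  assume "\<exists>v. C' = shift v C"
  then obtain v where v: "C' = shift v C" ..
  have "range (\<lambda>u. boundary (shift u C)) = range (\<lambda>u. boundary (shift u C'))"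
  proof (intro set_eqI iffI; elim rangeE)
    fix e u assume "e = boundary (shift u C)"
    then show "e \<in> range (\<lambda>u. boundary (shift u C'))"
      by (intro range_eqI[of _ _ "(fst u - fst v, snd u - snd v)"]) (simp add: v shift_shift)
  next
    fix e u assume "e = boundary (shift u C')"
    then show "e \<in> range (\<lambda>u. boundary (shift u C))"
      by (simp add: v shift_shift)
  qed
  then show "cell_class C = cell_class C'"
    unfolding cell_class_def translation_class_def translate_boundary .
qed

text \<open>All members of the class have the same counts, so the condition on every
  \<open>E\<close> in \<open>bimodal_count\<close> is a condition on one representative.\<close>

lemma cell_class_counts:
  assumes "finite C"
  shows "(\<forall>E\<in>cell_class C. card {e \<in> E. horizontal e} = 2 * p \<and> card {e \<in> E. vertical e} = 2 * q)
    \<longleftrightarrow> bottoms C = p \<and> lefts C = q"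
  unfolding cell_class_def translation_class_def translate_boundary
  by (auto simp: card_horizontal card_vertical finite_shift assms bottoms_shift lefts_shift)

section \<open>Columns and rows\<close>

text \<open>Weakly falling and then weakly rising, said without naming the turning point: this form
  passes to subintervals and reflections at once. The indices are \<open>a\<close>, ...,
  \<open>n - 1\<close>, so ranges of columns are half-open like the columns themselves.\<close>

definition quasiconvex :: "int \<Rightarrow> int \<Rightarrow> (int \<Rightarrow> int) \<Rightarrow> bool" where
  "quasiconvex a n f \<longleftrightarrow>
     (\<forall>c d e. a \<le> c \<longrightarrow> c \<le> d \<longrightarrow> d \<le> e \<longrightarrow> e < n \<longrightarrow> f d \<le> max (f c) (f e))"

definition quasiconcave :: "int \<Rightarrow> int \<Rightarrow> (int \<Rightarrow> int) \<Rightarrow> bool" where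
  "quasiconcave a n f \<longleftrightarrow>
     (\<forall>c d e. a \<le> c \<longrightarrow> c \<le> d \<longrightarrow> d \<le> e \<longrightarrow> e < n \<longrightarrow> min (f c) (f e) \<le> f d)"

definition overlapping :: "int \<Rightarrow> int \<Rightarrow> (int \<Rightarrow> int) \<Rightarrow> (int \<Rightarrow> int) \<Rightarrow> bool" where
  "overlapping a n b t \<longleftrightarrow> (\<forall>c. a \<le> c \<longrightarrow> c < n \<longrightarrow> b c < t c) \<and>
     (\<forall>c. a \<le> c \<longrightarrow> c + 1 < n \<longrightarrow> b c < t (c + 1) \<and> b (c + 1) < t c)"

definition convex_profile :: "int \<Rightarrow> int \<Rightarrow> (int \<Rightarrow> int) \<Rightarrow> (int \<Rightarrow> int) \<Rightarrow> bool" where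
  "convex_profile a n b t \<longleftrightarrow>
     a < n \<and> overlapping a n b t \<and> quasiconvex a n b \<and> quasiconcave a n t"

definition region :: "int \<Rightarrow> int \<Rightarrow> (int \<Rightarrow> int) \<Rightarrow> (int \<Rightarrow> int) \<Rightarrow> point set" where
  "region a n b t = {(c, h). a \<le> c \<and> c < n \<and> b c \<le> h \<and> h < t c}"

lemma mem_region: "(c, h) \<in> region a n b t \<longleftrightarrow> a \<le> c \<and> c < n \<and> b c \<le> h \<and> h < t c"
  by (simp add: region_def)

text \<open>The columns between one that reaches down to \<open>h\<close> and one that reaches above \<open>k\<close>
  cannot all miss the band, because adjacent columns overlap.\<close>

lemma overlapping_cross_right:
  assumes "overlapping a n b t" "k \<le> h + 1" "a \<le> c" "c \<le> e" "e < n" "b c \<le> h" "k < t e"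
  shows "\<exists>d. c \<le> d \<and> d \<le> e \<and> b d \<le> h \<and> k < t d"
  using assms(4,5,7)
proof (induction e rule: int_ge_induct)
  case base
  then show ?case using assms(6) by auto
next
  case (step e)
  show ?case
  proof (cases "b (e + 1) \<le> h")
    case True
    then show ?thesis using step.prems step.hyps by (intro exI[of _ "e + 1"]) auto
  next
    case False
    moreover have "b (e + 1) < t e"
      using assms(1,3) step.hyps step.prems unfolding overlapping_def by auto
    ultimately have "k < t e" using assms(2) by linarith
    then have "\<exists>d. c \<le> d \<and> d \<le> e \<and> b d \<le> h \<and> k < t d"
      using step by (cases "c = e") auto
    then show ?thesis by force
  qed
qed

text \<open>Negation maps the indices \<open>a\<close>, ..., \<open>n - 1\<close> onto
  \<open>1 - n\<close>, ..., \<open>- a\<close>, which explains the new bounds \<open>1 - n\<close>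
  and \<open>1 - a\<close>.\<close>

lemma overlapping_mirror:
  assumes "overlapping a n b t"
  shows "overlapping (1 - n) (1 - a) (\<lambda>c. b (- c)) (\<lambda>c. t (- c))"
  unfolding overlapping_def
proof (intro conjI allI impI)
  fix c assume "1 - n \<le> c" "c < 1 - a"
  then show "b (- c) < t (- c)" using assms unfolding overlapping_def by auto
next
  fix c assume "1 - n \<le> c" "c + 1 < 1 - a"
  then have "a \<le> - c - 1" "- c - 1 + 1 < n" by linarith+
  then have "b (- c - 1) < t (- c - 1 + 1)" "b (- c - 1 + 1) < t (- c - 1)"
    using assms unfolding overlapping_def by blast+
  moreover have "- c - 1 + 1 = - c" "- (c + 1) = - c - 1" by linarith+
  ultimately show "b (- c) < t (- (c + 1))" "b (- (c + 1)) < t (- c)" by metis+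
qed

lemma quasiconvex_mirror:
  assumes "quasiconvex a n f" shows "quasiconvex (1 - n) (1 - a) (\<lambda>c. f (- c))"
  unfolding quasiconvex_def
proof (intro allI impI)
  fix c d e assume "1 - n \<le> c" "c \<le> d" "d \<le> e" "e < 1 - a"
  then have "f (- d) \<le> max (f (- e)) (f (- c))"
    using assms[unfolded quasiconvex_def, rule_format, of "- e" "- d" "- c"] by linarith
  then show "f (- d) \<le> max (f (- c)) (f (- e))" by linarith
qed

lemma quasiconcave_mirror:
  assumes "quasiconcave a n f" shows "quasiconcave (1 - n) (1 - a) (\<lambda>c. f (- c))"
  unfolding quasiconcave_def
proof (intro allI impI)
  fix c d e assume "1 - n \<le> c" "c \<le> d" "d \<le> e" "e < 1 - a"
  then have "min (f (- e)) (f (- c)) \<le> f (- d)"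
    using assms[unfolded quasiconcave_def, rule_format, of "- e" "- d" "- c"] by linarith
  then show "min (f (- c)) (f (- e)) \<le> f (- d)" by linarith
qed

lemma convex_profile_mirror:
  "convex_profile a n b t \<Longrightarrow> convex_profile (1 - n) (1 - a) (\<lambda>c. b (- c)) (\<lambda>c. t (- c))"
  unfolding convex_profile_def
  using overlapping_mirror quasiconvex_mirror quasiconcave_mirror by auto

lemma obtain_argmin:
  fixes f :: "int \<Rightarrow> int"
  assumes "a < n"
  obtains c where "a \<le> c" "c < n" "\<And>d. a \<le> d \<Longrightarrow> d < n \<Longrightarrow> f c \<le> f d"
proof -
  have "Min (f ` {a..<n}) \<in> f ` {a..<n}" by (rule Min_in) (use assms in auto)
  then obtain c where "c \<in> {a..<n}" "f c = Min (f ` {a..<n})" by auto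
  then show ?thesis using that[of c] by auto
qed

lemma obtain_argmax:
  fixes f :: "int \<Rightarrow> int"
  assumes "a < n"
  obtains c where "a \<le> c" "c < n" "\<And>d. a \<le> d \<Longrightarrow> d < n \<Longrightarrow> f d \<le> f c"
  using obtain_argmin[OF assms, of "\<lambda>c. - f c"] by auto

text \<open>Rows are intervals because between two cells of a row the bottoms stay below and the
  tops above it, by quasiconvexity and quasiconcavity. The rest comes from finding, between two
  given columns, one that contains prescribed rows: a single row gives nonemptiness and the shape of
  the row ends, two adjacent rows give the overlap.\<close>

theorem convex_profile_transpose:
  assumes "convex_profile a n b t"
  shows "\<exists>A N l r. convex_profile A N l r \<and>
    (\<forall>c h. (c, h) \<in> region a n b t \<longleftrightarrow> (h, c) \<in> region A N l r)"
proof -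
  have ov: "overlapping a n b t" and qb: "quasiconvex a n b" and qt: "quasiconcave a n t"
    and an: "a < n"
    using assms by (auto simp: convex_profile_def)
  have bt: "b c < t c" if "a \<le> c" "c < n" for c using ov that by (auto simp: overlapping_def)
  obtain p where p: "a \<le> p" "p < n" "\<And>d. a \<le> d \<Longrightarrow> d < n \<Longrightarrow> b p \<le> b d"
    using obtain_argmin[OF an] by blast
  obtain q where q: "a \<le> q" "q < n" "\<And>d. a \<le> d \<Longrightarrow> d < n \<Longrightarrow> t d \<le> t q"
    using obtain_argmax[OF an] by blast
  define R where "R h = {c. a \<le> c \<and> c < n \<and> b c \<le> h \<and> h < t c}" for h
  define l where "l h = Min (R h)" for h
  define r where "r h = Max (R h) + 1" for h
  have fin: "finite (R h)" for h
    by (rule finite_subset[of _ "{a..<n}"]) (auto simp: R_def)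
  \<comment> \<open>The columns \<open>c\<close> and \<open>e\<close> may come in either order; the
    case \<open>e < c\<close> is the mirror image. This is used with \<open>k = h\<close> and with
    \<open>k = h + 1\<close>.\<close>
  have cross: "\<exists>d. min c e \<le> d \<and> d \<le> max c e \<and> d \<in> R h \<and> d \<in> R k"
    if "c \<in> R i" "e \<in> R j" "i \<le> h" "h \<le> k" "k \<le> h + 1" "k \<le> j" for c e h k i j
  proof -
    have be: "b c \<le> h" "b e \<le> j" "k < t e" "a \<le> c" "c < n" "a \<le> e" "e < n"
      using that by (auto simp: R_def)
    have "\<exists>d. min c e \<le> d \<and> d \<le> max c e \<and> a \<le> d \<and> d < n \<and> b d \<le> h \<and> k < t d"
    proof (cases "c \<le> e")
      case True
      then show ?thesis
        using overlapping_cross_right[OF ov that(5), of c e] be by auto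
    next
      case False
      then have "\<exists>d. - c \<le> d \<and> d \<le> - e \<and> b (- d) \<le> h \<and> k < t (- d)"
        using overlapping_cross_right[OF overlapping_mirror[OF ov] that(5), of "- c" "- e"] be by auto
      then obtain d where "- c \<le> d" "d \<le> - e" "b (- d) \<le> h" "k < t (- d)" by blast
      then show ?thesis using be False by (intro exI[of _ "- d"]) auto
    qed
    then show ?thesis using that by (auto simp: R_def)
  qed
  have pR: "p \<in> R (b p)" and qR: "q \<in> R (t q - 1)" using p q bt by (auto simp: R_def)
  have ne: "R h \<noteq> {}" if "b p \<le> h" "h < t q" for h
    using cross[OF pR qR, of h h] that by auto
  have lr: "l h \<in> R h" "r h - 1 \<in> R h" if "b p \<le> h" "h < t q" for h
    using Min_in[OF fin ne[OF that]] Max_in[OF fin ne[OF that]] by (auto simp: l_def r_def)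
  have bounds: "l h \<le> c" "c < r h" if "c \<in> R h" for c h
    using Min_le[OF fin that] Max_ge[OF fin that] by (auto simp: l_def r_def)
  have R_iff: "c \<in> R h \<longleftrightarrow> b p \<le> h \<and> h < t q \<and> l h \<le> c \<and> c < r h" for c h
  proof
    assume "c \<in> R h"
    moreover from this have "b p \<le> h" "h < t q"
      using p(3)[of c] q(3)[of c] by (auto simp: R_def)
    ultimately show "b p \<le> h \<and> h < t q \<and> l h \<le> c \<and> c < r h" using bounds by blast
  next
    assume h: "b p \<le> h \<and> h < t q \<and> l h \<le> c \<and> c < r h"
    then have "l h \<in> R h" "r h - 1 \<in> R h" using lr by blast+
    moreover from this have "b c \<le> max (b (l h)) (b (r h - 1))" "min (t (l h)) (t (r h - 1)) \<le> t c"
      using qb[unfolded quasiconvex_def, rule_format, of "l h" c "r h - 1"]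
        qt[unfolded quasiconcave_def, rule_format, of "l h" c "r h - 1"] h
      by (auto simp: R_def)
    ultimately show "c \<in> R h" using h by (auto simp: R_def)
  qed
  have "convex_profile (b p) (t q) l r"
    unfolding convex_profile_def overlapping_def quasiconvex_def quasiconcave_def
  proof (intro conjI allI impI)
    show "b p < t q" using bt[OF p(1,2)] q(3)[OF p(1,2)] by linarith
  next
    fix h assume "b p \<le> h" "h < t q"
    then show "l h < r h" using lr(1) bounds(2) by blast
  next
    fix h assume h: "b p \<le> h" "h + 1 < t q"
    obtain d where "d \<in> R h" "d \<in> R (h + 1)"
      using cross[OF lr(1)[of h] lr(1)[of "h + 1"], of h "h + 1"] h by auto
    then show "l h < r (h + 1)" "l (h + 1) < r h" using bounds by (meson order_le_less_trans)+
  next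
    \<comment> \<open>Some column between \<open>l i\<close> and \<open>l j\<close> meets row
      \<open>h\<close>, so \<open>l h\<close> is at most the larger of the two. The last cells
      \<open>r i - 1\<close> and \<open>r j - 1\<close> give the other bound.\<close>
    fix i h j assume h: "b p \<le> i" "i \<le> h" "h \<le> j" "j < t q"
    obtain d where "d \<in> R h" "d \<le> max (l i) (l j)"
      using cross[OF lr(1)[of i] lr(1)[of j], of h h] h by auto
    then show "l h \<le> max (l i) (l j)" using bounds(1)[of d h] by linarith
    obtain d where "d \<in> R h" "min (r i - 1) (r j - 1) \<le> d"
      using cross[OF lr(2)[of i] lr(2)[of j], of h h] h by auto
    then show "min (r i) (r j) \<le> r h" using bounds(2)[of d h] by linarith
  qed
  moreover have "(c, h) \<in> region a n b t \<longleftrightarrow> (h, c) \<in> region (b p) (t q) l r" for c h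
    using R_iff[of c h] unfolding mem_region by (auto simp: R_def)
  ultimately show ?thesis by blast
qed

section \<open>Cutting a polygon at the floor of its indent\<close>

definition bimodal_columns ::
    "nat \<Rightarrow> int \<Rightarrow> int \<Rightarrow> int \<Rightarrow> (int \<Rightarrow> int) \<Rightarrow> (int \<Rightarrow> int) \<Rightarrow> bool" where
  "bimodal_columns m a n j b t \<longleftrightarrow>
     a \<le> j \<and> j < n \<and> overlapping a n b t \<and> quasiconvex a n b \<and>
     quasiconcave a (j + 1) t \<and> quasiconcave j n t \<and>
     (\<exists>i k. a \<le> i \<and> i \<le> j \<and> j \<le> k \<and> k < n \<and>
        (\<forall>c. a \<le> c \<longrightarrow> c \<le> j \<longrightarrow> t c \<le> t i) \<and>
        (\<forall>c. j \<le> c \<longrightarrow> c < n \<longrightarrow> t c \<le> t k) \<and>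
        min (t i) (t k) = t j + int m)"

text \<open>The rows of a polygon cut at the height \<open>v\<close> of its valley: together with the rows below
  the valley, either tower forms a convex polygon.\<close>

definition two_towers ::
    "nat \<Rightarrow> int \<Rightarrow> int \<Rightarrow> int \<Rightarrow> int \<Rightarrow> (int \<Rightarrow> int) \<Rightarrow> (int \<Rightarrow> int) \<Rightarrow> (int \<Rightarrow> int) \<Rightarrow> (int \<Rightarrow> int) \<Rightarrow> bool"
  where
  "two_towers m A v N N' l r l' r' \<longleftrightarrow>
     convex_profile A N l r \<and> convex_profile A N' l' r' \<and> A < v \<and> v < N \<and> v < N' \<and>
     (\<forall>h. A \<le> h \<longrightarrow> h < v \<longrightarrow> l h = l' h \<and> r h = r' h) \<and>
     r v < l' v \<and> min N N' = v + int m"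

text \<open>Above the floor \<open>t j\<close> only the columns left of \<open>j\<close> are kept.
  Capping the others at the floor empties those that start at or above it; as \<open>b\<close> is
  quasiconvex and below the floor at \<open>j\<close>, these form a final segment, which is
  dropped.\<close>

lemma convex_profile_left_part:
  assumes "a \<le> j" "j < n" "overlapping a n b t" "quasiconvex a n b"
    "quasiconcave a (j + 1) t" "quasiconcave j n t"
  obtains e t' where "convex_profile a e b t'"
    "\<And>c h. (c, h) \<in> region a e b t' \<longleftrightarrow> (c, h) \<in> region a n b t \<and> (c < j \<or> h < t j)"
proof -
  define v where "v = t j"
  define t' where "t' c = (if c < j then t c else min (t c) v)" for c
  define S where "S = {c. j \<le> c \<and> c < n \<and> b c < v}"
  define e where "e = Max S + 1"
  have bt: "b c < t c" if "a \<le> c" "c < n" for c using assms(3) that by (auto simp: overlapping_def)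
  have ov: "b c < t (c + 1)" "b (c + 1) < t c" if "a \<le> c" "c + 1 < n" for c
    using assms(3) that by (auto simp: overlapping_def)
  have fin: "finite S" by (rule finite_subset[of _ "{j..<n}"]) (auto simp: S_def)
  have jS: "j \<in> S" using bt[of j] assms(1,2) by (simp add: S_def v_def)
  have eS: "e - 1 \<in> S" using Max_in[OF fin] jS by (auto simp: e_def)
  have e: "j < e" "e \<le> n" using Max_ge[OF fin jS] eS by (auto simp: e_def S_def)
  have low: "b c < v \<longleftrightarrow> c < e" if "j \<le> c" "c < n" for c
  proof
    assume "b c < v"
    then show "c < e" using that Max_ge[OF fin, of c] by (simp add: S_def e_def)
  next
    assume "c < e"
    then have "b c \<le> max (b j) (b (e - 1))"
      using assms(4)[unfolded quasiconvex_def, rule_format, of j c "e - 1"] assms(1) that e by auto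
    then show "b c < v" using jS eS by (auto simp: S_def)
  qed
  have "convex_profile a e b t'"
    unfolding convex_profile_def overlapping_def quasiconvex_def quasiconcave_def
  proof (intro conjI allI impI)
    show "a < e" using assms e by simp
  next
    fix c assume "a \<le> c" "c < e"
    then show "b c < t' c" using bt[of c] low[of c] e by (auto simp: t'_def)
  next
    fix c assume c: "a \<le> c" "c + 1 < e"
    then show "b c < t' (c + 1)" "b (c + 1) < t' c"
      using ov[of c] low[of c] low[of "c + 1"] bt[of j] e assms(1,2)
      by (cases "c + 1 = j"; force simp: t'_def v_def)+
  next
    fix c d f assume "a \<le> c" "c \<le> d" "d \<le> f" "f < e"
    then show "b d \<le> max (b c) (b f)"
      using assms(4) e unfolding quasiconvex_def by auto
  next
    fix c d f assume cdf: "a \<le> c" "c \<le> d" "d \<le> f" "f < e"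
    have 1: "min (t c) (t f) \<le> t d" if "f \<le> j"
      using assms(5) cdf that unfolding quasiconcave_def by auto
    have 2: "min (t c) (t j) \<le> t d" if "d \<le> j"
      using assms(5) cdf that unfolding quasiconcave_def by auto
    have 3: "min (t c) (t f) \<le> t d" if "j \<le> c"
      using assms(6) cdf that e unfolding quasiconcave_def by auto
    have 4: "min (t j) (t f) \<le> t d" if "j \<le> d"
      using assms(6) cdf that e assms(2) unfolding quasiconcave_def by auto
    \<comment> \<open>The cap matters only from \<open>j\<close> on. Each position of
      \<open>c\<close>, \<open>d\<close>, \<open>f\<close> relative to \<open>j\<close> needs the
      shape of \<open>t\<close> on one side of \<open>j\<close>, with \<open>j\<close> standing in
      for an index on the other side.\<close>
    consider "f < j" | "d < j" "j \<le> f" | "c < j" "j \<le> d" | "j \<le> c" using cdf by linarith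
    then show "min (t' c) (t' f) \<le> t' d"
      by cases (use 1 2 3 4 cdf in \<open>simp_all add: t'_def v_def, linarith+\<close>)
  qed
  moreover have "(c, h) \<in> region a e b t' \<longleftrightarrow> (c, h) \<in> region a n b t \<and> (c < j \<or> h < t j)" for c h
    using low[of c] e by (auto simp: mem_region t'_def v_def)
  ultimately show ?thesis using that by blast
qed

text \<open>The reflection of the left part. It exchanges the two halves on which \<open>t\<close>
  is quasiconcave, hence the order \<open>q2\<close>, \<open>q1\<close>.\<close>

lemma convex_profile_right_part:
  assumes "a \<le> j" "j < n" "overlapping a n b t" "quasiconvex a n b"
    "quasiconcave a (j + 1) t" "quasiconcave j n t"
  obtains e t' where "convex_profile e n b t'"
    "\<And>c h. (c, h) \<in> region e n b t' \<longleftrightarrow> (c, h) \<in> region a n b t \<and> (j < c \<or> h < t j)"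
proof -
  have ov: "overlapping (1 - n) (1 - a) (\<lambda>c. b (- c)) (\<lambda>c. t (- c))"
    using overlapping_mirror[OF assms(3)] .
  have qb: "quasiconvex (1 - n) (1 - a) (\<lambda>c. b (- c))"
    using quasiconvex_mirror[OF assms(4)] .
  have q1: "quasiconcave (- j) (1 - a) (\<lambda>c. t (- c))"
    using quasiconcave_mirror[OF assms(5)] by simp
  have q2: "quasiconcave (1 - n) (- j + 1) (\<lambda>c. t (- c))"
    using quasiconcave_mirror[OF assms(6)] by simp
  have j: "1 - n \<le> - j" "- j < 1 - a" using assms(1,2) by linarith+
  obtain e t' where e: "convex_profile (1 - n) e (\<lambda>c. b (- c)) t'"
    "\<And>c h. (c, h) \<in> region (1 - n) e (\<lambda>c. b (- c)) t' \<longleftrightarrow>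
      (c, h) \<in> region (1 - n) (1 - a) (\<lambda>c. b (- c)) (\<lambda>c. t (- c)) \<and> (c < - j \<or> h < t (- (- j)))"
    using convex_profile_left_part[OF j ov qb q2 q1] by blast
  have "convex_profile (1 - e) n b (\<lambda>c. t' (- c))"
    using convex_profile_mirror[OF e(1)] by simp
  moreover have "(c, h) \<in> region (1 - e) n b (\<lambda>c. t' (- c)) \<longleftrightarrow>
      (c, h) \<in> region a n b t \<and> (j < c \<or> h < t j)" for c h
    using e(2)[of "- c" h] unfolding mem_region by auto
  ultimately show ?thesis using that by blast
qed

lemma int_interval_eq:
  fixes a b c d :: int
  assumes "a < b" "\<And>x. a \<le> x \<and> x < b \<longleftrightarrow> c \<le> x \<and> x < d"
  shows "a = c \<and> b = d"
  using assms(1) assms(2)[of a] assms(2)[of c] assms(2)[of "b - 1"] assms(2)[of "d - 1"] by linarith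

text \<open>The two parts are transposed separately. They contain the same cells below the floor, so
  their rows agree there, and each part is as high as the largest top on its side. A positive depth
  makes both maxima exceed \<open>t j\<close>, so that \<open>i < j < k\<close> holds although
  \<open>bimodal_columns\<close> asks only for weak inequalities.\<close>

theorem bimodal_columns_two_towers:
  assumes "bimodal_columns m a n j b t" "0 < m"
  obtains A v N N' l r l' r' where "two_towers m A v N N' l r l' r'"
    "\<And>c h. (c, h) \<in> region a n b t \<longleftrightarrow> (h, c) \<in> region A N l r \<or> (h, c) \<in> region A N' l' r'"
proof -
  have cols: "a \<le> j" "j < n" "overlapping a n b t" "quasiconvex a n b"
    "quasiconcave a (j + 1) t" "quasiconcave j n t"
    using assms(1) by (auto simp: bimodal_columns_def)
  obtain i k where ik: "a \<le> i" "i \<le> j" "j \<le> k" "k < n"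
    "\<And>c. a \<le> c \<Longrightarrow> c \<le> j \<Longrightarrow> t c \<le> t i" "\<And>c. j \<le> c \<Longrightarrow> c < n \<Longrightarrow> t c \<le> t k"
    "min (t i) (t k) = t j + int m"
    using assms(1) unfolding bimodal_columns_def by blast
  define v where "v = t j"
  have ti: "v < t i" "v < t k" using ik(7) assms(2) by (auto simp: v_def)
  then have ij: "i < j" "j < k" using ik(2,3) by (auto simp: v_def order_less_le)
  have bt: "b c < t c" if "a \<le> c" "c < n" for c
    using cols(3) that by (auto simp: overlapping_def)
  obtain e1 t1 where L: "convex_profile a e1 b t1"
    "\<And>c h. (c, h) \<in> region a e1 b t1 \<longleftrightarrow> (c, h) \<in> region a n b t \<and> (c < j \<or> h < v)"
    using convex_profile_left_part[OF cols] unfolding v_def by blast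
  obtain e2 t2 where R: "convex_profile e2 n b t2"
    "\<And>c h. (c, h) \<in> region e2 n b t2 \<longleftrightarrow> (c, h) \<in> region a n b t \<and> (j < c \<or> h < v)"
    using convex_profile_right_part[OF cols] unfolding v_def by blast
  obtain A N l r where T: "convex_profile A N l r"
    "\<And>c h. (c, h) \<in> region a n b t \<and> (c < j \<or> h < v) \<longleftrightarrow> (h, c) \<in> region A N l r"
    using convex_profile_transpose[OF L(1)] unfolding L(2) by blast
  obtain A' N' l' r' where T': "convex_profile A' N' l' r'"
    "\<And>c h. (c, h) \<in> region a n b t \<and> (j < c \<or> h < v) \<longleftrightarrow> (h, c) \<in> region A' N' l' r'"
    using convex_profile_transpose[OF R(1)] unfolding R(2) by blast
  have lr: "l h < r h" if "A \<le> h" "h < N" for h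
    using T(1) that by (auto simp: convex_profile_def overlapping_def)
  have lr': "l' h < r' h" if "A' \<le> h" "h < N'" for h
    using T'(1) that by (auto simp: convex_profile_def overlapping_def)
  have AN: "A < N" "A' < N'" using T(1) T'(1) by (auto simp: convex_profile_def)
  have base: "(j, v - 1) \<in> region a n b t" using bt[of j] cols by (auto simp: mem_region v_def)
  then have Av: "A < v" "A' < v" "v \<le> N" "v \<le> N'"
    using T(2)[of j "v - 1"] T'(2)[of j "v - 1"] by (auto simp: mem_region)
  have bottom: "(h, c) \<in> region A N l r \<longleftrightarrow> (h, c) \<in> region A' N' l' r'" if "h < v" for c h
    using T(2)[of c h] T'(2)[of c h] that by auto
  have AA: "A = A'"
    using bottom[OF Av(1), of "l A"] bottom[OF Av(2), of "l' A'"] lr[of A] lr'[of A'] AN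
    by (auto simp: mem_region)
  have eq: "l h = l' h \<and> r h = r' h" if "A \<le> h" "h < v" for h
  proof (rule int_interval_eq)
    show "l h < r h" using lr[of h] that Av by simp
  next
    fix c show "l h \<le> c \<and> c < r h \<longleftrightarrow> l' h \<le> c \<and> c < r' h"
      using bottom[OF that(2), of c] that Av AA by (auto simp: mem_region)
  qed
  have "(i, t i - 1) \<in> region a n b t" using bt[of i] ik cols by (auto simp: mem_region)
  then have "t i - 1 < N" using T(2)[of i "t i - 1"] ij by (auto simp: mem_region)
  moreover have "N - 1 < t i"
  proof -
    have "(l (N - 1), N - 1) \<in> region a n b t \<and> (l (N - 1) < j \<or> N - 1 < v)"
      unfolding T(2) using lr[of "N - 1"] AN by (auto simp: mem_region)
    then show ?thesis using ti ik(5)[of "l (N - 1)"] by (auto simp: mem_region)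
  qed
  ultimately have N: "N = t i" by simp
  have "(k, t k - 1) \<in> region a n b t" using bt[of k] ik cols by (auto simp: mem_region)
  then have "t k - 1 < N'" using T'(2)[of k "t k - 1"] ij by (auto simp: mem_region)
  moreover have "N' - 1 < t k"
  proof -
    have "(l' (N' - 1), N' - 1) \<in> region a n b t \<and> (j < l' (N' - 1) \<or> N' - 1 < v)"
      unfolding T'(2) using lr'[of "N' - 1"] AN by (auto simp: mem_region)
    then show ?thesis using ti ik(6)[of "l' (N' - 1)"] by (auto simp: mem_region)
  qed
  ultimately have N': "N' = t k" by simp
  \<comment> \<open>Column \<open>j\<close> stops at the floor: row \<open>v\<close> of the left
    part ends before it, and row \<open>v\<close> of the right part begins after it.\<close>
  have "(r v - 1, v) \<in> region a n b t \<and> (r v - 1 < j \<or> v < v)"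
    unfolding T(2) using lr[of v] Av N ti by (auto simp: mem_region)
  moreover have "(l' v, v) \<in> region a n b t \<and> (j < l' v \<or> v < v)"
    unfolding T'(2) using lr'[of v] Av N' ti by (auto simp: mem_region)
  ultimately have gap: "r v < l' v" by auto
  have "two_towers m A v N N' l r l' r'"
    unfolding two_towers_def using T(1) T'(1) AA Av eq gap ti ik(7) N N' by (auto simp: v_def)
  moreover have "(c, h) \<in> region a n b t \<longleftrightarrow> (h, c) \<in> region A N l r \<or> (h, c) \<in> region A N' l' r'"
    for c h
  proof -
    have "c < j \<or> h < v \<or> j < c" if "(c, h) \<in> region a n b t"
      using that by (auto simp: mem_region v_def)
    then show ?thesis using T(2)[of c h] T'(2)[of c h] AA by auto
  qed
  ultimately show ?thesis using that by blast
qed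

text \<open>Row \<open>v - 1\<close> reaches under the other tower, beyond \<open>r v\<close>. So
  the right end of the left tower has already moved inward at row \<open>v\<close>, and
  quasiconcavity forbids it to move out again. The left end of the right tower behaves in the same
  way.\<close>

lemma two_towers_separated:
  assumes "two_towers m A v N N' l r l' r'"
  shows "l (v - 1) < r v" "l' v < r' (v - 1)"
    and "\<And>h. v \<le> h \<Longrightarrow> h < N \<Longrightarrow> r h \<le> r v"
    and "\<And>h. v \<le> h \<Longrightarrow> h < N' \<Longrightarrow> l' v \<le> l' h"
proof -
  have P: "convex_profile A N l r" "convex_profile A N' l' r'" and Av: "A < v" "v < N" "v < N'"
    and eq: "l (v - 1) = l' (v - 1)" "r (v - 1) = r' (v - 1)" and gap: "r v < l' v"
    using assms by (auto simp: two_towers_def)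
  have v: "A \<le> v - 1" "v - 1 + 1 < N" "v - 1 + 1 < N'" using Av by auto
  have "l (v - 1) < r (v - 1 + 1)"
    using P(1) v unfolding convex_profile_def overlapping_def by blast
  then show 1: "l (v - 1) < r v" by simp
  have "l' (v - 1 + 1) < r' (v - 1)"
    using P(2) v unfolding convex_profile_def overlapping_def by blast
  then show 2: "l' v < r' (v - 1)" by simp
  fix h assume h: "v \<le> h"
  show "r h \<le> r v" if "h < N"
  proof -
    have "min (r (v - 1)) (r h) \<le> r v"
      using P(1) h that Av by (auto simp: convex_profile_def quasiconcave_def)
    then show ?thesis using 2 eq gap by simp
  qed
  show "l' v \<le> l' h" if "h < N'"
  proof -
    have "l' v \<le> max (l' (v - 1)) (l' h)"
      using P(2) h that Av by (auto simp: convex_profile_def quasiconvex_def)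
    then show ?thesis using 1 eq gap by simp
  qed
qed

text \<open>Each part is turned back into columns, and the two are glued along a column under the
  gap: the left part is used up to this column, the right part after it.\<close>

theorem two_towers_bimodal_columns:
  assumes "two_towers m A v N N' l r l' r'"
  obtains a n j b t where "bimodal_columns m a n j b t"
    "\<And>c h. (c, h) \<in> region a n b t \<longleftrightarrow> (h, c) \<in> region A N l r \<or> (h, c) \<in> region A N' l' r'"
proof -
  have P: "convex_profile A N l r" "convex_profile A N' l' r'" and Av: "A < v" "v < N" "v < N'"
    and eq: "\<And>h. A \<le> h \<Longrightarrow> h < v \<Longrightarrow> l h = l' h \<and> r h = r' h"
    and gap: "r v < l' v" and m: "min N N' = v + int m"
    using assms by (auto simp: two_towers_def)
  have lr: "l h < r h" if "A \<le> h" "h < N" for h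
    using P(1) that by (auto simp: convex_profile_def overlapping_def)
  have lr': "l' h < r' h" if "A \<le> h" "h < N'" for h
    using P(2) that by (auto simp: convex_profile_def overlapping_def)
  \<comment> \<open>\<open>r v\<close> is the exclusive end of the first row of the left tower,
    hence the first column under the gap.\<close>
  define j where "j = r v"
  note sep = two_towers_separated[OF assms]
  have j: "l (v - 1) < j" "l' (v - 1) < j" "j < r (v - 1)" "j < r' (v - 1)" "j < l' v"
    using sep(1,2) gap eq[of "v - 1"] Av by (auto simp: j_def)
  have rj: "r h \<le> j" if "v \<le> h" "h < N" for h
    using sep(3)[OF that] by (simp add: j_def)
  have lj: "j < l' h" if "v \<le> h" "h < N'" for h
    using sep(4)[OF that] gap by (simp add: j_def)
  obtain a n b t where C: "convex_profile a n b t"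
    "\<And>c h. (h, c) \<in> region A N l r \<longleftrightarrow> (c, h) \<in> region a n b t"
    using convex_profile_transpose[OF P(1)] by blast
  obtain a' n' b' t' where C': "convex_profile a' n' b' t'"
    "\<And>c h. (h, c) \<in> region A N' l' r' \<longleftrightarrow> (c, h) \<in> region a' n' b' t'"
    using convex_profile_transpose[OF P(2)] by blast
  have bt: "b c < t c" if "a \<le> c" "c < n" for c
    using C(1) that by (auto simp: convex_profile_def overlapping_def)
  have bt': "b' c < t' c" if "a' \<le> c" "c < n'" for c
    using C'(1) that by (auto simp: convex_profile_def overlapping_def)
  have F1: "c < j" if "(c, h) \<in> region a n b t" "v \<le> h" for c h
    using that rj[of h] unfolding C(2)[symmetric] by (auto simp: mem_region)
  have F2: "j < c" if "(c, h) \<in> region a' n' b' t'" "v \<le> h" for c h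
    using that lj[of h] unfolding C'(2)[symmetric] by (auto simp: mem_region)
  have F3: "(c, h) \<in> region a n b t \<longleftrightarrow> (c, h) \<in> region a' n' b' t'" if "h < v" for c h
    using that eq[of h] Av unfolding C(2)[symmetric] C'(2)[symmetric] by (auto simp: mem_region)
  have "(j, v - 1) \<in> region a n b t"
    unfolding C(2)[symmetric] using Av j by (auto simp: mem_region)
  then have jr: "a \<le> j" "j < n" "b j < v" "v \<le> t j" by (auto simp: mem_region)
  have "(j, v - 1) \<in> region a' n' b' t'"
    unfolding C'(2)[symmetric] using Av j by (auto simp: mem_region)
  then have jr': "a' \<le> j" "j < n'" "b' j < v" "v \<le> t' j" by (auto simp: mem_region)
  have tj: "t j = v"
  proof (rule ccontr)
    assume "t j \<noteq> v"
    then have "(j, v) \<in> region a n b t" using jr by (auto simp: mem_region)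
    then show False using F1 by blast
  qed
  have tj': "t' j = v"
  proof (rule ccontr)
    assume "t' j \<noteq> v"
    then have "(j, v) \<in> region a' n' b' t'" using jr' by (auto simp: mem_region)
    then show False using F2 by blast
  qed
  have bb: "b c = b' c" if "a \<le> c" "c < n" "b c < v" "a' \<le> c" "c < n'" "b' c < v" for c
    using F3[of "b c" c] F3[of "b' c" c] that bt[of c] bt'[of c] by (auto simp: mem_region)
  have bj: "b j = b' j" using bb jr jr' by blast
  define B where "B c = (if c \<le> j then b c else b' c)" for c
  define T where "T c = (if c \<le> j then t c else t' c)" for c
  have BT: "B c = b' c" "T c = t' c" if "j \<le> c" for c
    using that bj tj tj' by (auto simp: B_def T_def)
  have BT': "B c = b c" "T c = t c" if "c \<le> j" for c
    using that by (auto simp: B_def T_def)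
  \<comment> \<open>A column of one part that starts below the floor belongs to the other part too,
    with the same bottom, since the parts share all cells below the floor.\<close>
  have share: "a' \<le> c \<and> c < n' \<and> b' c = b c" if "a \<le> c" "c < n" "b c < v" for c
    using F3[of "b c" c] bb[of c] that bt[of c] by (auto simp: mem_region)
  have share': "a \<le> c \<and> c < n \<and> b c = b' c" if "a' \<le> c" "c < n'" "b' c < v" for c
    using F3[of "b' c" c] bb[of c] that bt'[of c] by (auto simp: mem_region)
  have qb: "b d \<le> max (b c) (b e)" if "a \<le> c" "c \<le> d" "d \<le> e" "e < n" for c d e
    using C(1) that by (auto simp: convex_profile_def quasiconvex_def)
  have qb': "b' d \<le> max (b' c) (b' e)" if "a' \<le> c" "c \<le> d" "d \<le> e" "e < n'" for c d e
    using C'(1) that by (auto simp: convex_profile_def quasiconvex_def)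
  have reg: "(c, h) \<in> region a n' B T \<longleftrightarrow>
      (h, c) \<in> region A N l r \<or> (h, c) \<in> region A N' l' r'" for c h
  proof (cases "c \<le> j")
    case True
    have "(c, h) \<in> region a' n' b' t' \<Longrightarrow> (c, h) \<in> region a n b t"
      using F2[of c h] F3[of h c] True by (cases "h < v") auto
    then show ?thesis unfolding C(2) C'(2) using True jr jr' by (auto simp: mem_region BT')
  next
    case False
    have "(c, h) \<in> region a n b t \<Longrightarrow> (c, h) \<in> region a' n' b' t'"
      using F1[of c h] F3[of h c] False by (cases "h < v") auto
    then show ?thesis unfolding C(2) C'(2) using False jr jr' by (auto simp: mem_region BT)
  qed
  have "bimodal_columns m a n' j B T"
    unfolding bimodal_columns_def
  proof (intro conjI)
    show "a \<le> j" "j < n'" using jr jr' by auto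
    show "overlapping a n' B T"
      unfolding overlapping_def
    proof (intro conjI allI impI)
      fix c assume "a \<le> c" "c < n'"
      then show "B c < T c"
        using bt[of c] bt'[of c] jr jr' BT[of c] BT'[of c] by (cases "c \<le> j") auto
    next
      fix c assume c: "a \<le> c" "c + 1 < n'"
      have 1: "b c < t (c + 1) \<and> b (c + 1) < t c" if "c + 1 \<le> j"
        using C(1) c that jr unfolding convex_profile_def overlapping_def by auto
      have 2: "b' c < t' (c + 1) \<and> b' (c + 1) < t' c" if "j \<le> c"
        using C'(1) c that jr' unfolding convex_profile_def overlapping_def by auto
      show "B c < T (c + 1)" "B (c + 1) < T c"
        using 1 2 BT[of c] BT[of "c + 1"] BT'[of c] BT'[of "c + 1"] by (cases "c + 1 \<le> j"; auto)+
    qed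
    show "quasiconvex a n' B"
      unfolding quasiconvex_def
    proof (intro allI impI)
      fix c d e assume cde: "a \<le> c" "c \<le> d" "d \<le> e" "e < n'"
      consider "e \<le> j" | "j \<le> c" | "c < j" "j < e" by linarith
      then show "B d \<le> max (B c) (B e)"
      proof cases
        case 1
        then show ?thesis using qb[of c d e] cde jr BT' by auto
      next
        case 2
        then show ?thesis using qb'[of c d e] cde jr' BT by auto
      next
        case 3
        \<comment> \<open>If \<open>b c < b j\<close>, then column \<open>c\<close> is shared, so
          \<open>c\<close>, \<open>j\<close> and \<open>e\<close> can be compared inside the right
          part; \<open>k2\<close> is the mirror image.\<close>
        have k1: "b' j \<le> b' e" if "b c < b j"
        proof -
          have "a' \<le> c \<and> c < n' \<and> b' c = b c" using share[of c] that 3 jr cde by simp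
          then show ?thesis using qb'[of c j e] 3 cde that bj by auto
        qed
        have k2: "b j \<le> b c" if "b' e < b' j"
        proof -
          have "a \<le> e \<and> e < n \<and> b e = b' e" using share'[of e] that 3 jr' cde by simp
          then show ?thesis using qb[of c j e] 3 cde that bj by auto
        qed
        show ?thesis
        proof (cases "d \<le> j")
          case True
          then have "b d \<le> max (b c) (b j)" using qb[of c d j] cde jr by auto
          then show ?thesis using k1 True 3 bj BT[of e] BT'[of c] BT'[of d] by fastforce
        next
          case False
          then have "b' d \<le> max (b' j) (b' e)" using qb'[of j d e] cde jr' by auto
          then show ?thesis using k2 False 3 bj BT[of e] BT'[of c] BT[of d] by fastforce
        qed
      qed
    qed
    show "quasiconcave a (j + 1) T"
      using C(1) jr BT' unfolding convex_profile_def quasiconcave_def by auto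
    show "quasiconcave j n' T"
      using C'(1) jr' BT unfolding convex_profile_def quasiconcave_def by auto
    show "\<exists>i k. a \<le> i \<and> i \<le> j \<and> j \<le> k \<and> k < n' \<and>
        (\<forall>c. a \<le> c \<longrightarrow> c \<le> j \<longrightarrow> T c \<le> T i) \<and>
        (\<forall>c. j \<le> c \<longrightarrow> c < n' \<longrightarrow> T c \<le> T k) \<and> min (T i) (T k) = T j + int m"
    proof -
      have "(l (N - 1), N - 1) \<in> region a n b t"
        unfolding C(2)[symmetric] using lr[of "N - 1"] Av by (auto simp: mem_region)
      then obtain i where i: "a \<le> i" "i < j" "i < n" "N \<le> t i"
        using F1[of "l (N - 1)" "N - 1"] Av by (auto simp: mem_region)
      have tN: "t c \<le> N" if "a \<le> c" "c < n" for c
      proof -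
        have "(c, t c - 1) \<in> region a n b t" using bt[of c] that by (auto simp: mem_region)
        then show ?thesis unfolding C(2)[symmetric] by (auto simp: mem_region)
      qed
      have "(l' (N' - 1), N' - 1) \<in> region a' n' b' t'"
        unfolding C'(2)[symmetric] using lr'[of "N' - 1"] Av by (auto simp: mem_region)
      then obtain k where k: "a' \<le> k" "j < k" "k < n'" "N' \<le> t' k"
        using F2[of "l' (N' - 1)" "N' - 1"] Av by (auto simp: mem_region)
      have tN': "t' c \<le> N'" if "a' \<le> c" "c < n'" for c
      proof -
        have "(c, t' c - 1) \<in> region a' n' b' t'" using bt'[of c] that by (auto simp: mem_region)
        then show ?thesis unfolding C'(2)[symmetric] by (auto simp: mem_region)
      qed
      have Ti: "T i = N" and Tk: "T k = N'"
        using tN[of i] tN'[of k] i k BT[of k] BT'[of i] by auto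
      have "T c \<le> T i" if "a \<le> c" "c \<le> j" for c
        using tN[of c] that jr Ti BT'(2)[of c] by simp
      moreover have "T c \<le> T k" if "j \<le> c" "c < n'" for c
        using tN'[of c] that jr' Tk BT(2)[of c] by simp
      moreover have "min (T i) (T k) = T j + int m"
        using Ti Tk m tj BT'(2)[of j] by simp
      moreover have "a \<le> i \<and> i \<le> j \<and> j \<le> k \<and> k < n'" using i k by simp
      ultimately show ?thesis by blast
    qed
  qed
  then show ?thesis using that reg by blast
qed

section \<open>Profiles indexed by naturals and by integers\<close>

lemma bimodal_profile_columns:
  assumes "bimodal_profile m w b t"
  obtains j where
    "bimodal_columns m 1 (int w + 1) j (\<lambda>c. b (nat c)) (\<lambda>c. t (nat c))"
    "column_cells w b t = region 1 (int w + 1) (\<lambda>c. b (nat c)) (\<lambda>c. t (nat c))"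
proof -
  obtain p where p: "p \<in> {1..w}" "antimono_on {1..p} b" "mono_on {p..w} b"
    using assms unfolding bimodal_profile_def by blast
  obtain i j k where ijk: "1 \<le> i" "i < j" "j < k" "k \<le> w"
    "mono_on {1..i} t" "antimono_on {i..j} t" "mono_on {j..k} t" "antimono_on {k..w} t"
    "min (t i) (t k) - t j = int m"
    using assms unfolding bimodal_profile_def by blast
  have "bimodal_columns m 1 (int w + 1) (int j) (\<lambda>c. b (nat c)) (\<lambda>c. t (nat c))"
    unfolding bimodal_columns_def
  proof (intro conjI)
    show "1 \<le> int j" "int j < int w + 1" using ijk by auto
    show "overlapping 1 (int w + 1) (\<lambda>c. b (nat c)) (\<lambda>c. t (nat c))"
      unfolding overlapping_def
    proof (intro conjI allI impI)
      fix c :: int assume "1 \<le> c" "c < int w + 1"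
      then have "nat c \<in> {1..w}" by auto
      then show "b (nat c) < t (nat c)" using assms unfolding bimodal_profile_def by blast
    next
      fix c :: int assume c: "1 \<le> c" "c + 1 < int w + 1"
      then have "nat c \<in> {1..<w}" by auto
      then have "max (b (nat c)) (b (nat c + 1)) < min (t (nat c)) (t (nat c + 1))"
        using assms unfolding bimodal_profile_def by blast
      moreover have "nat (c + 1) = nat c + 1" using c by (simp add: nat_add_distrib)
      ultimately show "b (nat c) < t (nat (c + 1))" "b (nat (c + 1)) < t (nat c)" by auto
    qed
    show "quasiconvex 1 (int w + 1) (\<lambda>c. b (nat c))"
      unfolding quasiconvex_def
    proof (intro allI impI)
      fix c d e :: int assume "1 \<le> c" "c \<le> d" "d \<le> e" "e < int w + 1"
      then have "1 \<le> nat c" "nat c \<le> nat d" "nat d \<le> nat e" "nat e \<le> w" by auto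
      then have "b (nat d) \<le> b (nat c) \<or> b (nat d) \<le> b (nat e)"
        using p(2,3) by (cases "nat d \<le> p") (auto simp: monotone_on_def)
      then show "b (nat d) \<le> max (b (nat c)) (b (nat e))" by auto
    qed
    show "quasiconcave 1 (int j + 1) (\<lambda>c. t (nat c))"
      unfolding quasiconcave_def
    proof (intro allI impI)
      fix c d e :: int assume "1 \<le> c" "c \<le> d" "d \<le> e" "e < int j + 1"
      then have "1 \<le> nat c" "nat c \<le> nat d" "nat d \<le> nat e" "nat e \<le> j" by auto
      then have "t (nat c) \<le> t (nat d) \<or> t (nat e) \<le> t (nat d)"
        using ijk(5,6) by (cases "nat d \<le> i") (auto simp: monotone_on_def)
      then show "min (t (nat c)) (t (nat e)) \<le> t (nat d)" by auto
    qed
    show "quasiconcave (int j) (int w + 1) (\<lambda>c. t (nat c))"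
      unfolding quasiconcave_def
    proof (intro allI impI)
      fix c d e :: int assume "int j \<le> c" "c \<le> d" "d \<le> e" "e < int w + 1"
      then have "j \<le> nat c" "nat c \<le> nat d" "nat d \<le> nat e" "nat e \<le> w" by auto
      then have "t (nat c) \<le> t (nat d) \<or> t (nat e) \<le> t (nat d)"
        using ijk(7,8) by (cases "nat d \<le> k") (auto simp: monotone_on_def)
      then show "min (t (nat c)) (t (nat e)) \<le> t (nat d)" by auto
    qed
    have "t (nat c) \<le> t i" if "1 \<le> c" "c \<le> int j" for c
    proof -
      have "1 \<le> nat c" "nat c \<le> j" using that by auto
      then show ?thesis using ijk by (cases "nat c \<le> i") (auto simp: monotone_on_def)
    qed
    moreover have "t (nat c) \<le> t k" if "int j \<le> c" "c < int w + 1" for c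
    proof -
      have "j \<le> nat c" "nat c \<le> w" using that by auto
      then show ?thesis using ijk by (cases "nat c \<le> k") (auto simp: monotone_on_def)
    qed
    ultimately show "\<exists>i k. 1 \<le> i \<and> i \<le> int j \<and> int j \<le> k \<and> k < int w + 1 \<and>
        (\<forall>c. 1 \<le> c \<longrightarrow> c \<le> int j \<longrightarrow> t (nat c) \<le> t (nat i)) \<and>
        (\<forall>c. int j \<le> c \<longrightarrow> c < int w + 1 \<longrightarrow> t (nat c) \<le> t (nat k)) \<and>
        min (t (nat i)) (t (nat k)) = t (nat (int j)) + int m"
      using ijk by (intro exI[of _ "int i"] exI[of _ "int k"]) auto
  qed
  moreover have "column_cells w b t = region 1 (int w + 1) (\<lambda>c. b (nat c)) (\<lambda>c. t (nat c))"
  proof (intro set_eqI iffI)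
    fix x assume "x \<in> column_cells w b t"
    then show "x \<in> region 1 (int w + 1) (\<lambda>c. b (nat c)) (\<lambda>c. t (nat c))"
      by (auto simp: column_cells_def mem_region)
  next
    fix x assume "x \<in> region 1 (int w + 1) (\<lambda>c. b (nat c)) (\<lambda>c. t (nat c))"
    then obtain c h where "x = (c, h)" "1 \<le> c" "c < int w + 1" "b (nat c) \<le> h" "h < t (nat c)"
      by (cases x) (auto simp: mem_region)
    then show "x \<in> column_cells w b t"
      unfolding column_cells_def by (intro CollectI exI[of _ "nat c"] exI[of _ h]) auto
  qed
  ultimately show ?thesis using that by blast
qed

text \<open>The turning points that \<open>bimodal_profile\<close> asks for are positions of
  extrema: a quasiconvex function falls before any of its minima and rises after it. A positive
  depth separates the two maxima strictly from the valley. The shift by \<open>a - 1\<close> makes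
  the columns start at 1.\<close>

lemma columns_bimodal_profile:
  assumes "bimodal_columns m a n j b t" "0 < m"
  obtains w b' t' where "bimodal_profile m w b' t'"
    "region a n b t = shift (a - 1, 0) (column_cells w b' t')"
proof -
  define w where "w = nat (n - a)"
  define b' where "b' i = b (int i + a - 1)" for i
  define t' where "t' i = t (int i + a - 1)" for i
  have aj: "a \<le> j" "j < n" and ov: "overlapping a n b t"
    using assms(1) by (auto simp: bimodal_columns_def)
  have qb: "b d \<le> max (b c) (b e)" if "a \<le> c" "c \<le> d" "d \<le> e" "e < n" for c d e
    using assms(1) that by (auto simp: bimodal_columns_def quasiconvex_def)
  have q1: "min (t c) (t e) \<le> t d" if "a \<le> c" "c \<le> d" "d \<le> e" "e \<le> j" for c d e
    using assms(1) that by (auto simp: bimodal_columns_def quasiconcave_def)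
  have q2: "min (t c) (t e) \<le> t d" if "j \<le> c" "c \<le> d" "d \<le> e" "e < n" for c d e
    using assms(1) that by (auto simp: bimodal_columns_def quasiconcave_def)
  obtain i k where ik: "a \<le> i" "i \<le> j" "j \<le> k" "k < n"
    "\<And>c. a \<le> c \<Longrightarrow> c \<le> j \<Longrightarrow> t c \<le> t i" "\<And>c. j \<le> c \<Longrightarrow> c < n \<Longrightarrow> t c \<le> t k"
    "min (t i) (t k) = t j + int m"
    using assms(1) unfolding bimodal_columns_def by blast
  have "t j < t i" "t j < t k" using ik(7) assms(2) by auto
  then have ij: "i < j" "j < k" using ik(2,3) by (auto simp: order_less_le)
  obtain p where p: "a \<le> p" "p < n" "\<And>d. a \<le> d \<Longrightarrow> d < n \<Longrightarrow> b p \<le> b d"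
    using obtain_argmin[of a n b] order_le_less_trans[OF aj] by blast
  have "bimodal_profile m w b' t'"
    unfolding bimodal_profile_def
  proof (intro conjI)
    show "\<forall>i\<in>{1..w}. b' i < t' i"
    proof
      fix i assume "i \<in> {1..w}"
      then show "b' i < t' i"
        using ov[unfolded overlapping_def, THEN conjunct1, rule_format, of "int i + a - 1"]
        by (auto simp: b'_def t'_def w_def)
    qed
    show "\<forall>i\<in>{1..<w}. max (b' i) (b' (i + 1)) < min (t' i) (t' (i + 1))"
    proof
      fix i assume "i \<in> {1..<w}"
      then have "a \<le> int i + a - 1" "int i + a - 1 + 1 < n" "int i + a < n" by (auto simp: w_def)
      then show "max (b' i) (b' (i + 1)) < min (t' i) (t' (i + 1))"
        using ov[unfolded overlapping_def, THEN conjunct1, rule_format, of "int i + a - 1"]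
          ov[unfolded overlapping_def, THEN conjunct1, rule_format, of "int i + a"]
          ov[unfolded overlapping_def, THEN conjunct2, rule_format, of "int i + a - 1"]
        by (simp add: b'_def t'_def)
    qed
    show "\<exists>l\<in>{1..w}. antimono_on {1..l} b' \<and> mono_on {l..w} b'"
    proof (rule bexI[of _ "nat (p - a + 1)"], intro conjI)
      show "nat (p - a + 1) \<in> {1..w}" using p by (auto simp: w_def)
      show "antimono_on {1..nat (p - a + 1)} b'"
        unfolding monotone_on_def
      proof (intro ballI impI)
        fix x y assume "x \<in> {1..nat (p - a + 1)}" "y \<in> {1..nat (p - a + 1)}" "x \<le> y"
        then have xy: "a \<le> int x + a - 1" "int x + a - 1 \<le> int y + a - 1" "int y + a - 1 \<le> p"
          by auto
        show "b' y \<le> b' x"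
          using qb[OF xy p(2)] p(3)[of "int x + a - 1"] xy p(2) by (simp add: b'_def)
      qed
      show "mono_on {nat (p - a + 1)..w} b'"
        unfolding monotone_on_def
      proof (intro ballI impI)
        fix x y assume "x \<in> {nat (p - a + 1)..w}" "y \<in> {nat (p - a + 1)..w}" "x \<le> y"
        then have xy: "p \<le> int x + a - 1" "int x + a - 1 \<le> int y + a - 1" "int y + a - 1 < n"
          using p by (auto simp: w_def)
        show "b' x \<le> b' y"
          using qb[OF p(1) xy] p(3)[of "int y + a - 1"] xy p(1) by (simp add: b'_def)
      qed
    qed
    show "\<exists>i j k. 1 \<le> i \<and> i < j \<and> j < k \<and> k \<le> w \<and>
        mono_on {1..i} t' \<and> antimono_on {i..j} t' \<and>
        mono_on {j..k} t' \<and> antimono_on {k..w} t' \<and> min (t' i) (t' k) - t' j = int m"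
    proof (rule exI[of _ "nat (i - a + 1)"], rule exI[of _ "nat (j - a + 1)"],
        rule exI[of _ "nat (k - a + 1)"], intro conjI)
      show "1 \<le> nat (i - a + 1)" "nat (i - a + 1) < nat (j - a + 1)"
        "nat (j - a + 1) < nat (k - a + 1)" "nat (k - a + 1) \<le> w"
        using ik(1-4) ij aj by (auto simp: w_def)
      show "mono_on {1..nat (i - a + 1)} t'"
        unfolding monotone_on_def
      proof (intro ballI impI)
        fix x y assume "x \<in> {1..nat (i - a + 1)}" "y \<in> {1..nat (i - a + 1)}" "x \<le> y"
        then have xy: "a \<le> int x + a - 1" "int x + a - 1 \<le> int y + a - 1" "int y + a - 1 \<le> i"
          by auto
        show "t' x \<le> t' y"
          using q1[OF xy ik(2)] ik(5)[of "int x + a - 1"] xy ik(2) by (simp add: t'_def)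
      qed
      show "antimono_on {nat (i - a + 1)..nat (j - a + 1)} t'"
        unfolding monotone_on_def
      proof (intro ballI impI)
        fix x y assume "x \<in> {nat (i - a + 1)..nat (j - a + 1)}"
          "y \<in> {nat (i - a + 1)..nat (j - a + 1)}" "x \<le> y"
        then have xy: "i \<le> int x + a - 1" "int x + a - 1 \<le> int y + a - 1" "int y + a - 1 \<le> j"
          using ik(1-4) aj by auto
        show "t' y \<le> t' x"
          using q1[OF ik(1) xy] ik(5)[of "int y + a - 1"] xy ik(1) by (simp add: t'_def)
      qed
      show "mono_on {nat (j - a + 1)..nat (k - a + 1)} t'"
        unfolding monotone_on_def
      proof (intro ballI impI)
        fix x y assume "x \<in> {nat (j - a + 1)..nat (k - a + 1)}"
          "y \<in> {nat (j - a + 1)..nat (k - a + 1)}" "x \<le> y"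
        then have xy: "j \<le> int x + a - 1" "int x + a - 1 \<le> int y + a - 1" "int y + a - 1 \<le> k"
          using ik(1-4) aj by auto
        show "t' x \<le> t' y"
          using q2[OF xy ik(4)] ik(6)[of "int x + a - 1"] xy ik(4) by (simp add: t'_def)
      qed
      show "antimono_on {nat (k - a + 1)..w} t'"
        unfolding monotone_on_def
      proof (intro ballI impI)
        fix x y assume "x \<in> {nat (k - a + 1)..w}" "y \<in> {nat (k - a + 1)..w}" "x \<le> y"
        then have xy: "k \<le> int x + a - 1" "int x + a - 1 \<le> int y + a - 1" "int y + a - 1 < n"
          using ik(1-4) aj by (auto simp: w_def)
        show "t' y \<le> t' x"
          using q2[OF ik(3) xy] ik(6)[of "int y + a - 1"] xy ik(3) by (simp add: t'_def)
      qed
      show "min (t' (nat (i - a + 1))) (t' (nat (k - a + 1))) - t' (nat (j - a + 1)) = int m"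
        using ik(1-4,7) aj by (simp add: t'_def)
    qed
  qed
  moreover have "region a n b t = shift (a - 1, 0) (column_cells w b' t')"
  proof (intro set_eqI iffI)
    fix x assume "x \<in> region a n b t"
    then obtain c h where x: "x = (c, h)" "a \<le> c" "c < n" "b c \<le> h" "h < t c"
      by (cases x) (auto simp: mem_region)
    have "int (nat (c - (a - 1))) = c - (a - 1)" using x by simp
    moreover have "1 \<le> nat (c - (a - 1)) \<and> nat (c - (a - 1)) \<le> nat (n - a)"
      using x(2,3) by arith
    ultimately have "(c - (a - 1), h) = (int (nat (c - (a - 1))), h) \<and> nat (c - (a - 1)) \<in> {1..w} \<and>
        b' (nat (c - (a - 1))) \<le> h \<and> h < t' (nat (c - (a - 1)))"
      using x by (simp add: w_def b'_def t'_def)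
    then have "(c - (a - 1), h) \<in> column_cells w b' t'"
      unfolding column_cells_def by blast
    then show "x \<in> shift (a - 1, 0) (column_cells w b' t')" by (simp add: x mem_shift)
  next
    fix x assume "x \<in> shift (a - 1, 0) (column_cells w b' t')"
    then obtain c h where x: "x = (c, h)" "(c - (a - 1), h) \<in> column_cells w b' t'"
      by (cases x) (auto simp: mem_shift)
    then obtain i where i: "c - (a - 1) = int i" "i \<in> {1..w}" "b' i \<le> h" "h < t' i"
      unfolding column_cells_def by auto
    then have c: "c = int i + a - 1" by simp
    show "x \<in> region a n b t"
      using i unfolding x(1) mem_region b'_def t'_def w_def c by auto
  qed
  ultimately show ?thesis using that by blast
qed

section \<open>Lists of rows\<close>

fun overlaps :: "int \<times> int \<Rightarrow> (int \<times> int) list \<Rightarrow> bool" where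
  "overlaps p [] \<longleftrightarrow> True"
| "overlaps p (q # rs) \<longleftrightarrow>
     fst q < snd q \<and> fst q < snd p \<and> fst p < snd q \<and> overlaps q rs"

text \<open>\<open>descending X a xs\<close>: the list \<open>a # xs\<close> falls and then rises; once it has risen, \<open>X\<close> is
  false and it may not fall again.\<close>

fun descending :: "bool \<Rightarrow> int \<Rightarrow> int list \<Rightarrow> bool" where
  "descending X a [] \<longleftrightarrow> True"
| "descending X a (b # xs) \<longleftrightarrow> (X \<or> a \<le> b) \<and> descending (X \<and> b \<le> a) b xs"

text \<open>\<open>X\<close> allows the left end and \<open>Y\<close> the right end to move outward
  from the row \<open>p\<close>. A flag is lost at the first strict inward move of its end.\<close>

fun valid :: "bool \<Rightarrow> bool \<Rightarrow> int \<times> int \<Rightarrow> (int \<times> int) list \<Rightarrow> bool" where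
  "valid X Y p [] \<longleftrightarrow> True"
| "valid X Y p (q # rs) \<longleftrightarrow> fst q < snd q \<and> fst q < snd p \<and> fst p < snd q \<and>
     (X \<or> fst p \<le> fst q) \<and> (Y \<or> snd q \<le> snd p) \<and>
     valid (X \<and> fst q \<le> fst p) (Y \<and> snd p \<le> snd q) q rs"

text \<open>Negation turns right ends into left ends.\<close>

lemma valid_iff:
  "valid X Y p rs \<longleftrightarrow> overlaps p rs \<and> descending X (fst p) (map fst rs) \<and>
     descending Y (- snd p) (map (\<lambda>q. - snd q) rs)"
  by (induction rs arbitrary: X Y p) auto

definition list_quasiconvex :: "int list \<Rightarrow> bool" where
  "list_quasiconvex xs \<longleftrightarrow>
     (\<forall>i j k. i \<le> j \<longrightarrow> j \<le> k \<longrightarrow> k < length xs \<longrightarrow> xs ! j \<le> max (xs ! i) (xs ! k))"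

lemma list_quasiconvex_Cons:
  "list_quasiconvex (a # xs) \<longleftrightarrow> list_quasiconvex xs \<and>
     (\<forall>j k. j \<le> k \<longrightarrow> k < length xs \<longrightarrow> xs ! j \<le> max a (xs ! k))"
proof
  assume L: "list_quasiconvex (a # xs)"
  show "list_quasiconvex xs \<and> (\<forall>j k. j \<le> k \<longrightarrow> k < length xs \<longrightarrow> xs ! j \<le> max a (xs ! k))"
    unfolding list_quasiconvex_def
  proof (intro conjI allI impI)
    fix i j k assume "i \<le> j" "j \<le> k" "k < length xs"
    then show "xs ! j \<le> max (xs ! i) (xs ! k)"
      using L[unfolded list_quasiconvex_def, rule_format, of "Suc i" "Suc j" "Suc k"] by simp
  next
    fix j k assume "j \<le> k" "k < length xs"
    then show "xs ! j \<le> max a (xs ! k)"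
      using L[unfolded list_quasiconvex_def, rule_format, of 0 "Suc j" "Suc k"] by simp
  qed
next
  assume R: "list_quasiconvex xs \<and> (\<forall>j k. j \<le> k \<longrightarrow> k < length xs \<longrightarrow> xs ! j \<le> max a (xs ! k))"
  show "list_quasiconvex (a # xs)"
    unfolding list_quasiconvex_def
  proof (intro allI impI)
    fix i j k assume ijk: "i \<le> j" "j \<le> k" "k < length (a # xs)"
    show "(a # xs) ! j \<le> max ((a # xs) ! i) ((a # xs) ! k)"
    proof (cases i)
      case 0
      then show ?thesis using R ijk by (cases j; cases k) auto
    next
      case (Suc i')
      then obtain j' k' where "j = Suc j'" "k = Suc k'" using ijk by (cases j; cases k) auto
      then show ?thesis using R ijk Suc by (simp add: list_quasiconvex_def)
    qed
  qed
qed

text \<open>If \<open>b \<le> a\<close>, every bound involving \<open>a\<close> follows from the one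
  involving \<open>b\<close>. Otherwise the list rises at once, and comparing \<open>b\<close> with
  \<open>a\<close> and a later entry forces \<open>b\<close> to be a minimum of the rest.\<close>

lemma list_quasiconvex_Cons_Cons:
  "list_quasiconvex (a # b # xs) \<longleftrightarrow>
     list_quasiconvex (b # xs) \<and> (b \<le> a \<or> (\<forall>c\<in>set xs. b \<le> c))"
proof (cases "list_quasiconvex (b # xs)")
  case True
  have "(\<forall>j k. j \<le> k \<longrightarrow> k < length (b # xs) \<longrightarrow> (b # xs) ! j \<le> max a ((b # xs) ! k))
      \<longleftrightarrow> (b \<le> a \<or> (\<forall>c\<in>set xs. b \<le> c))" (is "?L \<longleftrightarrow> ?R")
  proof
    assume L: ?L
    show ?R
    proof (cases "b \<le> a")
      case False
      have "\<forall>c\<in>set xs. b \<le> c"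
      proof
        fix c assume "c \<in> set xs"
        then obtain k where "k < length xs" "c = xs ! k" by (metis in_set_conv_nth)
        then show "b \<le> c" using L[rule_format, of 0 "Suc k"] False by simp
      qed
      then show ?thesis ..
    qed simp
  next
    assume R: ?R
    show ?L
    proof (intro allI impI)
      fix j k assume jk: "j \<le> k" "k < length (b # xs)"
      have 1: "(b # xs) ! j \<le> max b ((b # xs) ! k)"
        using True[unfolded list_quasiconvex_def, rule_format, of 0 j k] jk by simp
      have 2: "b \<le> (b # xs) ! k" if "\<not> b \<le> a"
        using R that jk by (cases k) auto
      show "(b # xs) ! j \<le> max a ((b # xs) ! k)" using 1 2 by (cases "b \<le> a") auto
    qed
  qed
  then show ?thesis using True list_quasiconvex_Cons[of a "b # xs"] by simp
qed (simp add: list_quasiconvex_Cons[of a])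

lemma descending_iff:
  "descending X a xs \<longleftrightarrow> list_quasiconvex (a # xs) \<and> (X \<or> (\<forall>b\<in>set xs. a \<le> b))"
proof (induction xs arbitrary: X a)
  case Nil
  then show ?case by (auto simp: list_quasiconvex_def)
next
  case (Cons b xs)
  show ?case
    unfolding descending.simps Cons.IH list_quasiconvex_Cons_Cons by force
qed

lemma overlaps_iff:
  "overlaps p rs \<longleftrightarrow> (\<forall>k<length rs. fst (rs ! k) < snd (rs ! k) \<and>
     fst (rs ! k) < snd ((p # rs) ! k) \<and> fst ((p # rs) ! k) < snd (rs ! k))"
proof (induction rs arbitrary: p)
  case (Cons q rs)
  then show ?case by (simp add: All_less_Suc2)
qed simp

definition profile_list :: "(int \<times> int) list \<Rightarrow> bool" where
  "profile_list xs \<longleftrightarrow>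
     convex_profile 0 (int (length xs)) (\<lambda>h. fst (xs ! nat h)) (\<lambda>h. snd (xs ! nat h))"

lemma quasiconvex_list:
  "quasiconvex 0 (int (length xs)) (\<lambda>h. f (xs ! nat h)) \<longleftrightarrow> list_quasiconvex (map f xs)"
proof
  assume L: "quasiconvex 0 (int (length xs)) (\<lambda>h. f (xs ! nat h))"
  show "list_quasiconvex (map f xs)"
    unfolding list_quasiconvex_def
  proof (intro allI impI)
    fix i j k assume "i \<le> j" "j \<le> k" "k < length (map f xs)"
    then show "map f xs ! j \<le> max (map f xs ! i) (map f xs ! k)"
      using L[unfolded quasiconvex_def, rule_format, of "int i" "int j" "int k"] by simp
  qed
next
  assume R: "list_quasiconvex (map f xs)"
  show "quasiconvex 0 (int (length xs)) (\<lambda>h. f (xs ! nat h))"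
    unfolding quasiconvex_def
  proof (intro allI impI)
    fix c d e :: int assume "0 \<le> c" "c \<le> d" "d \<le> e" "e < int (length xs)"
    then show "f (xs ! nat d) \<le> max (f (xs ! nat c)) (f (xs ! nat e))"
      using R[unfolded list_quasiconvex_def, rule_format, of "nat c" "nat d" "nat e"]
      by (simp add: nat_le_iff nat_less_iff)
  qed
qed

lemma quasiconcave_uminus: "quasiconcave a n f \<longleftrightarrow> quasiconvex a n (\<lambda>c. - f c)"
  unfolding quasiconcave_def quasiconvex_def by (simp add: minus_min_eq_max[symmetric] min_le_iff_disj le_max_iff_disj)

text \<open>A condition on triples of positions becomes one that is checked row by row from the
  bottom, as the recursions for generating functions need. At the bottom both ends may still move
  outward.\<close>

lemma profile_list_Cons:
  "profile_list (p # rs) \<longleftrightarrow> fst p < snd p \<and> valid True True p rs"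
proof -
  have 1: "overlapping 0 (int (length (p # rs))) (\<lambda>h. fst ((p # rs) ! nat h)) (\<lambda>h. snd ((p # rs) ! nat h))
      \<longleftrightarrow> fst p < snd p \<and> overlaps p rs" (is "?L \<longleftrightarrow> ?R")
  proof
    assume L: ?L
    have "fst p < snd p" using L[unfolded overlapping_def, THEN conjunct1, rule_format, of 0] by simp
    moreover have "overlaps p rs"
      unfolding overlaps_iff
    proof (intro allI impI)
      fix k assume "k < length rs"
      moreover have "nat (1 + int k) = Suc k" by simp
      ultimately show "fst (rs ! k) < snd (rs ! k) \<and>
          fst (rs ! k) < snd ((p # rs) ! k) \<and> fst ((p # rs) ! k) < snd (rs ! k)"
        using L[unfolded overlapping_def, THEN conjunct1, rule_format, of "int (Suc k)"]
          L[unfolded overlapping_def, THEN conjunct2, rule_format, of "int k"] by (simp add: add.commute)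
    qed
    ultimately show ?R ..
  next
    assume R: ?R
    show ?L
      unfolding overlapping_def
    proof (intro conjI allI impI)
      fix c :: int assume "0 \<le> c" "c < int (length (p # rs))"
      then obtain k where "c = int k" "k < length (p # rs)" by (metis nonneg_int_cases of_nat_less_iff)
      then show "fst ((p # rs) ! nat c) < snd ((p # rs) ! nat c)"
        using R unfolding overlaps_iff by (cases k) auto
    next
      fix c :: int assume "0 \<le> c" "c + 1 < int (length (p # rs))"
      then obtain k where k: "c = int k" "k < length rs"
        by (metis add.commute add_less_cancel_right length_Cons nonneg_int_cases of_nat_Suc of_nat_less_iff)
      moreover have "nat (int k + 1) = Suc k" by simp
      ultimately show "fst ((p # rs) ! nat c) < snd ((p # rs) ! nat (c + 1))"
        "fst ((p # rs) ! nat (c + 1)) < snd ((p # rs) ! nat c)"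
        using R unfolding overlaps_iff by auto
    qed
  qed
  have 2: "quasiconvex 0 (int (length (p # rs))) (\<lambda>h. fst ((p # rs) ! nat h))
      \<longleftrightarrow> descending True (fst p) (map fst rs)"
    unfolding quasiconvex_list descending_iff by simp
  have 3: "quasiconcave 0 (int (length (p # rs))) (\<lambda>h. snd ((p # rs) ! nat h))
      \<longleftrightarrow> descending True (- snd p) (map (\<lambda>q. - snd q) rs)"
    unfolding quasiconcave_uminus quasiconvex_list[of _ "\<lambda>q. - snd q"] descending_iff by simp
  show ?thesis
    unfolding profile_list_def convex_profile_def 1 2 3 valid_iff by auto
qed

definition row_cells :: "(int \<times> int) list \<Rightarrow> point set" where
  "row_cells xs = {(c, h). 0 \<le> h \<and> nat h < length xs \<and> fst (xs ! nat h) \<le> c \<and> c < snd (xs ! nat h)}"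

lemma mem_row_cells:
  "(c, h) \<in> row_cells xs \<longleftrightarrow>
     0 \<le> h \<and> nat h < length xs \<and> fst (xs ! nat h) \<le> c \<and> c < snd (xs ! nat h)"
  by (simp add: row_cells_def)

lemma row_cells_region:
  "(c, h) \<in> row_cells xs \<longleftrightarrow>
     (h, c) \<in> region 0 (int (length xs)) (\<lambda>h. fst (xs ! nat h)) (\<lambda>h. snd (xs ! nat h))"
  unfolding mem_row_cells mem_region by auto

section \<open>Base and towers as three lists\<close>

definition tower_lists ::
    "nat \<Rightarrow> (int \<times> int) list \<Rightarrow> (int \<times> int) list \<Rightarrow> (int \<times> int) list \<Rightarrow> bool" where
  "tower_lists m bs ls rs \<longleftrightarrow> bs \<noteq> [] \<and> ls \<noteq> [] \<and> rs \<noteq> [] \<and>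
     profile_list (bs @ ls) \<and> profile_list (bs @ rs) \<and>
     snd (hd ls) < fst (hd rs) \<and> min (length ls) (length rs) = m"

definition tower_cells ::
    "(int \<times> int) list \<Rightarrow> (int \<times> int) list \<Rightarrow> (int \<times> int) list \<Rightarrow> point set" where
  "tower_cells bs ls rs = row_cells (bs @ ls) \<union> row_cells (bs @ rs)"

lemma tower_lists_two_towers:
  assumes "tower_lists m bs ls rs"
  shows "two_towers m 0 (int (length bs)) (int (length (bs @ ls))) (int (length (bs @ rs)))
    (\<lambda>h. fst ((bs @ ls) ! nat h)) (\<lambda>h. snd ((bs @ ls) ! nat h))
    (\<lambda>h. fst ((bs @ rs) ! nat h)) (\<lambda>h. snd ((bs @ rs) ! nat h))"
  using assms unfolding two_towers_def tower_lists_def profile_list_def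
  by (auto simp: nth_append hd_conv_nth)

lemma profile_list_map:
  assumes "convex_profile A N l r"
  shows "profile_list (map (\<lambda>k. (l (A + int k) - d, r (A + int k) - d)) [0..<nat (N - A)])"
    (is "profile_list ?xs")
proof -
  have AN: "A < N" using assms by (simp add: convex_profile_def)
  then have len: "int (length ?xs) = N - A" by simp
  have nth: "?xs ! nat h = (l (A + h) - d, r (A + h) - d)" if "0 \<le> h" "h < N - A" for h
    using that by simp
  have ov: "l h < r h" if "A \<le> h" "h < N" for h
    using assms that by (simp add: convex_profile_def overlapping_def)
  have ov2: "l h < r (h + 1) \<and> l (h + 1) < r h" if "A \<le> h" "h + 1 < N" for h
    using assms that by (simp add: convex_profile_def overlapping_def)
  have q: "l h \<le> max (l i) (l j)" "min (r i) (r j) \<le> r h"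
    if "A \<le> i" "i \<le> h" "h \<le> j" "j < N" for i h j
    using assms that by (simp_all add: convex_profile_def quasiconvex_def quasiconcave_def)
  show ?thesis
    unfolding profile_list_def convex_profile_def overlapping_def quasiconvex_def quasiconcave_def len
  proof (intro conjI allI impI)
    show "0 < N - A" using AN by simp
  next
    fix h assume h: "0 \<le> h" "h < N - A"
    show "fst (?xs ! nat h) < snd (?xs ! nat h)"
      unfolding nth[OF h] using ov[of "A + h"] h by simp
  next
    fix h assume h: "0 \<le> h" "h + 1 < N - A"
    have h': "0 \<le> h + 1" "h < N - A" using h by auto
    show "fst (?xs ! nat h) < snd (?xs ! nat (h + 1))" "fst (?xs ! nat (h + 1)) < snd (?xs ! nat h)"
      unfolding nth[OF h(1) h'(2)] nth[OF h'(1) h(2)] using ov2[of "A + h"] h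
      by (simp_all add: add.assoc)
  next
    fix i h j assume h: "0 \<le> i" "i \<le> h" "h \<le> j" "j < N - A"
    then have *: "i < N - A" "0 \<le> h" "h < N - A" "0 \<le> j" by auto
    show "fst (?xs ! nat h) \<le> max (fst (?xs ! nat i)) (fst (?xs ! nat j))"
      "min (snd (?xs ! nat i)) (snd (?xs ! nat j)) \<le> snd (?xs ! nat h)"
      unfolding nth[OF h(1) *(1)] nth[OF *(2,3)] nth[OF *(4) h(4)]
      using q[of "A + i" "A + h" "A + j"] h by auto
  qed
qed

lemma row_cells_map:
  assumes "A \<le> N"
  shows "(c, h) \<in> row_cells (map (\<lambda>k. (l (A + int k) - d, r (A + int k) - d)) [0..<nat (N - A)])
    \<longleftrightarrow> (h + A, c + d) \<in> region A N l r"
proof (cases "0 \<le> h \<and> h < N - A")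
  case True
  then have "nat h < nat (N - A)" by simp
  then show ?thesis using True unfolding mem_row_cells mem_region by (auto simp: add.commute)
next
  case False
  then show ?thesis unfolding mem_row_cells mem_region by auto
qed

text \<open>The translation by \<open>A\<close> and \<open>l A\<close> puts the leftmost cell of the
  bottom row at the origin; this normal form selects one triple of lists in each translation
  class.\<close>

lemma two_towers_tower_lists:
  assumes "two_towers m A v N N' l r l' r'"
  obtains bs ls rs where "tower_lists m bs ls rs" "fst (hd bs) = 0"
    "\<And>c h. (c, h) \<in> tower_cells bs ls rs \<longleftrightarrow>
      (h + A, c + l A) \<in> region A N l r \<or> (h + A, c + l A) \<in> region A N' l' r'"
proof -
  define f where "f = (\<lambda>k. (l (A + int k) - l A, r (A + int k) - l A))"
  define f' where "f' = (\<lambda>k. (l' (A + int k) - l A, r' (A + int k) - l A))"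
  define bs where "bs = map f [0..<nat (v - A)]"
  define ls where "ls = map f [nat (v - A)..<nat (N - A)]"
  define rs where "rs = map f' [nat (v - A)..<nat (N' - A)]"
  have P: "convex_profile A N l r" "convex_profile A N' l' r'" and Av: "A < v" "v < N" "v < N'"
    and eq: "\<And>h. A \<le> h \<Longrightarrow> h < v \<Longrightarrow> l h = l' h \<and> r h = r' h"
    and gap: "r v < l' v" and m: "min N N' = v + int m"
    using assms by (auto simp: two_towers_def)
  have upt: "[0..<nat (M - A)] = [0..<nat (v - A)] @ [nat (v - A)..<nat (M - A)]" if "v < M" for M
    using upt_add_eq_append[of 0 "nat (v - A)" "nat (M - A) - nat (v - A)"] that Av by simp
  have bl: "bs @ ls = map f [0..<nat (N - A)]"
    unfolding bs_def ls_def upt[OF Av(2)] by simp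
  have "bs = map f' [0..<nat (v - A)]"
    unfolding bs_def using eq by (auto simp: f_def f'_def)
  then have br: "bs @ rs = map f' [0..<nat (N' - A)]"
    unfolding rs_def upt[OF Av(3)] by simp
  have ne: "bs \<noteq> []" "ls \<noteq> []" "rs \<noteq> []"
    using Av by (simp_all add: bs_def ls_def rs_def)
  have hd: "hd ls = f (nat (v - A))" "hd rs = f' (nat (v - A))" "hd bs = f 0"
    using Av by (simp_all add: bs_def ls_def rs_def hd_map)
  have "tower_lists m bs ls rs"
    unfolding tower_lists_def bl br
  proof (intro conjI)
    show "snd (hd ls) < fst (hd rs)" using gap Av by (simp add: hd f_def f'_def)
    have "length ls = nat (N - v)" "length rs = nat (N' - v)"
      using Av by (simp_all add: ls_def rs_def)
    then show "min (length ls) (length rs) = m" using m by auto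
  qed (use ne profile_list_map[OF P(1)] profile_list_map[OF P(2)] in \<open>simp_all add: f_def f'_def\<close>)
  moreover have "fst (hd bs) = 0" by (simp add: hd f_def)
  moreover have "(c, h) \<in> tower_cells bs ls rs \<longleftrightarrow>
      (h + A, c + l A) \<in> region A N l r \<or> (h + A, c + l A) \<in> region A N' l' r'" for c h
    unfolding tower_cells_def bl br f_def f'_def Un_iff using row_cells_map[of A N] row_cells_map[of A N'] Av
    by auto
  ultimately show ?thesis using that by blast
qed

section \<open>Half-perimeters of base and towers\<close>

lemma finite_row_cells: "finite (row_cells xs)"
proof -
  have "row_cells xs = (\<Union>k<length xs. (\<lambda>c. (c, int k)) ` {fst (xs ! k)..<snd (xs ! k)})"
    by (force simp: row_cells_def image_iff)
  then show ?thesis by simp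
qed

lemma finite_tower_cells: "finite (tower_cells bs ls rs)"
  by (simp add: tower_cells_def finite_row_cells)

lemma tower_lists_facts:
  assumes "tower_lists m bs ls rs"
  shows "\<And>k. k < length (bs @ ls) \<Longrightarrow> fst ((bs @ ls) ! k) < snd ((bs @ ls) ! k)"
    and "\<And>k. k < length (bs @ rs) \<Longrightarrow> fst ((bs @ rs) ! k) < snd ((bs @ rs) ! k)"
    and "\<And>k. length bs \<le> k \<Longrightarrow> k < length (bs @ ls) \<Longrightarrow> snd ((bs @ ls) ! k) \<le> snd (hd ls)"
    and "\<And>k. length bs \<le> k \<Longrightarrow> k < length (bs @ rs) \<Longrightarrow> snd (hd ls) < fst ((bs @ rs) ! k)"
    and "\<And>k. k < length bs \<Longrightarrow> (bs @ ls) ! k = (bs @ rs) ! k"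
proof -
  have ne: "bs \<noteq> []" "ls \<noteq> []" "rs \<noteq> []" and gap: "snd (hd ls) < fst (hd rs)"
    using assms by (auto simp: tower_lists_def)
  have pos: "\<And>k. k < length xs \<Longrightarrow> fst (xs ! k) < snd (xs ! k)" if "profile_list xs" for xs
  proof -
    fix k assume "k < length xs"
    then show "fst (xs ! k) < snd (xs ! k)"
      using that[unfolded profile_list_def convex_profile_def overlapping_def, THEN conjunct2,
          THEN conjunct1, THEN conjunct1, rule_format, of "int k"] by simp
  qed
  show "\<And>k. k < length (bs @ ls) \<Longrightarrow> fst ((bs @ ls) ! k) < snd ((bs @ ls) ! k)"
    "\<And>k. k < length (bs @ rs) \<Longrightarrow> fst ((bs @ rs) ! k) < snd ((bs @ rs) ! k)"
    using assms pos unfolding tower_lists_def by blast+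
  note sep = two_towers_separated[OF tower_lists_two_towers[OF assms]]
  show "snd ((bs @ ls) ! k) \<le> snd (hd ls)" if "length bs \<le> k" "k < length (bs @ ls)" for k
    using sep(3)[of "int k"] that ne by (simp add: nth_append hd_conv_nth)
  show "snd (hd ls) < fst ((bs @ rs) ! k)" if "length bs \<le> k" "k < length (bs @ rs)" for k
    using sep(4)[of "int k"] that ne gap by (simp add: nth_append hd_conv_nth)
  show "(bs @ ls) ! k = (bs @ rs) ! k" if "k < length bs" for k
    using that by (simp add: nth_append)
qed

text \<open>Every row of the base and of each tower has exactly one cell without left neighbour. The
  towers do not interfere, because the column \<open>snd (hd ls)\<close>, empty above the base, lies
  between them.\<close>

lemma lefts_tower_cells:
  assumes "tower_lists m bs ls rs"
  shows "lefts (tower_cells bs ls rs) = length bs + length ls + length rs"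
proof -
  let ?xs = "bs @ ls" and ?ys = "bs @ rs" and ?n = "length bs" and ?j = "snd (hd ls)"
  note f = tower_lists_facts[OF assms]
  define g where "g xs k = (fst (xs ! k), int k)" for xs :: "(int \<times> int) list" and k
  let ?C = "tower_cells bs ls rs"
  have "{c \<in> ?C. (fst c - 1, snd c) \<notin> ?C} = g ?xs ` {..<length ?xs} \<union> g ?ys ` {?n..<length ?ys}"
  proof (intro set_eqI iffI)
    fix x assume "x \<in> {c \<in> ?C. (fst c - 1, snd c) \<notin> ?C}"
    then obtain c h where x: "x = (c, h)" "(c, h) \<in> ?C" "(c - 1, h) \<notin> ?C" by (cases x) auto
    then obtain k where k: "h = int k" by (auto simp: tower_cells_def mem_row_cells intro: nonneg_int_cases)
    from x(2) consider "(c, h) \<in> row_cells ?xs" | "(c, h) \<in> row_cells ?ys"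
      by (auto simp: tower_cells_def)
    then show "x \<in> g ?xs ` {..<length ?xs} \<union> g ?ys ` {?n..<length ?ys}"
    proof cases
      case 1
      then have "k < length ?xs" "c = fst (?xs ! k)"
        using x(3) k by (auto simp: tower_cells_def mem_row_cells)
      then show ?thesis by (intro UnI1 image_eqI[of _ _ k]) (auto simp: g_def x k)
    next
      case 2
      then have 3: "k < length ?ys" "c = fst (?ys ! k)"
        using x(3) k by (auto simp: tower_cells_def mem_row_cells)
      show ?thesis
      proof (cases "k < ?n")
        case True
        then show ?thesis using f(5)[OF True] 3 by (intro UnI1 image_eqI[of _ _ k]) (auto simp: g_def x k)
      next
        case False
        then show ?thesis using 3 by (intro UnI2 image_eqI[of _ _ k]) (auto simp: g_def x k)
      qed
    qed
  next
    fix x assume "x \<in> g ?xs ` {..<length ?xs} \<union> g ?ys ` {?n..<length ?ys}"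
    then consider k where "k < length ?xs" "x = g ?xs k"
      | k where "?n \<le> k" "k < length ?ys" "x = g ?ys k" by auto
    then show "x \<in> {c \<in> ?C. (fst c - 1, snd c) \<notin> ?C}"
    proof cases
      case 1
      have "\<not> fst (?ys ! k) \<le> fst (?xs ! k) - 1 \<or> \<not> k < length ?ys"
        using f(5)[of k] f(4)[of k] f(3)[of k] f(1)[of k] 1(1) by (cases "k < ?n") auto
      then show ?thesis using 1 f(1)[of k] by (auto simp: g_def tower_cells_def mem_row_cells)
    next
      case 2
      have "\<not> fst (?ys ! k) - 1 < snd (?xs ! k) \<or> \<not> k < length ?xs"
        using f(4)[of k] f(3)[of k] 2 by force
      then show ?thesis using 2 f(2)[of k] by (auto simp: g_def tower_cells_def mem_row_cells)
    qed
  qed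
  moreover have "inj_on (g xs) K" for xs K by (auto simp: inj_on_def g_def)
  moreover have "g ?xs ` {..<length ?xs} \<inter> g ?ys ` {?n..<length ?ys} = {}"
  proof -
    have False if "k < length ?xs" "?n \<le> k" "k < length ?ys" "fst (?xs ! k) = fst (?ys ! k)" for k
      using f(1)[of k] f(3)[of k] f(4)[of k] that by linarith
    then show ?thesis by (auto simp: g_def)
  qed
  ultimately show ?thesis
    unfolding lefts_def by (simp add: card_Un_disjoint card_image)
qed

text \<open>For overlapping rows this is the number of cells of \<open>q\<close> with no cell of
  \<open>p\<close> below, see \<open>card_growth\<close>; the truncating \<open>nat\<close> discards
  inward moves.\<close>

definition growth :: "int \<times> int \<Rightarrow> int \<times> int \<Rightarrow> nat" where
  "growth p q = nat (fst p - fst q) + nat (snd q - snd p)"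

fun weight :: "int \<times> int \<Rightarrow> (int \<times> int) list \<Rightarrow> nat" where
  "weight p [] = 0"
| "weight p (q # rs) = growth p q + weight q rs"

lemma card_growth:
  assumes "fst p < snd p" "fst q < snd p" "fst p < snd q"
  shows "card ({fst q..<snd q} - {fst p..<snd p}) = growth p q"
proof -
  have "{fst q..<snd q} - {fst p..<snd p} = {fst q..<fst p} \<union> {snd p..<snd q}"
    using assms by auto
  moreover have "card ({fst q..<fst p} \<union> {snd p..<snd q}) = growth p q"
    unfolding growth_def by (subst card_Un_disjoint) (use assms in auto)
  ultimately show ?thesis by simp
qed

lemma sum_growth:
  assumes "fst p < snd p" "overlaps p rs"
  shows "(\<Sum>k<length rs. card ({fst (rs ! k)..<snd (rs ! k)} -
    {fst ((p # rs) ! k)..<snd ((p # rs) ! k)})) = weight p rs"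
  using assms
proof (induction rs arbitrary: p)
  case (Cons q rs)
  show ?case
    unfolding length_Cons sum.lessThan_Suc_shift using Cons by (simp add: card_growth)
qed simp

lemma overlaps_append:
  assumes "fst p < snd p" "overlaps p (bs @ rs)"
  shows "overlaps (last (p # bs)) rs" "fst (last (p # bs)) < snd (last (p # bs))"
  using assms by (induction bs arbitrary: p) auto

text \<open>The cell below a cell of one tower can only belong to the same tower or to the base, as
  a column between the towers is empty. So lower sides are counted stack by stack: the base once,
  together with the left tower, and the right tower separately, its first row resting on the last
  base row.\<close>

lemma bottoms_tower_cells:
  assumes "tower_lists m (p # bs) ls rs"
  shows "bottoms (tower_cells (p # bs) ls rs) =
    nat (snd p - fst p) + weight p (bs @ ls) + weight (last (p # bs)) rs"
proof -
  let ?xs = "p # bs @ ls" and ?ys = "p # bs @ rs" and ?n = "length (p # bs)" and ?j = "snd (hd ls)"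
  note f = tower_lists_facts[OF assms, unfolded append_Cons]
  define I where "I q = {fst q..<snd q}" for q :: "int \<times> int"
  \<comment> \<open>Nothing lies below row 0, so all of its cells count; this is the term
    \<open>nat (snd p - fst p)\<close>.\<close>
  define prev where "prev xs k = (if k = 0 then {} else I (xs ! (k - 1)))" for xs k
  define S1 where "S1 = Sigma {..<length ?xs} (\<lambda>k. I (?xs ! k) - prev ?xs k)"
  define S2 where "S2 = Sigma {?n..<length ?ys} (\<lambda>k. I (?ys ! k) - prev ?ys k)"
  define g where "g = (\<lambda>(k, c). (c :: int, int k))"
  let ?C = "tower_cells (p # bs) ls rs"
  have mem: "(c, int k) \<in> ?C \<longleftrightarrow>
      k < length ?xs \<and> c \<in> I (?xs ! k) \<or> k < length ?ys \<and> c \<in> I (?ys ! k)" for c k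
    by (auto simp: tower_cells_def mem_row_cells I_def)
  have left: "c < ?j" if "?n \<le> k" "k < length ?xs" "c \<in> I (?xs ! k)" for c k
    using f(3)[OF that(1,2)] that(3) by (auto simp: I_def)
  have right: "?j < c" if "?n \<le> k" "k < length ?ys" "c \<in> I (?ys ! k)" for c k
    using f(4)[OF that(1,2)] that(3) by (auto simp: I_def)
  have key: "(c, int k) \<in> ?C \<and> (k = 0 \<or> (c, int (k - 1)) \<notin> ?C) \<longleftrightarrow> (k, c) \<in> S1 \<union> S2" for c k
  proof
    assume L: "(c, int k) \<in> ?C \<and> (k = 0 \<or> (c, int (k - 1)) \<notin> ?C)"
    then consider "k < length ?xs" "c \<in> I (?xs ! k)" | "?n \<le> k" "k < length ?ys" "c \<in> I (?ys ! k)"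
      using f(5)[of k] unfolding mem by (cases "k < ?n") auto
    then show "(k, c) \<in> S1 \<union> S2"
    proof cases
      case 1
      then have "c \<notin> prev ?xs k" using L unfolding mem prev_def by auto
      then show ?thesis using 1 by (simp add: S1_def)
    next
      case 2
      then have "c \<notin> prev ?ys k" using L unfolding mem prev_def by auto
      then show ?thesis using 2 by (simp add: S2_def)
    qed
  next
    assume "(k, c) \<in> S1 \<union> S2"
    then consider "k < length ?xs" "c \<in> I (?xs ! k)" "c \<notin> prev ?xs k"
      | "?n \<le> k" "k < length ?ys" "c \<in> I (?ys ! k)" "c \<notin> prev ?ys k"
      unfolding S1_def S2_def by auto
    then show "(c, int k) \<in> ?C \<and> (k = 0 \<or> (c, int (k - 1)) \<notin> ?C)"
    proof cases
      case 1
      have "c \<notin> I (?ys ! (k - 1))" if "k - 1 < length ?ys" "k \<noteq> 0"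
      proof (cases "k - 1 < ?n")
        case True
        then show ?thesis using 1(3) that f(5)[OF True] by (simp add: prev_def)
      next
        case False
        then have "c < ?j" using left[of k c] 1 by simp
        then show ?thesis using right[of "k - 1" c] False that by auto
      qed
      then show ?thesis using 1 unfolding mem by (auto simp: prev_def)
    next
      case 2
      have "c \<notin> I (?xs ! (k - 1))" if "k - 1 < length ?xs" "k \<noteq> 0"
      proof (cases "k - 1 < ?n")
        case True
        then show ?thesis using 2(4) that f(5)[OF True] by (simp add: prev_def)
      next
        case False
        have "?j < c" using right[of k c] 2 by simp
        then show ?thesis using left[of "k - 1" c] False that by auto
      qed
      then show ?thesis using 2 unfolding mem by (auto simp: prev_def)
    qed
  qed
  have "{c \<in> ?C. (fst c, snd c - 1) \<notin> ?C} = g ` (S1 \<union> S2)"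
  proof (intro set_eqI iffI)
    fix x assume "x \<in> {c \<in> ?C. (fst c, snd c - 1) \<notin> ?C}"
    then obtain c h where x: "x = (c, h)" "(c, h) \<in> ?C" "(c, h - 1) \<notin> ?C" by (cases x) auto
    then obtain k where k: "h = int k" by (auto simp: tower_cells_def mem_row_cells intro: nonneg_int_cases)
    have "k = 0 \<or> int (k - 1) = h - 1" using k by auto
    then have "(k, c) \<in> S1 \<union> S2" using x key[of c k] k by auto
    then show "x \<in> g ` (S1 \<union> S2)" by (rule rev_image_eqI) (simp add: g_def x k)
  next
    fix x assume "x \<in> g ` (S1 \<union> S2)"
    then obtain k c where x: "x = (c, int k)" "(k, c) \<in> S1 \<union> S2" by (auto simp: g_def)
    have 1: "(c, int k) \<in> ?C" "k = 0 \<or> (c, int (k - 1)) \<notin> ?C" using x(2) key[of c k] by auto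
    have "(c, int k - 1) \<notin> ?C"
    proof (cases k)
      case 0
      then show ?thesis by (simp add: tower_cells_def mem_row_cells)
    next
      case (Suc k')
      then show ?thesis using 1(2) by simp
    qed
    then show "x \<in> {c \<in> ?C. (fst c, snd c - 1) \<notin> ?C}" using x 1 by simp
  qed
  moreover have "inj_on g (S1 \<union> S2)" by (auto simp: inj_on_def g_def)
  moreover have fin: "finite S1" "finite S2" by (auto simp: S1_def S2_def I_def)
  moreover have "S1 \<inter> S2 = {}"
    using left right by (fastforce simp: S1_def S2_def)
  ultimately have bot: "bottoms ?C = card S1 + card S2"
    unfolding bottoms_def by (simp add: card_image card_Un_disjoint)
  have ov: "overlaps p (bs @ ls)" "overlaps p (bs @ rs)" "fst p < snd p"
    using assms unfolding tower_lists_def by (simp_all add: profile_list_Cons valid_iff)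
  have "card S1 = (\<Sum>k<length ?xs. card (I (?xs ! k) - prev ?xs k))"
    unfolding S1_def by (subst card_SigmaI) (auto simp: I_def)
  also have "\<dots> = card (I p) + (\<Sum>k<length (bs @ ls). card (I ((bs @ ls) ! k) - I (?xs ! k)))"
    unfolding length_Cons sum.lessThan_Suc_shift by (simp add: prev_def)
  also have "\<dots> = nat (snd p - fst p) + weight p (bs @ ls)"
    using sum_growth[OF ov(3,1)] by (simp add: I_def)
  finally have S1: "card S1 = nat (snd p - fst p) + weight p (bs @ ls)" .
  \<comment> \<open>For \<open>k = 0\<close> the row below is the last base row and not a row of
    \<open>rs\<close>.\<close>
  have nth: "?ys ! (k + ?n) = rs ! k" "?ys ! (k + ?n - 1) = (last (p # bs) # rs) ! k" for k
  proof -
    show "?ys ! (k + ?n) = rs ! k" by (simp add: nth_append)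
    show "?ys ! (k + ?n - 1) = (last (p # bs) # rs) ! k"
    proof (cases k)
      case 0
      then show ?thesis using last_conv_nth[of "p # bs"] nth_append[of "p # bs" rs "length bs"] by simp
    next
      case (Suc k')
      then show ?thesis by (simp add: nth_append)
    qed
  qed
  have "card S2 = (\<Sum>k\<in>{?n..<length ?ys}. card (I (?ys ! k) - prev ?ys k))"
    unfolding S2_def by (subst card_SigmaI) (auto simp: I_def)
  also have "\<dots> = (\<Sum>k\<in>{0 + ?n..<length rs + ?n}. card (I (?ys ! k) - prev ?ys k))"
    by (rule arg_cong[of _ _ "sum _"]) (simp add: add.commute)
  also have "\<dots> = (\<Sum>k<length rs. card (I (?ys ! (k + ?n)) - prev ?ys (k + ?n)))"
    unfolding sum.shift_bounds_nat_ivl by (simp add: atLeast0LessThan)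
  also have "\<dots> = (\<Sum>k<length rs. card (I (rs ! k) - I ((last (p # bs) # rs) ! k)))"
    unfolding prev_def nth by simp
  also have "\<dots> = weight (last (p # bs)) rs"
    using sum_growth[OF overlaps_append(2,1)[OF ov(3,2)]] by (simp add: I_def)
  finally have "card S2 = weight (last (p # bs)) rs" .
  with S1 bot show ?thesis by simp
qed

section \<open>Recovering base and towers from the cells\<close>

lemma row_lists_eq:
  fixes xs ys :: "(int \<times> int) list"
  assumes "\<And>k. k < length xs \<Longrightarrow> fst (xs ! k) < snd (xs ! k)"
    "\<And>k. k < length ys \<Longrightarrow> fst (ys ! k) < snd (ys ! k)"
    "\<And>c k. k < length xs \<and> fst (xs ! k) \<le> c \<and> c < snd (xs ! k) \<longleftrightarrow>
      k < length ys \<and> fst (ys ! k) \<le> c \<and> c < snd (ys ! k)"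
  shows "xs = ys"
proof -
  have "k < length xs \<longleftrightarrow> k < length ys" for k
    using assms(1)[of k] assms(2)[of k] assms(3)[of k "fst (xs ! k)"] assms(3)[of k "fst (ys ! k)"]
    by auto
  then have len: "length xs = length ys" by (metis linorder_neq_iff)
  show ?thesis
  proof (rule nth_equalityI[OF len])
    fix k assume k: "k < length xs"
    have "fst (xs ! k) = fst (ys ! k) \<and> snd (xs ! k) = snd (ys ! k)"
      using int_interval_eq[OF assms(1)[OF k]] assms(3)[of k] k len by simp
    then show "xs ! k = ys ! k" by (simp add: prod_eq_iff)
  qed
qed

text \<open>Both stacks can be read off the union once the height of the base and the column
  \<open>snd (hd ls)\<close> are known.\<close>

lemma tower_cells_rows:
  assumes "tower_lists m bs ls rs"
  shows "k < length (bs @ ls) \<and> fst ((bs @ ls) ! k) \<le> c \<and> c < snd ((bs @ ls) ! k) \<longleftrightarrow>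
      (c, int k) \<in> tower_cells bs ls rs \<and> (k < length bs \<or> c < snd (hd ls))"
    and "k < length (bs @ rs) \<and> fst ((bs @ rs) ! k) \<le> c \<and> c < snd ((bs @ rs) ! k) \<longleftrightarrow>
      (c, int k) \<in> tower_cells bs ls rs \<and> (k < length bs \<or> snd (hd ls) < c)"
proof -
  note f = tower_lists_facts[OF assms]
  have len: "k < length bs \<Longrightarrow> k < length (bs @ ls) \<and> k < length (bs @ rs)" by simp
  show "k < length (bs @ ls) \<and> fst ((bs @ ls) ! k) \<le> c \<and> c < snd ((bs @ ls) ! k) \<longleftrightarrow>
      (c, int k) \<in> tower_cells bs ls rs \<and> (k < length bs \<or> c < snd (hd ls))"
    unfolding tower_cells_def Un_iff mem_row_cells
    using f(3)[of k] f(4)[of k] f(5)[of k] len by (cases "k < length bs") force+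
  show "k < length (bs @ rs) \<and> fst ((bs @ rs) ! k) \<le> c \<and> c < snd ((bs @ rs) ! k) \<longleftrightarrow>
      (c, int k) \<in> tower_cells bs ls rs \<and> (k < length bs \<or> snd (hd ls) < c)"
    unfolding tower_cells_def Un_iff mem_row_cells
    using f(3)[of k] f(4)[of k] f(5)[of k] len by (cases "k < length bs") force+
qed

lemma tower_cells_gap:
  assumes "tower_lists m bs ls rs"
  defines "n \<equiv> int (length bs)" and "j \<equiv> snd (hd ls)"
  shows "(j - 1, n) \<in> tower_cells bs ls rs" "(j, n) \<notin> tower_cells bs ls rs"
    "(fst (hd rs), n) \<in> tower_cells bs ls rs" "j < fst (hd rs)"
proof -
  have ne: "ls \<noteq> []" "rs \<noteq> []" and gap: "j < fst (hd rs)"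
    using assms by (auto simp: tower_lists_def)
  have hd: "(bs @ ls) ! length bs = hd ls" "(bs @ rs) ! length bs = hd rs"
    using ne by (auto simp: nth_append hd_conv_nth)
  note f = tower_lists_facts[OF assms(1)]
  show "j < fst (hd rs)" by (fact gap)
  have "fst (hd ls) < j" "fst (hd rs) < snd (hd rs)"
    using f(1)[of "length bs"] f(2)[of "length bs"] ne unfolding hd by (simp_all add: j_def)
  then show "(j - 1, n) \<in> tower_cells bs ls rs" "(fst (hd rs), n) \<in> tower_cells bs ls rs"
    "(j, n) \<notin> tower_cells bs ls rs"
    unfolding tower_cells_def Un_iff mem_row_cells n_def nat_int hd
    using ne gap by (simp_all add: j_def)
qed

text \<open>The base ends below the first row with a gap: if one base were shorter, its gap row
  would have to be an interval of the other base. The gap begins right after the left tower, which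
  fixes \<open>snd (hd ls)\<close>, and then both stacks are determined.\<close>

lemma tower_cells_inj_cells:
  assumes T: "tower_lists m bs ls rs" "tower_lists m bs' ls' rs'"
    and eq: "tower_cells bs ls rs = tower_cells bs' ls' rs'"
  shows "bs = bs' \<and> ls = ls' \<and> rs = rs'"
proof -
  have not_less: "\<not> length bs < length bs'"
    if T: "tower_lists m bs ls rs" "tower_lists m bs' ls' rs'"
      "tower_cells bs ls rs = tower_cells bs' ls' rs'" for bs ls rs bs' ls' rs'
  proof
    assume l: "length bs < length bs'"
    show False
      using tower_cells_gap[OF T(1)] tower_cells_rows(1)[OF T(2), of "length bs" "snd (hd ls) - 1"]
        tower_cells_rows(1)[OF T(2), of "length bs" "snd (hd ls)"]
        tower_cells_rows(1)[OF T(2), of "length bs" "fst (hd rs)"] l unfolding T(3) by auto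
  qed
  have n: "length bs = length bs'"
    using not_less[OF T eq] not_less[OF T(2,1) eq[symmetric]] by simp
  have not_less': "\<not> snd (hd ls) < snd (hd ls')"
    if T: "tower_lists m bs ls rs" "tower_lists m bs' ls' rs'"
      "tower_cells bs ls rs = tower_cells bs' ls' rs'" and n: "length bs = length bs'"
    for bs ls rs bs' ls' rs'
  proof
    assume l: "snd (hd ls) < snd (hd ls')"
    note r = tower_cells_rows(1)[OF T(2), of "length bs"]
    have ne: "ls' \<noteq> []" using T(2) by (simp add: tower_lists_def)
    have hd: "(bs' @ ls') ! length bs = hd ls'" using ne by (simp add: n nth_append hd_conv_nth)
    show False
      using tower_cells_gap(1,2)[OF T(1)] r[of "snd (hd ls) - 1"] r[of "snd (hd ls)"] l ne n
      unfolding T(3) hd by auto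
  qed
  have j: "snd (hd ls) = snd (hd ls')"
    using not_less'[OF T eq n] not_less'[OF T(2,1) eq[symmetric] n[symmetric]] by simp
  have "bs @ ls = bs' @ ls'"
    by (rule row_lists_eq)
      (use tower_lists_facts(1)[OF T(1)] tower_lists_facts(1)[OF T(2)] in blast,
        use tower_lists_facts(1)[OF T(2)] in blast,
        simp only: tower_cells_rows(1)[OF T(1)] tower_cells_rows(1)[OF T(2)] eq n j)
  moreover have "bs @ rs = bs' @ rs'"
    by (rule row_lists_eq)
      (use tower_lists_facts(2)[OF T(1)] in blast, use tower_lists_facts(2)[OF T(2)] in blast,
        simp only: tower_cells_rows(2)[OF T(1)] tower_cells_rows(2)[OF T(2)] eq n j)
  ultimately show ?thesis using n by simp
qed

lemma tower_cells_bottom_row: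
  assumes "tower_lists m bs ls rs" "fst (hd bs) = 0"
  shows "(0, 0) \<in> tower_cells bs ls rs"
    "(c, h) \<in> tower_cells bs ls rs \<Longrightarrow> 0 \<le> h" "(c, 0) \<in> tower_cells bs ls rs \<Longrightarrow> 0 \<le> c"
proof -
  have ne: "bs \<noteq> []" using assms by (simp add: tower_lists_def)
  then have hd: "(bs @ ls) ! 0 = hd bs" "(bs @ rs) ! 0 = hd bs"
    by (simp_all add: nth_append hd_conv_nth)
  have "0 < snd (hd bs)"
    using tower_lists_facts(1)[OF assms(1), of 0] ne hd assms(2) by simp
  then show "(0, 0) \<in> tower_cells bs ls rs" "(c, h) \<in> tower_cells bs ls rs \<Longrightarrow> 0 \<le> h"
    "(c, 0) \<in> tower_cells bs ls rs \<Longrightarrow> 0 \<le> c"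
    using assms(2) ne hd by (auto simp: tower_cells_def mem_row_cells)
qed

text \<open>The origin is the leftmost cell of the lowest row in both sets, so a translation
  carrying one set to the other is trivial.\<close>

lemma tower_cells_inj:
  assumes T: "tower_lists m bs ls rs" "tower_lists m bs' ls' rs'"
    and hd: "fst (hd bs) = 0" "fst (hd bs') = 0"
    and eq: "tower_cells bs' ls' rs' = shift v (tower_cells bs ls rs)"
  shows "bs = bs' \<and> ls = ls' \<and> rs = rs'"
proof -
  note a = tower_cells_bottom_row[OF T(1) hd(1)] and b = tower_cells_bottom_row[OF T(2) hd(2)]
  have "(fst v, snd v) \<in> tower_cells bs' ls' rs'" "(- fst v, - snd v) \<in> tower_cells bs ls rs"
    using a(1) b(1) unfolding eq mem_shift by simp_all
  then have "snd v = 0" "fst v = 0"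
    using a(2,3) b(2,3) by (metis antisym neg_0_le_iff_le neg_le_0_iff_le minus_zero)+
  then have "tower_cells bs ls rs = tower_cells bs' ls' rs'"
    unfolding eq by (auto simp: mem_shift)
  then show ?thesis using tower_cells_inj_cells[OF T] by blast
qed

definition towers :: "nat \<Rightarrow> nat \<Rightarrow> nat \<Rightarrow>
    ((int \<times> int) list \<times> (int \<times> int) list \<times> (int \<times> int) list) set" where
  "towers m p q = {(bs, ls, rs). tower_lists m bs ls rs \<and> fst (hd bs) = 0 \<and>
     nat (snd (hd bs)) + weight (hd bs) (tl bs @ ls) + weight (last bs) rs = p \<and>
     length bs + length ls + length rs = q}"

text \<open>The normalized triples represent the translation classes: every class arises by passing
  from columns to rows, every triple gives a polygon by the converse passage, and
  \<open>tower_cells_inj\<close> separates the classes. A positive depth means that there is a tower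
  on either side.\<close>

theorem bimodal_count_towers:
  assumes "0 < m"
  shows "bimodal_count m p q = card (towers m p q)"
proof -
  define cls where "cls = (\<lambda>(bs, ls, rs). cell_class (tower_cells bs ls rs))"
  have fin_cols: "finite (column_cells w b t)" for w b t
  proof -
    have "column_cells w b t = (\<Union>i\<in>{1..w}. (\<lambda>h. (int i, h)) ` {b i..<t i})"
      by (force simp: column_cells_def image_iff)
    then show ?thesis by simp
  qed
  have counts: "bottoms (tower_cells bs ls rs) =
      nat (snd (hd bs)) + weight (hd bs) (tl bs @ ls) + weight (last bs) rs"
    "lefts (tower_cells bs ls rs) = length bs + length ls + length rs"
    if L: "tower_lists m bs ls rs" "fst (hd bs) = 0" for bs ls rs
  proof -
    obtain p bs' where "bs = p # bs'" using L(1) by (cases bs) (auto simp: tower_lists_def)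
    then show "bottoms (tower_cells bs ls rs) =
      nat (snd (hd bs)) + weight (hd bs) (tl bs @ ls) + weight (last bs) rs"
      using bottoms_tower_cells[of m p bs' ls rs] L by simp
  qed (use lefts_tower_cells L in blast)
  have "{P \<in> bimodal_polygons m. \<forall>E\<in>P. card {e \<in> E. horizontal e} = 2 * p \<and>
      card {e \<in> E. vertical e} = 2 * q} = cls ` towers m p q"
  proof (intro set_eqI iffI)
    fix P assume "P \<in> {P \<in> bimodal_polygons m. \<forall>E\<in>P. card {e \<in> E. horizontal e} = 2 * p \<and>
      card {e \<in> E. vertical e} = 2 * q}"
    then obtain w b t where wbt: "bimodal_profile m w b t" "P = cell_class (column_cells w b t)"
      and "\<forall>E\<in>P. card {e \<in> E. horizontal e} = 2 * p \<and> card {e \<in> E. vertical e} = 2 * q"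
      unfolding bimodal_polygons_def cell_class_def by blast
    then have pq: "bottoms (column_cells w b t) = p" "lefts (column_cells w b t) = q"
      using cell_class_counts[OF fin_cols, of w b t p q] by auto
    obtain j where j: "bimodal_columns m 1 (int w + 1) j (\<lambda>c. b (nat c)) (\<lambda>c. t (nat c))"
      "column_cells w b t = region 1 (int w + 1) (\<lambda>c. b (nat c)) (\<lambda>c. t (nat c))"
      using bimodal_profile_columns[OF wbt(1)] by blast
    obtain A v N N' l r l' r' where T: "two_towers m A v N N' l r l' r'"
      "\<And>c h. (c, h) \<in> column_cells w b t \<longleftrightarrow> (h, c) \<in> region A N l r \<or> (h, c) \<in> region A N' l' r'"
      using bimodal_columns_two_towers[OF j(1) assms] unfolding j(2) by blast
    obtain bs ls rs where L: "tower_lists m bs ls rs" "fst (hd bs) = 0"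
      "\<And>c h. (c, h) \<in> tower_cells bs ls rs \<longleftrightarrow>
        (h + A, c + l A) \<in> region A N l r \<or> (h + A, c + l A) \<in> region A N' l' r'"
      using two_towers_tower_lists[OF T(1)] by blast
    have "x \<in> tower_cells bs ls rs \<longleftrightarrow> x \<in> shift (- l A, - A) (column_cells w b t)" for x
      by (cases x) (simp add: L(3) mem_shift T(2))
    then have sh: "tower_cells bs ls rs = shift (- l A, - A) (column_cells w b t)"
      by (rule set_eqI)
    then have "cell_class (column_cells w b t) = cell_class (tower_cells bs ls rs)"
      unfolding cell_class_eq_iff[OF fin_cols finite_tower_cells] by blast
    then have "P = cls (bs, ls, rs)" by (simp add: wbt(2) cls_def)
    moreover have "bottoms (tower_cells bs ls rs) = p" "lefts (tower_cells bs ls rs) = q"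
      unfolding sh bottoms_shift lefts_shift by (fact pq)+
    then have "(bs, ls, rs) \<in> towers m p q"
      using counts[OF L(1,2)] L(1,2) by (simp add: towers_def)
    ultimately show "P \<in> cls ` towers m p q" by (rule image_eqI)
  next
    fix P assume "P \<in> cls ` towers m p q"
    then obtain bs ls rs where P: "P = cell_class (tower_cells bs ls rs)"
      and t: "(bs, ls, rs) \<in> towers m p q" by (auto simp: cls_def)
    have L: "tower_lists m bs ls rs" "fst (hd bs) = 0" using t by (auto simp: towers_def)
    obtain a n j b t where C: "bimodal_columns m a n j b t"
      "\<And>c h. (c, h) \<in> region a n b t \<longleftrightarrow> (c, h) \<in> tower_cells bs ls rs"
      using two_towers_bimodal_columns[OF tower_lists_two_towers[OF L(1)]]
      unfolding tower_cells_def Un_iff row_cells_region by blast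
    obtain w b' t' where W: "bimodal_profile m w b' t'"
      "region a n b t = shift (a - 1, 0) (column_cells w b' t')"
      using columns_bimodal_profile[OF C(1) assms] by blast
    have "tower_cells bs ls rs = shift (a - 1, 0) (column_cells w b' t')"
      unfolding W(2)[symmetric] by (rule set_eqI) (metis C(2) surj_pair)
    then have "P = cell_class (column_cells w b' t')"
      unfolding P using cell_class_eq_iff[OF fin_cols finite_tower_cells] by metis
    then have "P \<in> bimodal_polygons m"
      unfolding bimodal_polygons_def cell_class_def using W(1) by blast
    moreover have "bottoms (tower_cells bs ls rs) = p" "lefts (tower_cells bs ls rs) = q"
      using t counts[OF L] by (simp_all add: towers_def)
    then have "\<forall>E\<in>P. card {e \<in> E. horizontal e} = 2 * p \<and> card {e \<in> E. vertical e} = 2 * q"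
      unfolding P using cell_class_counts[OF finite_tower_cells] by blast
    ultimately show "P \<in> {P \<in> bimodal_polygons m. \<forall>E\<in>P. card {e \<in> E. horizontal e} = 2 * p \<and>
      card {e \<in> E. vertical e} = 2 * q}" by blast
  qed
  moreover have "inj_on cls (towers m p q)"
  proof (rule inj_onI)
    fix x y assume xy: "x \<in> towers m p q" "y \<in> towers m p q" "cls x = cls y"
    obtain bs ls rs bs' ls' rs' where e: "x = (bs, ls, rs)" "y = (bs', ls', rs')"
      by (metis prod_cases3)
    have L: "tower_lists m bs ls rs" "fst (hd bs) = 0" "tower_lists m bs' ls' rs'" "fst (hd bs') = 0"
      using xy by (auto simp: towers_def e)
    obtain v where "tower_cells bs' ls' rs' = shift v (tower_cells bs ls rs)"
      using xy(3) cell_class_eq_iff[OF finite_tower_cells finite_tower_cells]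
      unfolding cls_def e by auto
    then show "x = y" using tower_cells_inj[OF L(1,3,2,4)] by (simp add: e)
  qed
  ultimately show ?thesis unfolding bimodal_count_def by (simp add: card_image)
qed

section \<open>Generating functions of row lists\<close>

lemma card_UN_image:
  assumes "finite A" "\<And>a. a \<in> A \<Longrightarrow> finite (B a)"
    "\<And>a b a' b'. a \<in> A \<Longrightarrow> b \<in> B a \<Longrightarrow> a' \<in> A \<Longrightarrow> b' \<in> B a' \<Longrightarrow> f a b = f a' b' \<Longrightarrow>
      a = a' \<and> b = b'"
  shows "card (\<Union>a\<in>A. f a ` B a) = (\<Sum>a\<in>A. card (B a))"
proof -
  have "(\<Union>a\<in>A. f a ` B a) = (\<lambda>(a, b). f a b) ` Sigma A B" by force
  moreover have "inj_on (\<lambda>(a, b). f a b) (Sigma A B)"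
    using assms(3) by (fastforce simp: inj_on_def)
  ultimately show ?thesis using assms(1,2) by (simp add: card_image card_SigmaI)
qed

definition row_lists :: "bool \<Rightarrow> bool \<Rightarrow> int \<times> int \<Rightarrow> nat \<Rightarrow> nat \<Rightarrow> (int \<times> int) list set" where
  "row_lists X Y p k w = {rs. valid X Y p rs \<and> length rs = k \<and> weight p rs = w}"

text \<open>The rows that may follow a row of width \<open>n\<close> placed at 0. The bound on the
  growth loses no list of total weight \<open>w\<close> and makes the set finite.\<close>

definition next_rows :: "bool \<Rightarrow> bool \<Rightarrow> nat \<Rightarrow> nat \<Rightarrow> (int \<times> int) set" where
  "next_rows X Y n w = {q. fst q < snd q \<and> fst q < int n \<and> 0 < snd q \<and> (X \<or> 0 \<le> fst q) \<and>
     (Y \<or> snd q \<le> int n) \<and> growth (0, int n) q \<le> w}"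

definition translate_row :: "int \<Rightarrow> int \<times> int \<Rightarrow> int \<times> int" where
  "translate_row d q = (fst q + d, snd q + d)"

definition mirror_row :: "int \<Rightarrow> int \<times> int \<Rightarrow> int \<times> int" where
  "mirror_row d q = (d - snd q, d - fst q)"

lemma valid_translate: "valid X Y (translate_row d p) (map (translate_row d) rs) = valid X Y p rs"
  by (induction rs arbitrary: X Y p) (auto simp: translate_row_def)

lemma weight_translate: "weight (translate_row d p) (map (translate_row d) rs) = weight p rs"
  by (induction rs arbitrary: p) (auto simp: translate_row_def growth_def)

lemma valid_mirror: "valid Y X (mirror_row d p) (map (mirror_row d) rs) = valid X Y p rs"
  by (induction rs arbitrary: X Y p) (auto simp: mirror_row_def)

lemma weight_mirror: "weight (mirror_row d p) (map (mirror_row d) rs) = weight p rs"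
  by (induction rs arbitrary: p) (auto simp: mirror_row_def growth_def)

lemma translate_row_inverse [simp]: "translate_row d (translate_row (- d) q) = q"
  by (simp add: translate_row_def)

lemma translate_row_inverse_map [simp]: "map (translate_row d) (map (translate_row (- d)) rs) = rs"
  by (induction rs) auto

lemma mirror_row_inverse [simp]: "mirror_row d (mirror_row d q) = q"
  by (simp add: mirror_row_def)

lemma mirror_row_inverse_map [simp]: "map (mirror_row d) (map (mirror_row d) rs) = rs"
  by (induction rs) auto

lemma inj_translate_row: "inj (translate_row d)"
  by (auto simp: inj_def translate_row_def prod_eq_iff)

lemma inj_mirror_row: "inj (mirror_row d)"
  by (auto simp: inj_def mirror_row_def prod_eq_iff)

lemma row_lists_translate:
  "row_lists X Y (translate_row d p) k w = map (translate_row d) ` row_lists X Y p k w"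
proof (intro set_eqI iffI)
  fix rs assume L: "rs \<in> row_lists X Y (translate_row d p) k w"
  have "map (translate_row (- d)) rs \<in> row_lists X Y p k w"
    using L valid_translate[of X Y d p "map (translate_row (- d)) rs"]
      weight_translate[of d p "map (translate_row (- d)) rs"]
    unfolding translate_row_inverse_map by (simp add: row_lists_def)
  then show "rs \<in> map (translate_row d) ` row_lists X Y p k w"
    by (rule rev_image_eqI) (simp only: translate_row_inverse_map)
qed (auto simp: row_lists_def valid_translate weight_translate)

lemma finite_next_rows: "finite (next_rows X Y n w)"
proof (rule finite_subset)
  show "next_rows X Y n w \<subseteq> {- int w..int n} \<times> {0..int n + int w}"
    by (auto simp: next_rows_def growth_def)
qed simp

lemma row_as_translate:
  assumes "fst q < snd q"
  shows "q = translate_row (fst q) (0, int (nat (snd q - fst q)))"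
  using assms by (simp add: translate_row_def prod_eq_iff)

text \<open>Only the width of the row below matters. This reduces the state to two flags and one
  number.\<close>

lemma card_row_lists_translate:
  assumes "fst q < snd q"
  shows "card (row_lists X Y q k w) = card (row_lists X Y (0, int (nat (snd q - fst q))) k w)"
    and "finite (row_lists X Y q k w) = finite (row_lists X Y (0, int (nat (snd q - fst q))) k w)"
proof -
  have inj: "inj_on (map (translate_row (fst q))) A" for A
    using inj_translate_row by (auto intro: inj_onI simp: inj_map_eq_map)
  have eq: "row_lists X Y q k w
      = map (translate_row (fst q)) ` row_lists X Y (0, int (nat (snd q - fst q))) k w"
    by (subst row_as_translate[OF assms]) (rule row_lists_translate)
  show "card (row_lists X Y q k w) = card (row_lists X Y (0, int (nat (snd q - fst q))) k w)"
    unfolding eq by (rule card_image[OF inj])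
  show "finite (row_lists X Y q k w) = finite (row_lists X Y (0, int (nat (snd q - fst q))) k w)"
    unfolding eq by (rule finite_image_iff[OF inj])
qed

lemma row_lists_Suc:
  "row_lists X Y (0, int n) (Suc k) w = (\<Union>q\<in>next_rows X Y n w. (#) q `
     row_lists (X \<and> fst q \<le> 0) (Y \<and> int n \<le> snd q) q k (w - growth (0, int n) q))"
proof (intro set_eqI iffI)
  fix rs assume L: "rs \<in> row_lists X Y (0, int n) (Suc k) w"
  then obtain q rs' where rs: "rs = q # rs'" by (cases rs) (auto simp: row_lists_def)
  then have "q \<in> next_rows X Y n w"
    "rs' \<in> row_lists (X \<and> fst q \<le> 0) (Y \<and> int n \<le> snd q) q k (w - growth (0, int n) q)"
    using L by (auto simp: row_lists_def next_rows_def)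
  then show "rs \<in> (\<Union>q\<in>next_rows X Y n w. (#) q `
     row_lists (X \<and> fst q \<le> 0) (Y \<and> int n \<le> snd q) q k (w - growth (0, int n) q))"
    unfolding rs by blast
qed (auto simp: row_lists_def next_rows_def)

lemma row_lists_0: "row_lists X Y p 0 w = (if w = 0 then {[]} else {})"
  by (auto simp: row_lists_def)

lemma finite_row_lists_base: "finite (row_lists X Y (0, int n) k w)"
proof (induction k arbitrary: X Y n w)
  case (Suc k)
  have "finite (row_lists X' Y' q k w')" if "q \<in> next_rows X Y n w" for q X' Y' w'
  proof -
    have pos: "fst q < snd q" using that by (simp add: next_rows_def)
    show ?thesis unfolding card_row_lists_translate(2)[OF pos] by (rule Suc.IH)
  qed
  then show ?case unfolding row_lists_Suc by (simp add: finite_next_rows)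
qed (simp add: row_lists_0)

lemma finite_row_lists: "fst q < snd q \<Longrightarrow> finite (row_lists X Y q k w)"
  using card_row_lists_translate(2) finite_row_lists_base by blast

definition num_lists :: "bool \<Rightarrow> bool \<Rightarrow> nat \<Rightarrow> nat \<Rightarrow> nat \<Rightarrow> nat" where
  "num_lists X Y n k w = card (row_lists X Y (0, int n) k w)"

lemma num_lists_0: "num_lists X Y n 0 w = (if w = 0 then 1 else 0)"
  by (simp add: num_lists_def row_lists_0)

lemma num_lists_Suc:
  "num_lists X Y n (Suc k) w = (\<Sum>q\<in>next_rows X Y n w.
     num_lists (X \<and> fst q \<le> 0) (Y \<and> int n \<le> snd q) (nat (snd q - fst q)) k (w - growth (0, int n) q))"
proof -
  have pos: "fst q < snd q" if "q \<in> next_rows X Y n w" for q using that by (simp add: next_rows_def)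
  show ?thesis
    unfolding num_lists_def row_lists_Suc
    by (subst card_UN_image)
      (auto simp: finite_next_rows finite_row_lists pos card_row_lists_translate(1) intro!: sum.cong)
qed

text \<open>\<open>n\<close> is the width of the row carrying the lists, \<open>x\<close> marks the
  growth and \<open>y\<close> the number of rows. The predicate \<open>Q\<close> restricts the
  length, so that one recursion serves all lists, lists of one row and nonempty lists.\<close>

definition list_gf :: "(nat \<Rightarrow> bool) \<Rightarrow> bool \<Rightarrow> bool \<Rightarrow> nat \<Rightarrow> rat fps fps" where
  "list_gf Q X Y n = Abs_fps (\<lambda>w. Abs_fps (\<lambda>k. if Q k then of_nat (num_lists X Y n k w) else 0))"

text \<open>The transfer operator for one more row: \<open>F\<close> receives the flags and the
  width after it, and the shift of the index by the growth is multiplication by a power of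
  \<open>x\<close>.\<close>

definition step :: "bool \<Rightarrow> bool \<Rightarrow> (bool \<Rightarrow> bool \<Rightarrow> nat \<Rightarrow> rat fps fps) \<Rightarrow> nat \<Rightarrow> rat fps fps" where
  "step X Y F n = Abs_fps (\<lambda>w. \<Sum>q\<in>next_rows X Y n w.
     fps_nth (F (X \<and> fst q \<le> 0) (Y \<and> int n \<le> snd q) (nat (snd q - fst q))) (w - growth (0, int n) q))"

lemma var_y_mult_nth: "fps_nth (fps_nth (var_y * f) p) k = (if k = 0 then 0 else fps_nth (fps_nth f p) (k - 1))"
  by (simp add: var_y_def)

lemma list_gf_rec:
  "list_gf Q X Y n = (if Q 0 then 1 else 0) + var_y * step X Y (list_gf (\<lambda>k. Q (Suc k))) n"
proof (intro fps_ext)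
  fix w k
  show "fps_nth (fps_nth (list_gf Q X Y n) w) k = fps_nth (fps_nth ((if Q 0 then 1 else 0) +
      var_y * step X Y (list_gf (\<lambda>k. Q (Suc k))) n) w) k"
  proof (cases k)
    case 0
    then show ?thesis by (simp add: var_y_mult_nth list_gf_def num_lists_0)
  next
    case (Suc k')
    then show ?thesis
      by (simp add: var_y_mult_nth list_gf_def num_lists_Suc step_def fps_sum_nth)
  qed
qed

section \<open>Completing a row by further base rows and two towers\<close>

definition towers_above ::
    "nat \<Rightarrow> bool \<Rightarrow> bool \<Rightarrow> int \<times> int \<Rightarrow> nat \<Rightarrow> nat \<Rightarrow> ((int \<times> int) list \<times> (int \<times> int) list) set" where
  "towers_above m X Y p k w = {(ls, rs). ls \<noteq> [] \<and> rs \<noteq> [] \<and> valid X Y p ls \<and> valid X Y p rs \<and>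
     snd (hd ls) < fst (hd rs) \<and> min (length ls) (length rs) = m \<and>
     length ls + length rs = k \<and> weight p ls + weight p rs = w}"

definition completions ::
    "nat \<Rightarrow> bool \<Rightarrow> bool \<Rightarrow> int \<times> int \<Rightarrow> nat \<Rightarrow> nat \<Rightarrow>
      ((int \<times> int) list \<times> (int \<times> int) list \<times> (int \<times> int) list) set" where
  "completions m X Y p k w = {(bs, ls, rs). ls \<noteq> [] \<and> rs \<noteq> [] \<and>
     valid X Y p (bs @ ls) \<and> valid X Y p (bs @ rs) \<and>
     snd (hd ls) < fst (hd rs) \<and> min (length ls) (length rs) = m \<and>
     length bs + length ls + length rs = k \<and> weight p (bs @ ls) + weight (last (p # bs)) rs = w}"

lemma last_map_Cons: "last (f p # map f bs) = f (last (p # bs))"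
  by (metis last_map list.simps(9) list.distinct(1))

lemma completions_translate:
  "completions m X Y (translate_row d p) k w =
     (\<lambda>(bs, ls, rs). (map (translate_row d) bs, map (translate_row d) ls, map (translate_row d) rs)) `
     completions m X Y p k w" (is "_ = ?f d ` _")
proof -
  have sub: "?f d x \<in> completions m X Y (translate_row d p) k w"
    if "x \<in> completions m X Y p k w" for x d p
  proof -
    obtain bs ls rs where x: "x = (bs, ls, rs)" by (metis prod_cases3)
    show ?thesis
      using that unfolding x completions_def
      by (auto simp: valid_translate weight_translate last_map_Cons hd_map
          simp del: last.simps map_append simp flip: map_append)
        (simp add: translate_row_def)
  qed
  have inv: "?f d (?f (- d) x) = x" for x
    by (cases x) (simp del: map_map)
  show ?thesis
  proof (intro set_eqI iffI)
    fix x assume "x \<in> completions m X Y (translate_row d p) k w"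
    then have "?f (- d) x \<in> completions m X Y (translate_row (- d) (translate_row d p)) k w"
      by (rule sub)
    moreover have "translate_row (- d) (translate_row d p) = p" by (simp add: translate_row_def)
    ultimately show "x \<in> ?f d ` completions m X Y p k w"
      by (intro image_eqI[of _ _ "?f (- d) x"]) (simp_all only: inv)
  next
    fix x assume "x \<in> ?f d ` completions m X Y p k w"
    then obtain y where y: "x = ?f d y" "y \<in> completions m X Y p k w" by (rule imageE)
    show "x \<in> completions m X Y (translate_row d p) k w"
      unfolding y(1) by (rule sub[OF y(2)])
  qed
qed

text \<open>Reflection exchanges the flags and also the two towers. The weight counts the base
  together with the left tower; splitting it off with \<open>w_app\<close> makes the weight visibly
  symmetric.\<close>

lemma completions_mirror:
  "completions m Y X (mirror_row d p) k w =
     (\<lambda>(bs, ls, rs). (map (mirror_row d) bs, map (mirror_row d) rs, map (mirror_row d) ls)) `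
     completions m X Y p k w" (is "_ = ?f d ` _")
proof -
  have w_app: "weight p (bs @ rs) = weight p bs + weight (last (p # bs)) rs" for p bs rs
    by (induction bs arbitrary: p) auto
  have sub: "?f d x \<in> completions m Y X (mirror_row d p) k w"
    if "x \<in> completions m X Y p k w" for x p X Y
  proof -
    obtain bs ls rs where x: "x = (bs, ls, rs)" by (metis prod_cases3)
    have "snd (mirror_row d q) < fst (mirror_row d r) \<longleftrightarrow> snd r < fst q" for q r
      by (auto simp: mirror_row_def)
    then show ?thesis
      using that unfolding x completions_def
      by (auto simp: valid_mirror weight_mirror last_map_Cons hd_map w_app min.commute
          simp del: last.simps map_append simp flip: map_append)
  qed
  have inv: "?f d (?f d x) = x" for x
    by (cases x) (simp del: map_map)
  show ?thesis
  proof (intro set_eqI iffI)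
    fix x assume "x \<in> completions m Y X (mirror_row d p) k w"
    then have "?f d x \<in> completions m X Y (mirror_row d (mirror_row d p)) k w"
      by (rule sub)
    then show "x \<in> ?f d ` completions m X Y p k w"
      by (intro image_eqI[of _ _ "?f d x"]) (simp_all only: inv mirror_row_inverse)
  next
    fix x assume "x \<in> ?f d ` completions m X Y p k w"
    then obtain y where y: "x = ?f d y" "y \<in> completions m X Y p k w" by (rule imageE)
    show "x \<in> completions m Y X (mirror_row d p) k w"
      unfolding y(1) by (rule sub[OF y(2)])
  qed
qed

text \<open>Either the base is finished and both towers start on the present row, or the next row
  still belongs to the base.\<close>

lemma completions_rec:
  "completions m X Y (0, int n) k w =
     Pair [] ` towers_above m X Y (0, int n) k w \<union>
     (if k = 0 then {} else \<Union>q\<in>next_rows X Y n w. (\<lambda>(bs, ls, rs). (q # bs, ls, rs)) `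
        completions m (X \<and> fst q \<le> 0) (Y \<and> int n \<le> snd q) q (k - 1) (w - growth (0, int n) q))"
proof (intro set_eqI iffI)
  fix x assume L: "x \<in> completions m X Y (0, int n) k w"
  obtain bs ls rs where x: "x = (bs, ls, rs)" by (metis prod_cases3)
  show "x \<in> Pair [] ` towers_above m X Y (0, int n) k w \<union>
     (if k = 0 then {} else \<Union>q\<in>next_rows X Y n w. (\<lambda>(bs, ls, rs). (q # bs, ls, rs)) `
        completions m (X \<and> fst q \<le> 0) (Y \<and> int n \<le> snd q) q (k - 1) (w - growth (0, int n) q))"
  proof (cases bs)
    case Nil
    then show ?thesis using L unfolding x completions_def towers_above_def by auto
  next
    case (Cons q bs')
    then have "q \<in> next_rows X Y n w"
      "(bs', ls, rs) \<in> completions m (X \<and> fst q \<le> 0) (Y \<and> int n \<le> snd q) q (k - 1) (w - growth (0, int n) q)"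
      "k \<noteq> 0"
      using L unfolding x completions_def next_rows_def by auto
    then show ?thesis unfolding x Cons by force
  qed
next
  fix x assume "x \<in> Pair [] ` towers_above m X Y (0, int n) k w \<union>
     (if k = 0 then {} else \<Union>q\<in>next_rows X Y n w. (\<lambda>(bs, ls, rs). (q # bs, ls, rs)) `
        completions m (X \<and> fst q \<le> 0) (Y \<and> int n \<le> snd q) q (k - 1) (w - growth (0, int n) q))"
  then consider (1) "x \<in> Pair [] ` towers_above m X Y (0, int n) k w"
    | (2) q bs ls rs where "k \<noteq> 0" "q \<in> next_rows X Y n w" "x = (q # bs, ls, rs)"
      "(bs, ls, rs) \<in> completions m (X \<and> fst q \<le> 0) (Y \<and> int n \<le> snd q) q (k - 1) (w - growth (0, int n) q)"
    by (auto split: if_splits)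
  then show "x \<in> completions m X Y (0, int n) k w"
  proof cases
    case 1
    then show ?thesis unfolding completions_def towers_above_def by auto
  next
    case 2
    then show ?thesis unfolding completions_def next_rows_def by auto
  qed
qed

lemma finite_towers_above: "finite (towers_above m X Y (0, int n) k w)"
proof (rule finite_subset)
  show "towers_above m X Y (0, int n) k w \<subseteq>
    (\<Union>i\<le>k. \<Union>v\<le>w. row_lists X Y (0, int n) i v) \<times> (\<Union>i\<le>k. \<Union>v\<le>w. row_lists X Y (0, int n) i v)"
    by (auto simp: towers_above_def row_lists_def)
qed (simp add: finite_row_lists_base)

lemma card_completions_translate:
  assumes "fst q < snd q"
  shows "card (completions m X Y q k w) = card (completions m X Y (0, int (nat (snd q - fst q))) k w)"
    and "finite (completions m X Y q k w) = finite (completions m X Y (0, int (nat (snd q - fst q))) k w)"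
proof -
  let ?f = "\<lambda>(bs, ls, rs). (map (translate_row (fst q)) bs, map (translate_row (fst q)) ls,
    map (translate_row (fst q)) rs)"
  have inj: "inj_on ?f A" for A
    using inj_translate_row by (auto intro!: inj_onI simp: inj_map_eq_map)
  have eq: "completions m X Y q k w = ?f ` completions m X Y (0, int (nat (snd q - fst q))) k w"
    by (subst row_as_translate[OF assms]) (rule completions_translate)
  show "card (completions m X Y q k w) = card (completions m X Y (0, int (nat (snd q - fst q))) k w)"
    unfolding eq by (rule card_image[OF inj])
  show "finite (completions m X Y q k w) = finite (completions m X Y (0, int (nat (snd q - fst q))) k w)"
    unfolding eq by (rule finite_image_iff[OF inj])
qed

lemma finite_completions_base: "finite (completions m X Y (0, int n) k w)"
proof (induction k arbitrary: X Y n w)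
  case 0
  then show ?case by (simp add: completions_rec finite_towers_above)
next
  case (Suc k)
  have "finite (completions m X' Y' q k w')" if "q \<in> next_rows X Y n w" for q X' Y' w'
  proof -
    have pos: "fst q < snd q" using that by (simp add: next_rows_def)
    show ?thesis unfolding card_completions_translate(2)[OF pos] by (rule Suc.IH)
  qed
  then show ?case unfolding completions_rec[of m X Y n "Suc k"]
    by (simp add: finite_next_rows finite_towers_above)
qed

lemma finite_completions: "fst q < snd q \<Longrightarrow> finite (completions m X Y q k w)"
  using card_completions_translate(2) finite_completions_base by blast

lemma card_completions_mirror:
  "card (completions m Y X (0, int n) k w) = card (completions m X Y (0, int n) k w)"
proof -
  let ?f = "\<lambda>(bs, ls, rs). (map (mirror_row (int n)) bs, map (mirror_row (int n)) rs,
    map (mirror_row (int n)) ls)"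
  have "inj_on ?f A" for A
    using inj_mirror_row by (auto intro!: inj_onI simp: inj_map_eq_map)
  moreover have "completions m Y X (0, int n) k w = ?f ` completions m X Y (0, int n) k w"
    using completions_mirror[of m Y X "int n" "(0, int n)"] by (simp add: mirror_row_def)
  ultimately show ?thesis by (simp add: card_image)
qed

definition completion_gf :: "nat \<Rightarrow> bool \<Rightarrow> bool \<Rightarrow> nat \<Rightarrow> rat fps fps" where
  "completion_gf m X Y n =
     Abs_fps (\<lambda>w. Abs_fps (\<lambda>k. of_nat (card (completions m X Y (0, int n) k w))))"

definition towers_above_gf :: "nat \<Rightarrow> bool \<Rightarrow> bool \<Rightarrow> nat \<Rightarrow> rat fps fps" where
  "towers_above_gf m X Y n =
     Abs_fps (\<lambda>w. Abs_fps (\<lambda>k. of_nat (card (towers_above m X Y (0, int n) k w))))"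

lemma completion_gf_mirror: "completion_gf m Y X = completion_gf m X Y"
  by (rule ext) (simp add: completion_gf_def card_completions_mirror[of m Y X])

lemma completion_gf_rec:
  "completion_gf m X Y n = towers_above_gf m X Y n + var_y * step X Y (completion_gf m) n"
proof (intro fps_ext)
  fix w k
  have pos: "fst q < snd q" if "q \<in> next_rows X Y n w" for q using that by (simp add: next_rows_def)
  have base: "card (Pair ([] :: (int \<times> int) list) ` towers_above m X Y (0, int n) k w)
      = card (towers_above m X Y (0, int n) k w)" for k
    by (rule card_image) (simp add: inj_on_def)
  have "card (completions m X Y (0, int n) k w) = card (towers_above m X Y (0, int n) k w) +
    (if k = 0 then 0 else \<Sum>q\<in>next_rows X Y n w. card (completions m (X \<and> fst q \<le> 0)
      (Y \<and> int n \<le> snd q) (0, int (nat (snd q - fst q))) (k - 1) (w - growth (0, int n) q)))"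
  proof (cases "k = 0")
    case True
    then show ?thesis unfolding completions_rec[of m X Y n] by (simp add: base)
  next
    case False
    let ?U = "\<Union>q\<in>next_rows X Y n w. (\<lambda>(bs, ls, rs). (q # bs, ls, rs)) `
        completions m (X \<and> fst q \<le> 0) (Y \<and> int n \<le> snd q) q (k - 1) (w - growth (0, int n) q)"
    have "card (completions m X Y (0, int n) k w)
        = card (Pair [] ` towers_above m X Y (0, int n) k w \<union> ?U)"
      using False unfolding completions_rec[of m X Y n] by simp
    also have "\<dots> = card (Pair ([] :: (int \<times> int) list) ` towers_above m X Y (0, int n) k w) + card ?U"
      by (rule card_Un_disjoint)
        (auto simp: finite_towers_above finite_next_rows intro!: finite_completions pos)
    also have "card ?U = (\<Sum>q\<in>next_rows X Y n w. card (completions m (X \<and> fst q \<le> 0)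
      (Y \<and> int n \<le> snd q) q (k - 1) (w - growth (0, int n) q)))"
      by (rule card_UN_image) (auto simp: finite_next_rows intro!: finite_completions pos)
    finally show ?thesis
      using False by (simp add: base card_completions_translate(1)[OF pos] cong: sum.cong)
  qed
  then show "fps_nth (fps_nth (completion_gf m X Y n) w) k = fps_nth (fps_nth
      (towers_above_gf m X Y n + var_y * step X Y (completion_gf m) n) w) k"
    by (simp add: var_y_mult_nth completion_gf_def towers_above_gf_def step_def fps_sum_nth)
qed

lemma towers_completions:
  "towers m p q = (if q = 0 then {} else \<Union>n\<in>{1..p}. (\<lambda>(bs, ls, rs). ((0, int n) # bs, ls, rs)) `
     completions m True True (0, int n) (q - 1) (p - n))"
proof (intro set_eqI iffI)
  fix x assume L: "x \<in> towers m p q"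
  obtain bs ls rs where x: "x = (bs, ls, rs)" by (metis prod_cases3)
  obtain r bs' where bs: "bs = r # bs'"
    using L unfolding x by (cases bs) (auto simp: towers_def tower_lists_def)
  have T: "tower_lists m (r # bs') ls rs" "fst r = 0" using L unfolding x bs towers_def by auto
  then have "fst r < snd r" by (simp add: tower_lists_def profile_list_Cons)
  then have r: "r = (0, int (nat (snd r)))" "0 < nat (snd r)" using T(2) by (auto simp: prod_eq_iff)
  have "nat (snd r) \<in> {1..p}" "q \<noteq> 0"
    "(bs', ls, rs) \<in> completions m True True (0, int (nat (snd r))) (q - 1) (p - nat (snd r))"
    using L r T unfolding x bs towers_def completions_def tower_lists_def
    by (auto simp: profile_list_Cons)
  then show "x \<in> (if q = 0 then {} else \<Union>n\<in>{1..p}. (\<lambda>(bs, ls, rs). ((0, int n) # bs, ls, rs)) `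
     completions m True True (0, int n) (q - 1) (p - n))"
    unfolding x bs using r(1) by force
next
  fix x assume "x \<in> (if q = 0 then {} else \<Union>n\<in>{1..p}. (\<lambda>(bs, ls, rs). ((0, int n) # bs, ls, rs)) `
     completions m True True (0, int n) (q - 1) (p - n))"
  then obtain n bs ls rs where "q \<noteq> 0" "n \<in> {1..p}" "x = ((0, int n) # bs, ls, rs)"
    "(bs, ls, rs) \<in> completions m True True (0, int n) (q - 1) (p - n)"
    by (auto split: if_splits)
  then show "x \<in> towers m p q"
    unfolding towers_def completions_def tower_lists_def by (auto simp: profile_list_Cons)
qed

text \<open>A bottom row of width \<open>n\<close> contributes the factor \<open>x ^ n * y\<close>.
  The inner sum is thus the series over all widths at \<open>s = x\<close>, later called
  \<open>sum_at_x\<close>.\<close>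

lemma bimodal_gf_completion_gf:
  assumes "0 < m"
  shows "bimodal_gf m =
    var_y * Abs_fps (\<lambda>p. \<Sum>n\<in>{1..p}. fps_nth (completion_gf m True True n) (p - n))"
proof (intro fps_ext)
  fix p q
  have "card (towers m p q) = (if q = 0 then 0 else
      \<Sum>n\<in>{1..p}. card (completions m True True (0, int n) (q - 1) (p - n)))"
    unfolding towers_completions
    by (auto intro!: card_UN_image finite_completions_base)
  then show "fps_nth (fps_nth (bimodal_gf m) p) q = fps_nth (fps_nth (var_y * Abs_fps
      (\<lambda>p. \<Sum>n\<in>{1..p}. fps_nth (completion_gf m True True n) (p - n))) p) q"
    by (simp add: var_y_mult_nth bimodal_gf_def bimodal_count_towers[OF assms] completion_gf_def
        fps_sum_nth)
qed

section \<open>One more row, by the way its ends move\<close>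

definition grow :: "(nat \<Rightarrow> 'a::comm_monoid_add fps) \<Rightarrow> nat \<Rightarrow> 'a fps" where
  "grow f n = Abs_fps (\<lambda>w. \<Sum>d\<le>w. fps_nth (f (n + d)) (w - d))"

text \<open>The new right end is already fixed at distance \<open>a\<close> from the old left end,
  and only the left end is chosen. Moving outward or staying in place, it keeps a set flag, and
  \<open>grow\<close> sums \<open>x ^ d\<close> times the value at width \<open>a + d\<close>;
  moving inward, it loses the flag.\<close>

definition half_step :: "bool \<Rightarrow> (bool \<Rightarrow> bool \<Rightarrow> nat \<Rightarrow> rat fps fps) \<Rightarrow> nat \<Rightarrow> rat fps fps" where
  "half_step X F a = (if X then grow (F True False) a + (\<Sum>j\<in>{1..<a}. F False False j)
     else (\<Sum>j\<in>{1..a}. F False False j))"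

lemma sum_Sigma:
  assumes "finite A" "\<And>a. a \<in> A \<Longrightarrow> finite (B a)"
  shows "sum g (Sigma A B) = (\<Sum>a\<in>A. \<Sum>b\<in>B a. g (a, b))"
  using assms by (simp add: sum.Sigma)

lemma half_step_nth:
  assumes "0 < a"
  shows "fps_nth (half_step X F a) w = (\<Sum>q\<in>{q \<in> next_rows X False a w. snd q = int a}.
     fps_nth (F (X \<and> fst q \<le> 0) False (nat (snd q - fst q))) (w - growth (0, int a) q))"
proof -
  define h where "h q = fps_nth (F (X \<and> fst q \<le> 0) False (nat (snd q - fst q))) (w - growth (0, int a) q)" for q
  have inj: "inj_on (\<lambda>j. (int a - int j, int a)) K" "inj_on (\<lambda>c. (- int c, int a)) K" for K
    by (auto simp: inj_on_def)
  show ?thesis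
  proof (cases X)
    case True
    have "{q \<in> next_rows X False a w. snd q = int a}
        = (\<lambda>c. (- int c, int a)) ` {..w} \<union> (\<lambda>j. (int a - int j, int a)) ` {1..<a}"
    proof (intro set_eqI iffI)
      fix q assume q: "q \<in> {q \<in> next_rows X False a w. snd q = int a}"
      show "q \<in> (\<lambda>c. (- int c, int a)) ` {..w} \<union> (\<lambda>j. (int a - int j, int a)) ` {1..<a}"
      proof (cases "fst q \<le> 0")
        case True
        then show ?thesis using q
          by (intro UnI1 image_eqI[of _ _ "nat (- fst q)"]) (auto simp: next_rows_def growth_def prod_eq_iff)
      next
        case False
        then show ?thesis using q
          by (intro UnI2 image_eqI[of _ _ "nat (int a - fst q)"]) (auto simp: next_rows_def prod_eq_iff)
      qed
    qed (use True assms in \<open>auto simp: next_rows_def growth_def\<close>)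
    moreover have "(\<lambda>c. (- int c, int a)) ` {..w} \<inter> (\<lambda>j. (int a - int j, int a)) ` {1..<a} = {}"
      by auto
    ultimately have "sum h {q \<in> next_rows X False a w. snd q = int a} =
        (\<Sum>c\<le>w. h (- int c, int a)) + (\<Sum>j\<in>{1..<a}. h (int a - int j, int a))"
      by (simp add: sum.union_disjoint sum.reindex[OF inj(1)] sum.reindex[OF inj(2)])
    moreover have "h (- int c, int a) = fps_nth (F True False (a + c)) (w - c)" for c
    proof -
      have "nat (int a + int c) = a + c" by simp
      then show ?thesis using True by (simp add: h_def growth_def)
    qed
    moreover have "h (int a - int j, int a) = fps_nth (F False False j) w" if "j \<in> {1..<a}" for j
      using that by (simp add: h_def growth_def)
    ultimately have "sum h {q \<in> next_rows X False a w. snd q = int a} = fps_nth (half_step X F a) w"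
      using True by (simp add: half_step_def grow_def fps_sum_nth)
    then show ?thesis unfolding h_def[symmetric] by (rule sym)
  next
    case False
    have "{q \<in> next_rows X False a w. snd q = int a} = (\<lambda>j. (int a - int j, int a)) ` {1..a}"
    proof (intro set_eqI iffI)
      fix q assume q: "q \<in> {q \<in> next_rows X False a w. snd q = int a}"
      then show "q \<in> (\<lambda>j. (int a - int j, int a)) ` {1..a}"
        using False by (intro image_eqI[of _ _ "nat (int a - fst q)"]) (auto simp: next_rows_def prod_eq_iff)
    qed (use False assms in \<open>auto simp: next_rows_def growth_def\<close>)
    then have "sum h {q \<in> next_rows X False a w. snd q = int a} = (\<Sum>j\<in>{1..a}. h (int a - int j, int a))"
      by (simp add: sum.reindex[OF inj(1)])
    moreover have "h (int a - int j, int a) = fps_nth (F False False j) w" if "j \<in> {1..a}" for j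
      using that False by (simp add: h_def growth_def)
    ultimately have "sum h {q \<in> next_rows X False a w. snd q = int a} = fps_nth (half_step X F a) w"
      using False by (simp add: half_step_def fps_sum_nth)
    then show ?thesis unfolding h_def[symmetric] by (rule sym)
  qed
qed

text \<open>Without the right flag the new right end lies at some \<open>a \<le> n\<close>, and the
  choice of the left end then depends only on \<open>a\<close>.\<close>

lemma step_False: "step X False F n = (\<Sum>a\<in>{1..n}. half_step X F a)"
proof (rule fps_ext)
  fix w
  define h where "h q = fps_nth (F (X \<and> fst q \<le> 0) False (nat (snd q - fst q))) (w - growth (0, int n) q)" for q
  have eq: "{q \<in> next_rows X False a w. snd q = int a} = {q \<in> next_rows X False n w. snd q = int a}"
    if "a \<in> {1..n}" for a
    using that by (auto simp: next_rows_def growth_def)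
  have "fps_nth (step X False F n) w = sum h (next_rows X False n w)"
    by (simp add: step_def h_def)
  also have "\<dots> = (\<Sum>a\<in>{1..n}. sum h {q \<in> next_rows X False n w. nat (snd q) = a})"
    by (rule sum.group[OF finite_next_rows, symmetric]) (auto simp: next_rows_def)
  also have "\<dots> = (\<Sum>a\<in>{1..n}. fps_nth (half_step X F a) w)"
  proof (rule sum.cong[OF refl])
    fix a assume a: "a \<in> {1..n}"
    have "{q \<in> next_rows X False n w. nat (snd q) = a} = {q \<in> next_rows X False n w. snd q = int a}"
      using a by auto
    moreover have "h q = fps_nth (F (X \<and> fst q \<le> 0) False (nat (snd q - fst q))) (w - growth (0, int a) q)"
      if "snd q = int a" for q
      using that a by (simp add: h_def growth_def)
    moreover have "0 < a" using a by simp
    ultimately show "sum h {q \<in> next_rows X False n w. nat (snd q) = a} = fps_nth (half_step X F a) w"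
      unfolding half_step_nth[OF \<open>0 < a\<close>] eq[OF a] by (auto intro!: sum.cong)
  qed
  finally show "fps_nth (step X False F n) w = fps_nth (\<Sum>a\<in>{1..n}. half_step X F a) w"
    by (simp add: fps_sum_nth)
qed

text \<open>The summands belong to the cases of which ends move strictly inward: none, the right,
  the left, both. If just one does, it leaves \<open>a\<close> of the old columns, at least one and
  fewer than \<open>n\<close>, and the other end grows from width \<open>a\<close>.\<close>

lemma step_True:
  assumes "0 < n"
  shows "step True True F n = grow (grow (F True True)) n + (\<Sum>a\<in>{1..<n}. grow (F True False) a)
    + (\<Sum>a\<in>{1..<n}. grow (F False True) a) + (\<Sum>a\<in>{1..<n}. \<Sum>j\<in>{1..<a}. F False False j)"
proof (rule fps_ext)
  fix w
  define h where "h q = fps_nth (F (fst q \<le> 0) (int n \<le> snd q) (nat (snd q - fst q))) (w - growth (0, int n) q)" for q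
  define f1 where "f1 = (\<lambda>(c, d). (- int c, int n + int d))"
  define f2 where "f2 = (\<lambda>(a, c). (- int c, int a))"
  define f3 where "f3 = (\<lambda>(a, d). (int n - int a, int n + int d))"
  define f4 where "f4 = (\<lambda>(a, j). (int a - int j, int a))"
  define S1 where "S1 = Sigma {..w} (\<lambda>c. {..w - c})"
  define S2 where "S2 = Sigma {1..<n} (\<lambda>_. {..w})"
  define S4 where "S4 = Sigma {1..<n} (\<lambda>a. {1..<a})"
  have inj: "inj_on f1 S1" "inj_on f2 S2" "inj_on f3 S2" "inj_on f4 S4"
    by (auto simp: inj_on_def f1_def f2_def f3_def f4_def)
  have "next_rows True True n w = f1 ` S1 \<union> (f2 ` S2 \<union> (f3 ` S2 \<union> f4 ` S4))"
  proof (intro set_eqI iffI)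
    fix q assume q: "q \<in> next_rows True True n w"
    consider "fst q \<le> 0" "int n \<le> snd q" | "fst q \<le> 0" "snd q < int n"
      | "0 < fst q" "int n \<le> snd q" | "0 < fst q" "snd q < int n" by linarith
    then show "q \<in> f1 ` S1 \<union> (f2 ` S2 \<union> (f3 ` S2 \<union> f4 ` S4))"
    proof cases
      case 1
      then have "q \<in> f1 ` S1" using q
        by (intro image_eqI[of _ _ "(nat (- fst q), nat (snd q - int n))"])
          (auto simp: f1_def S1_def next_rows_def growth_def prod_eq_iff)
      then show ?thesis by blast
    next
      case 2
      then have "q \<in> f2 ` S2" using q
        by (intro image_eqI[of _ _ "(nat (snd q), nat (- fst q))"])
          (auto simp: f2_def S2_def next_rows_def growth_def prod_eq_iff)
      then show ?thesis by blast
    next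
      case 3
      then have "q \<in> f3 ` S2" using q
        by (intro image_eqI[of _ _ "(nat (int n - fst q), nat (snd q - int n))"])
          (auto simp: f3_def S2_def next_rows_def growth_def prod_eq_iff)
      then show ?thesis by blast
    next
      case 4
      then have "q \<in> f4 ` S4" using q
        by (intro image_eqI[of _ _ "(nat (snd q), nat (snd q - fst q))"])
          (auto simp: f4_def S4_def next_rows_def growth_def prod_eq_iff)
      then show ?thesis by blast
    qed
  qed (use assms in \<open>auto simp: f1_def f2_def f3_def f4_def S1_def S2_def S4_def next_rows_def growth_def\<close>)
  moreover have "f3 ` S2 \<inter> f4 ` S4 = {}" "f2 ` S2 \<inter> (f3 ` S2 \<union> f4 ` S4) = {}"
    "f1 ` S1 \<inter> (f2 ` S2 \<union> (f3 ` S2 \<union> f4 ` S4)) = {}"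
    by (auto simp: f1_def f2_def f3_def f4_def S1_def S2_def S4_def)
  moreover have "finite S1" "finite S2" "finite S4" by (auto simp: S1_def S2_def S4_def)
  ultimately have "sum h (next_rows True True n w)
      = sum (h \<circ> f1) S1 + (sum (h \<circ> f2) S2 + (sum (h \<circ> f3) S2 + sum (h \<circ> f4) S4))"
    by (simp add: sum.union_disjoint sum.reindex inj)
  also have "sum (h \<circ> f1) S1 = fps_nth (grow (grow (F True True)) n) w"
  proof -
    have "(h \<circ> f1) (c, d) = fps_nth (F True True (n + c + d)) (w - c - d)" for c d
    proof -
      have "nat (int n + int d + int c) = n + c + d" by simp
      then show ?thesis by (simp add: h_def f1_def growth_def)
    qed
    then show ?thesis unfolding S1_def by (subst sum_Sigma) (auto simp: grow_def intro!: sum.cong)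
  qed
  also have "sum (h \<circ> f2) S2 = (\<Sum>a\<in>{1..<n}. fps_nth (grow (F True False) a) w)"
  proof -
    have "(h \<circ> f2) (a, c) = fps_nth (F True False (a + c)) (w - c)" if "a \<in> {1..<n}" for a c
    proof -
      have "nat (int a + int c) = a + c" by simp
      then show ?thesis using that by (simp add: h_def f2_def growth_def)
    qed
    then show ?thesis unfolding S2_def by (subst sum_Sigma) (auto simp: grow_def intro!: sum.cong)
  qed
  also have "sum (h \<circ> f3) S2 = (\<Sum>a\<in>{1..<n}. fps_nth (grow (F False True) a) w)"
  proof -
    have "(h \<circ> f3) (a, d) = fps_nth (F False True (a + d)) (w - d)" if "a \<in> {1..<n}" for a d
    proof -
      have "nat (int a + int d) = a + d" by simp
      then show ?thesis using that by (simp add: h_def f3_def growth_def add.commute)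
    qed
    then show ?thesis unfolding S2_def by (subst sum_Sigma) (auto simp: grow_def intro!: sum.cong)
  qed
  also have "sum (h \<circ> f4) S4 = (\<Sum>a\<in>{1..<n}. \<Sum>j\<in>{1..<a}. fps_nth (F False False j) w)"
  proof -
    have "(h \<circ> f4) (a, j) = fps_nth (F False False j) w" if "a \<in> {1..<n}" "j \<in> {1..<a}" for a j
      using that by (simp add: h_def f4_def growth_def)
    then show ?thesis unfolding S4_def by (subst sum_Sigma) (auto intro!: sum.cong)
  qed
  finally show "fps_nth (step True True F n) w = fps_nth (grow (grow (F True True)) n
    + (\<Sum>a\<in>{1..<n}. grow (F True False) a) + (\<Sum>a\<in>{1..<n}. grow (F False True) a)
    + (\<Sum>a\<in>{1..<n}. \<Sum>j\<in>{1..<a}. F False False j)) w"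
    by (simp add: step_def h_def[symmetric] fps_sum_nth)
qed

section \<open>Towers on either side of the gap\<close>

definition left_towers :: "bool \<Rightarrow> nat \<Rightarrow> nat \<Rightarrow> nat \<Rightarrow> (int \<times> int) list set" where
  "left_towers X a k w = {ls. ls \<noteq> [] \<and> snd (hd ls) = int a \<and> valid X False (0, int a) ls \<and>
     length ls = k \<and> weight (0, int a) ls = w}"

definition tower_gf :: "(nat \<Rightarrow> bool) \<Rightarrow> bool \<Rightarrow> nat \<Rightarrow> rat fps fps" where
  "tower_gf Q X a = Abs_fps (\<lambda>w. Abs_fps (\<lambda>k. if Q k then of_nat (card (left_towers X a k w)) else 0))"

lemma finite_left_towers: "finite (left_towers X a k w)"
  by (rule finite_subset[OF _ finite_row_lists_base[of X False a k w]])
    (auto simp: left_towers_def row_lists_def)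

lemma left_towers_Suc:
  "left_towers X a (Suc k) w = (\<Union>q\<in>{q \<in> next_rows X False a w. snd q = int a}. (#) q `
     row_lists (X \<and> fst q \<le> 0) False q k (w - growth (0, int a) q))"
proof (intro set_eqI iffI)
  fix rs assume L: "rs \<in> left_towers X a (Suc k) w"
  then obtain q rs' where rs: "rs = q # rs'" by (cases rs) (auto simp: left_towers_def)
  then have "q \<in> {q \<in> next_rows X False a w. snd q = int a}"
    "rs' \<in> row_lists (X \<and> fst q \<le> 0) False q k (w - growth (0, int a) q)"
    using L by (auto simp: left_towers_def row_lists_def next_rows_def)
  then show "rs \<in> (\<Union>q\<in>{q \<in> next_rows X False a w. snd q = int a}. (#) q `
     row_lists (X \<and> fst q \<le> 0) False q k (w - growth (0, int a) q))"
    unfolding rs by blast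
qed (auto simp: left_towers_def row_lists_def next_rows_def)

lemma card_left_towers_Suc:
  "card (left_towers X a (Suc k) w) = (\<Sum>q\<in>{q \<in> next_rows X False a w. snd q = int a}.
     num_lists (X \<and> fst q \<le> 0) False (nat (snd q - fst q)) k (w - growth (0, int a) q))"
proof -
  have pos: "fst q < snd q" if "q \<in> next_rows X False a w" for q using that by (simp add: next_rows_def)
  let ?A = "{q \<in> next_rows X False a w. snd q = int a}"
  have "card (left_towers X a (Suc k) w) = (\<Sum>q\<in>?A.
      card (row_lists (X \<and> fst q \<le> 0) False q k (w - growth (0, int a) q)))"
    unfolding left_towers_Suc
  proof (rule card_UN_image)
    show "finite ?A" by (rule finite_subset[OF _ finite_next_rows]) auto
    show "finite (row_lists (X \<and> fst q \<le> 0) False q k (w - growth (0, int a) q))" if "q \<in> ?A" for q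
      using that by (intro finite_row_lists pos) simp
  qed simp
  also have "\<dots> = (\<Sum>q\<in>?A. num_lists (X \<and> fst q \<le> 0) False (nat (snd q - fst q)) k
      (w - growth (0, int a) q))"
    unfolding num_lists_def
    by (intro sum.cong refl card_row_lists_translate(1) pos) simp
  finally show ?thesis .
qed

text \<open>The first row of the tower has its right end at \<open>a\<close>, which is the choice
  described by \<open>half_step\<close>; this row shifts the length condition by one.\<close>

lemma tower_gf_half_step:
  assumes "\<not> Q 0" "0 < a"
  shows "tower_gf Q X a = var_y * half_step X (list_gf (\<lambda>k. Q (Suc k))) a"
proof (intro fps_ext)
  fix w k
  show "fps_nth (fps_nth (tower_gf Q X a) w) k =
      fps_nth (fps_nth (var_y * half_step X (list_gf (\<lambda>k. Q (Suc k))) a) w) k"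
  proof (cases k)
    case 0
    then show ?thesis using assms by (simp add: tower_gf_def var_y_mult_nth)
  next
    case (Suc k')
    then show ?thesis
      by (simp add: tower_gf_def var_y_mult_nth half_step_nth[OF assms(2)] fps_sum_nth list_gf_def card_left_towers_Suc)
  qed
qed

text \<open>The first row of a left tower ends strictly inside the base row, so its right end loses
  the flag and adds no growth. Cutting the base row off at that end therefore changes
  nothing.\<close>

lemma left_tower_base:
  assumes "ls \<noteq> []" "snd (hd ls) < int n"
  shows "valid X Y (0, int n) ls \<longleftrightarrow> valid X False (0, snd (hd ls)) ls"
    "weight (0, int n) ls = weight (0, snd (hd ls)) ls"
  using assms by (cases ls; auto simp: growth_def)+

text \<open>The right tower is reflected into a left one. \<open>a\<close> and \<open>b\<close>
  measure from either end of the base row to the inner end of the first tower row; the gap of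
  \<open>n - a - b\<close> columns has at least one, hence \<open>b < n - a\<close>.\<close>

lemma towers_above_decompose:
  defines "I \<equiv> \<lambda>m n k w. {(a, b, v, i). a \<in> {1..<n} \<and> b \<in> {1..<n - a} \<and> v \<in> {0..w} \<and> i \<in> {0..k} \<and>
    min i (k - i) = m}"
  shows "towers_above m X Y (0, int n) k w = (\<Union>z\<in>I m n k w. (\<lambda>(ls, rs). (ls, map (mirror_row (int n)) rs)) `
     (case z of (a, b, v, i) \<Rightarrow> left_towers X a i v \<times> left_towers Y b (k - i) (w - v)))"
proof (intro set_eqI iffI)
  fix x assume L: "x \<in> towers_above m X Y (0, int n) k w"
  obtain ls rs where x: "x = (ls, rs)" by (cases x)
  define rs' where "rs' = map (mirror_row (int n)) rs"
  have rs: "rs = map (mirror_row (int n)) rs'" by (simp add: rs'_def del: map_map)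
  have P: "ls \<noteq> []" "rs \<noteq> []" "valid X Y (0, int n) ls" "valid X Y (0, int n) rs"
    "snd (hd ls) < fst (hd rs)" "min (length ls) (length rs) = m" "length ls + length rs = k"
    "weight (0, int n) ls + weight (0, int n) rs = w"
    using L unfolding x towers_above_def by auto
  have m0: "mirror_row (int n) (0, int n) = (0, int n)" by (simp add: mirror_row_def)
  have V: "valid Y X (0, int n) rs'" "weight (0, int n) rs' = weight (0, int n) rs"
    using valid_mirror[of Y X "int n" "(0, int n)" rs] weight_mirror[of "int n" "(0, int n)" rs] P
    unfolding rs'_def m0 by auto
  have hd: "snd (hd rs') = int n - fst (hd rs)" "rs' \<noteq> []"
    using P(2) by (auto simp: rs'_def hd_map mirror_row_def)
  have len: "length rs' = length rs" by (simp add: rs'_def)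
  have pos: "0 < snd (hd ls)" "fst (hd rs) < int n"
    using P(1-4) by (cases ls; cases rs; auto)+
  define a where "a = nat (snd (hd ls))"
  define b where "b = nat (snd (hd rs'))"
  have ab: "snd (hd ls) = int a" "snd (hd rs') = int b" "1 \<le> a" "1 \<le> b" "a + b < n"
    using pos hd P(5) by (auto simp: a_def b_def)
  have "ls \<in> left_towers X a (length ls) (weight (0, int n) ls)"
    using left_tower_base[OF P(1), of n] P(3) ab by (auto simp: left_towers_def P(1))
  moreover have "rs' \<in> left_towers Y b (k - length ls) (w - weight (0, int n) ls)"
    using left_tower_base[OF hd(2), of n] V P(7,8) ab len by (auto simp: left_towers_def hd(2))
  moreover have "(a, b, weight (0, int n) ls, length ls) \<in> I m n k w"
    using ab P(6-8) by (auto simp: I_def)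
  ultimately show "x \<in> (\<Union>z\<in>I m n k w. (\<lambda>(ls, rs). (ls, map (mirror_row (int n)) rs)) `
     (case z of (a, b, v, i) \<Rightarrow> left_towers X a i v \<times> left_towers Y b (k - i) (w - v)))"
    unfolding x by (intro UN_I image_eqI[of _ _ "(ls, rs')"]) (auto simp: rs simp del: map_map)
next
  fix x assume "x \<in> (\<Union>z\<in>I m n k w. (\<lambda>(ls, rs). (ls, map (mirror_row (int n)) rs)) `
     (case z of (a, b, v, i) \<Rightarrow> left_towers X a i v \<times> left_towers Y b (k - i) (w - v)))"
  then obtain a b v i ls rs where z: "(a, b, v, i) \<in> I m n k w"
    and x: "x = (ls, map (mirror_row (int n)) rs)"
    and ls: "ls \<in> left_towers X a i v" and rs: "rs \<in> left_towers Y b (k - i) (w - v)" by auto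
  have m0: "mirror_row (int n) (0, int n) = (0, int n)" by (simp add: mirror_row_def)
  have ne: "ls \<noteq> []" "rs \<noteq> []" using ls rs by (auto simp: left_towers_def)
  have hd: "snd (hd ls) = int a" "snd (hd rs) = int b" using ls rs by (auto simp: left_towers_def)
  have lt: "snd (hd ls) < int n" "snd (hd rs) < int n" using z unfolding hd by (auto simp: I_def)
  have V: "valid X Y (0, int n) ls" "valid Y X (0, int n) rs"
    "weight (0, int n) ls = v" "weight (0, int n) rs = w - v"
    using ls rs left_tower_base[OF ne(1) lt(1)] left_tower_base[OF ne(2) lt(2)] unfolding hd
    by (auto simp: left_towers_def)
  have "valid X Y (0, int n) (map (mirror_row (int n)) rs)"
    "weight (0, int n) (map (mirror_row (int n)) rs) = w - v"
    using valid_mirror[of X Y "int n" "(0, int n)" rs] weight_mirror[of "int n" "(0, int n)" rs] V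
    unfolding m0 by auto
  moreover have "fst (hd (map (mirror_row (int n)) rs)) = int n - int b"
    using ne hd by (simp add: hd_map mirror_row_def)
  moreover have "length ls = i" "length rs = k - i" using ls rs by (auto simp: left_towers_def)
  ultimately show "x \<in> towers_above m X Y (0, int n) k w"
    using z V ne hd unfolding x towers_above_def I_def by auto
qed

text \<open>Minimum \<open>m\<close> means that one tower has exactly \<open>m\<close> rows and the
  other at least \<open>m\<close>; two towers of \<open>m\<close> rows are counted twice and
  subtracted once.\<close>

lemma towers_above_gf_product:
  assumes "0 < m"
  defines "S \<equiv> tower_gf (\<lambda>k. k = m)" and "T \<equiv> tower_gf (\<lambda>k. m \<le> k)"
  shows "towers_above_gf m X Y n = (\<Sum>a\<in>{1..<n}. \<Sum>b\<in>{1..<n - a}.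
    S X a * T Y b + T X a * S Y b - S X a * S Y b)"
proof (intro fps_ext)
  fix w k :: nat
  define I where "I = {(a, b, v, i). a \<in> {1..<n} \<and> b \<in> {1..<n - a} \<and> v \<in> {0..w} \<and> i \<in> {0..k} \<and>
    min i (k - i) = m}"
  define c where "c = (\<lambda>(a, b, v, i). card (left_towers X a i v) * card (left_towers Y b (k - i) (w - v)))"
  have fin: "finite I"
    by (rule finite_subset[of _ "{1..<n} \<times> {1..<n} \<times> {0..w} \<times> {0..k}"]) (auto simp: I_def)
  have "card (towers_above m X Y (0, int n) k w) = (\<Sum>z\<in>I. c z)"
    unfolding towers_above_decompose I_def[symmetric]
  proof (subst card_UN_image)
    fix z z' u u'
    assume "z \<in> I" "z' \<in> I"
      "u \<in> (case z of (a, b, v, i) \<Rightarrow> left_towers X a i v \<times> left_towers Y b (k - i) (w - v))"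
      "u' \<in> (case z' of (a, b, v, i) \<Rightarrow> left_towers X a i v \<times> left_towers Y b (k - i) (w - v))"
      "(case u of (ls, rs) \<Rightarrow> (ls, map (mirror_row (int n)) rs)) =
       (case u' of (ls, rs) \<Rightarrow> (ls, map (mirror_row (int n)) rs))"
    then show "z = z' \<and> u = u'"
      using inj_mirror_row by (auto simp: left_towers_def inj_map_eq_map)
  qed (auto simp: fin finite_left_towers c_def card_cartesian_product intro!: sum.cong)
  also have "\<dots> = (\<Sum>a\<in>{1..<n}. \<Sum>b\<in>{1..<n - a}. \<Sum>v\<in>{0..w}. \<Sum>i\<in>{0..k}.
      if min i (k - i) = m then c (a, b, v, i) else 0)"
  proof -
    define S where "S = Sigma {1..<n} (\<lambda>a. Sigma {1..<n - a} (\<lambda>b. Sigma {0..w} (\<lambda>v. {0..k})))"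
    have "I = {z \<in> S. case z of (a, b, v, i) \<Rightarrow> min i (k - i) = m}"
      by (auto simp: I_def S_def)
    moreover have "finite S" by (auto simp: S_def)
    ultimately have "sum c I = (\<Sum>z\<in>S. if case z of (a, b, v, i) \<Rightarrow> min i (k - i) = m then c z else 0)"
      by (simp add: sum.inter_filter)
    then show ?thesis by (simp add: S_def sum_Sigma)
  qed
  finally have card: "card (towers_above m X Y (0, int n) k w) = (\<Sum>a\<in>{1..<n}. \<Sum>b\<in>{1..<n - a}.
      \<Sum>v\<in>{0..w}. \<Sum>i\<in>{0..k}. if min i (k - i) = m then c (a, b, v, i) else 0)" .
  have prod: "fps_nth (fps_nth (tower_gf P X a * tower_gf Q Y b) w) k = (\<Sum>v\<in>{0..w}. \<Sum>i\<in>{0..k}.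
      if P i \<and> Q (k - i) then of_nat (c (a, b, v, i)) else 0)" for P Q a b
    by (auto simp: fps_mult_nth fps_sum_nth tower_gf_def c_def intro!: sum.cong)
  have min: "of_nat (if min i (k - i) = m then N else 0) =
      (if i = m \<and> m \<le> k - i then of_nat N else 0) + (if m \<le> i \<and> k - i = m then of_nat N else 0)
      - (if i = m \<and> k - i = m then of_nat N else (0 :: rat))" for i N
    by (auto simp: min_def)
  show "fps_nth (fps_nth (towers_above_gf m X Y n) w) k = fps_nth (fps_nth
      (\<Sum>a\<in>{1..<n}. \<Sum>b\<in>{1..<n - a}. S X a * T Y b + T X a * S Y b - S X a * S Y b) w) k"
    unfolding S_def T_def
    by (simp add: towers_above_gf_def card fps_sum_nth prod min sum.distrib sum_subtractf)
qed

section \<open>Series marking the width\<close>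

definition geom :: "'a::comm_ring_1 fps" where "geom = Abs_fps (\<lambda>_. 1)"

text \<open>The exponent of the new variable \<open>s\<close> is the width. The coefficient at 0 is
  set to 0: rows of width 0 do not occur, while \<open>f 0\<close> may be anything.\<close>

definition series :: "(nat \<Rightarrow> 'a::comm_ring_1) \<Rightarrow> 'a fps" where
  "series f = Abs_fps (\<lambda>n. if n = 0 then 0 else f n)"

definition sum_at_x :: "(nat \<Rightarrow> rat fps fps) \<Rightarrow> rat fps fps" where
  "sum_at_x f = Abs_fps (\<lambda>p. \<Sum>n\<in>{1..p}. fps_nth (f n) (p - n))"

lemma geom_inverse: "geom * (1 - fps_X) = (1 :: 'a::comm_ring_1 fps)"
  by (rule fps_ext) (simp add: geom_def algebra_simps)

lemma geom_mult_nth: "fps_nth (geom * f) n = (\<Sum>k\<le>n. fps_nth f k)"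
proof -
  have "fps_nth (f * geom) n = (\<Sum>k\<le>n. fps_nth f k)"
    by (simp add: fps_mult_nth geom_def atLeast0AtMost)
  then show ?thesis by (simp add: mult.commute)
qed

lemma series_add: "series (\<lambda>n. f n + g n) = series f + series g"
  by (rule fps_ext) (simp add: series_def)

lemma series_diff: "series (\<lambda>n. f n - g n) = series f - series g"
  by (rule fps_ext) (simp add: series_def)

lemma series_cmult: "series (\<lambda>n. c * f n) = fps_const c * series f"
  by (rule fps_ext) (simp add: series_def)

lemma series_cong: "(\<And>n. 0 < n \<Longrightarrow> f n = g n) \<Longrightarrow> series f = series g"
  by (rule fps_ext) (simp add: series_def)

lemma series_sums: "series (\<lambda>n. \<Sum>j\<in>{1..n}. f j) = geom * series f"
proof (rule fps_ext)
  fix n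
  have "(\<Sum>k\<le>n. fps_nth (series f) k) = (\<Sum>k\<in>{1..n}. f k)"
    unfolding series_def
    by (rule sum.mono_neutral_cong_right) (auto simp: not_less_eq_eq)
  then show "fps_nth (series (\<lambda>n. \<Sum>j\<in>{1..n}. f j)) n = fps_nth (geom * series f) n"
    by (simp add: geom_mult_nth) (simp add: series_def)
qed

lemma series_sums': "series (\<lambda>n. \<Sum>j\<in>{1..<n}. f j) = fps_X * geom * series f"
proof (rule fps_ext)
  fix n
  show "fps_nth (series (\<lambda>n. \<Sum>j\<in>{1..<n}. f j)) n = fps_nth (fps_X * geom * series f) n"
  proof (cases n)
    case (Suc k)
    have "fps_nth (fps_X * geom * series f) n = fps_nth (geom * series f) k"
      by (simp add: Suc mult.assoc)
    also have "\<dots> = fps_nth (series (\<lambda>n. \<Sum>j\<in>{1..n}. f j)) k" by (simp only: series_sums)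
    finally show ?thesis by (simp add: Suc series_def atLeastLessThanSuc_atLeastAtMost)
  qed (simp add: series_def mult.assoc)
qed

lemma series_one: "series (\<lambda>_. 1) = fps_X * (geom :: 'a::comm_ring_1 fps)"
  by (rule fps_ext) (simp add: series_def geom_def)

text \<open>Here \<open>n\<close> is the sum of \<open>a\<close>, \<open>b\<close> and a gap of at
  least one column, and the gap accounts for the factor \<open>s / (1 - s)\<close>.\<close>

lemma series_convolution:
  "series (\<lambda>n. \<Sum>a\<in>{1..<n}. \<Sum>b\<in>{1..<n - a}. f a * g b) = fps_X * geom * series f * series g"
proof (rule fps_ext)
  fix n
  let ?h = "\<lambda>n. \<Sum>b\<in>{1..<n}. g b"
  have "fps_nth (series f * series ?h) n = (\<Sum>a\<in>{0..n}. fps_nth (series f) a * fps_nth (series ?h) (n - a))"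
    by (rule fps_mult_nth)
  also have "\<dots> = (\<Sum>a\<in>{1..<n}. f a * ?h (n - a))"
    by (rule sum.mono_neutral_cong_right) (auto simp: series_def not_less_eq_eq)
  finally have "fps_nth (series f * series ?h) n = (if n = 0 then 0 else \<Sum>a\<in>{1..<n}. f a * ?h (n - a))"
    by simp
  then show "fps_nth (series (\<lambda>n. \<Sum>a\<in>{1..<n}. \<Sum>b\<in>{1..<n - a}. f a * g b)) n
      = fps_nth (fps_X * geom * series f * series g) n"
    unfolding series_sums' by (simp add: series_def sum_distrib_left mult_ac)
qed

lemma grow_Suc: "grow f n = f n + var_x * grow f (Suc n)" for f :: "nat \<Rightarrow> rat fps fps"
proof (rule fps_ext)
  fix w
  show "fps_nth (grow f n) w = fps_nth (f n + var_x * grow f (Suc n)) w"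
  proof (cases w)
    case (Suc k)
    have "(\<Sum>d\<le>Suc k. fps_nth (f (n + d)) (Suc k - d))
        = fps_nth (f n) (Suc k) + (\<Sum>d\<le>k. fps_nth (f (n + Suc d)) (Suc k - Suc d))"
      by (subst sum.atMost_Suc_shift) simp
    then show ?thesis by (simp add: Suc grow_def var_x_def)
  qed (simp add: grow_def var_x_def)
qed

lemma sum_at_x_grow: "sum_at_x f = var_x * grow f 1"
proof (rule fps_ext)
  fix p
  show "fps_nth (sum_at_x f) p = fps_nth (var_x * grow f 1) p"
  proof (cases p)
    case (Suc k)
    have "(\<Sum>n\<in>{1..Suc k}. fps_nth (f n) (Suc k - n)) = (\<Sum>n\<in>{0..k}. fps_nth (f (Suc n)) (k - n))"
      using sum.shift_bounds_cl_Suc_ivl[of "\<lambda>n. fps_nth (f n) (Suc k - n)" 0 k] by simp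
    then show ?thesis by (simp add: Suc sum_at_x_def grow_def var_x_def atLeast0AtMost)
  qed (simp add: sum_at_x_def var_x_def)
qed

text \<open>Summing \<open>grow f n = f n + x * grow f (n + 1)\<close> over \<open>n\<close> shows
  that the operator is a difference quotient between \<open>s\<close> and \<open>x\<close>. The
  boundary term is the value at \<open>s = x\<close>, the unknown that the kernel method has to
  find.\<close>

lemma series_grow:
  "(fps_X - fps_const var_x) * series (grow f) = fps_X * (series f - fps_const (sum_at_x f))"
proof (rule fps_ext)
  fix n
  show "fps_nth ((fps_X - fps_const var_x) * series (grow f)) n
      = fps_nth (fps_X * (series f - fps_const (sum_at_x f))) n"
  proof (cases n)
    case (Suc k)
    then show ?thesis
      using grow_Suc[of f k] by (cases k) (simp_all add: left_diff_distrib series_def sum_at_x_grow)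
  qed (simp add: left_diff_distrib series_def)
qed

section \<open>Substitution of a series without constant term\<close>

definition fps_eval :: "'a::comm_ring_1 fps \<Rightarrow> 'a fps fps \<Rightarrow> 'a fps" where
  "fps_eval a F = Abs_fps (\<lambda>p. \<Sum>n\<le>p. fps_nth (fps_nth F n * a ^ n) p)"

lemma mult_power_nth_zero:
  fixes a c :: "'a::comm_ring_1 fps"
  assumes "fps_nth a 0 = 0" "p < n"
  shows "fps_nth (c * a ^ n) p = 0"
  unfolding fps_mult_nth
  by (rule sum.neutral) (use assms startsby_zero_power_prefix[OF assms(1), of n] in auto)

text \<open>\<open>a ^ n\<close> starts at degree \<open>n\<close>, so every cutoff from
  \<open>p\<close> on gives the same coefficient.\<close>

lemma fps_eval_nth:
  assumes "fps_nth a 0 = 0" "p \<le> N"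
  shows "fps_nth (fps_eval a F) p = (\<Sum>n\<le>N. fps_nth (fps_nth F n * a ^ n) p)"
  unfolding fps_eval_def fps_nth_Abs_fps
proof (rule sum.mono_neutral_left)
  show "\<forall>n\<in>{..N} - {..p}. fps_nth (fps_nth F n * a ^ n) p = 0"
    using mult_power_nth_zero[OF assms(1)] by simp
qed (use assms in auto)

text \<open>Terms with \<open>i + j > p\<close> vanish at degree \<open>p\<close>, so the square of
  index pairs shrinks to the triangle of the Cauchy product.\<close>

lemma fps_eval_mult:
  assumes "fps_nth a 0 = 0"
  shows "fps_eval a (F * G) = fps_eval a F * fps_eval a G"
proof (rule fps_ext)
  fix p
  define A where "A i = fps_nth F i * a ^ i" for i
  define B where "B i = fps_nth G i * a ^ i" for i
  have AB: "A i * B j = fps_nth F i * fps_nth G j * a ^ (i + j)" for i j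
    by (simp add: A_def B_def power_add mult_ac)
  have "fps_nth (fps_eval a F * fps_eval a G) p
      = (\<Sum>k\<in>{0..p}. (\<Sum>i\<le>p. fps_nth (A i) k) * (\<Sum>j\<le>p. fps_nth (B j) (p - k)))"
    unfolding fps_mult_nth by (rule sum.cong) (auto simp: fps_eval_nth[OF assms, of _ p] A_def B_def)
  also have "\<dots> = (\<Sum>k\<in>{0..p}. \<Sum>i\<le>p. \<Sum>j\<le>p. fps_nth (A i) k * fps_nth (B j) (p - k))"
    by (simp add: sum_product)
  also have "\<dots> = (\<Sum>i\<le>p. \<Sum>j\<le>p. fps_nth (A i * B j) p)"
    unfolding fps_mult_nth by (subst sum.swap) (intro sum.cong refl sum.swap)
  also have "\<dots> = (\<Sum>(i, j)\<in>{..p} \<times> {..p}. fps_nth (A i * B j) p)"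
    by (rule sum.cartesian_product)
  also have "\<dots> = (\<Sum>(i, j)\<in>{(i, j). i + j \<le> p}. fps_nth (A i * B j) p)"
  proof (rule sum.mono_neutral_right)
    show "\<forall>z\<in>{..p} \<times> {..p} - {(i, j). i + j \<le> p}. (case z of (i, j) \<Rightarrow> fps_nth (A i * B j) p) = 0"
    proof
      fix z assume z: "z \<in> {..p} \<times> {..p} - {(i, j). i + j \<le> p}"
      obtain i j where "z = (i, j)" by (cases z)
      with z show "(case z of (i, j) \<Rightarrow> fps_nth (A i * B j) p) = 0"
        by (simp add: AB mult_power_nth_zero[OF assms])
    qed
  qed auto
  also have "\<dots> = (\<Sum>n\<le>p. \<Sum>i\<le>n. fps_nth (A i * B (n - i)) p)"
    by (rule sum.triangle_reindex_eq)
  also have "\<dots> = (\<Sum>n\<le>p. fps_nth (fps_nth (F * G) n * a ^ n) p)"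
  proof (rule sum.cong[OF refl])
    fix n
    have "fps_nth (F * G) n * a ^ n = (\<Sum>i\<le>n. A i * B (n - i))"
      unfolding AB by (simp add: fps_mult_nth sum_distrib_right atLeast0AtMost)
    then show "(\<Sum>i\<le>n. fps_nth (A i * B (n - i)) p) = fps_nth (fps_nth (F * G) n * a ^ n) p"
      by (simp add: fps_sum_nth)
  qed
  finally show "fps_nth (fps_eval a (F * G)) p = fps_nth (fps_eval a F * fps_eval a G) p"
    by (simp add: fps_eval_def)
qed

lemma fps_eval_add: "fps_eval a (F + G) = fps_eval a F + fps_eval a G"
  by (rule fps_ext) (simp add: fps_eval_def sum.distrib distrib_right)

lemma fps_eval_const: "fps_eval a (fps_const c) = c"
proof (rule fps_ext)
  fix p
  have "(\<Sum>n\<le>p. fps_nth (fps_nth (fps_const c) n * a ^ n) p) = (\<Sum>n\<le>p. if n = 0 then fps_nth c p else 0)"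
    by (rule sum.cong) auto
  then show "fps_nth (fps_eval a (fps_const c)) p = fps_nth c p"
    by (simp add: fps_eval_def)
qed

lemma fps_eval_X:
  assumes "fps_nth a 0 = 0"
  shows "fps_eval a fps_X = a"
proof (rule fps_ext)
  fix p
  have "(\<Sum>n\<le>Suc p. fps_nth (fps_nth fps_X n * a ^ n) p) = (\<Sum>n\<le>Suc p. if n = 1 then fps_nth a p else 0)"
    by (rule sum.cong) auto
  then show "fps_nth (fps_eval a fps_X) p = fps_nth a p"
    by (simp add: fps_eval_nth[OF assms, of p "Suc p"])
qed

lemma fps_eval_series: "fps_eval var_x (series f) = sum_at_x f"
proof (rule fps_ext)
  fix p
  have "(\<Sum>n\<le>p. fps_nth (fps_nth (series f) n * var_x ^ n) p) = (\<Sum>n\<in>{1..p}. fps_nth (f n) (p - n))"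
    by (rule sum.mono_neutral_cong_right) (auto simp: series_def var_x_def fps_X_power_mult_right_nth)
  then show "fps_nth (fps_eval var_x (series f)) p = fps_nth (sum_at_x f) p"
    by (simp add: fps_eval_def sum_at_x_def)
qed

section \<open>Ring homomorphisms acting on coefficients\<close>

definition fps_map :: "('a::comm_ring_1 \<Rightarrow> 'b::comm_ring_1) \<Rightarrow> 'a fps \<Rightarrow> 'b fps" where
  "fps_map h F = Abs_fps (\<lambda>n. h (fps_nth F n))"

definition is_ring_hom :: "('a::comm_ring_1 \<Rightarrow> 'b::comm_ring_1) \<Rightarrow> bool" where
  "is_ring_hom h \<longleftrightarrow> h 1 = 1 \<and> (\<forall>a b. h (a + b) = h a + h b) \<and> (\<forall>a b. h (a * b) = h a * h b)"

lemma is_ring_homD: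
  assumes "is_ring_hom h"
  shows "h 0 = 0" "h 1 = 1" "h (a + b) = h a + h b" "h (a * b) = h a * h b" "h (- a) = - h a"
    "h (a - b) = h a - h b" "h (a ^ n) = h a ^ n" "h (numeral k) = numeral k"
proof -
  have 1: "h 1 = 1" and add: "h (a + b) = h a + h b" and mult: "h (a * b) = h a * h b" for a b
    using assms by (auto simp: is_ring_hom_def)
  show 0: "h 0 = 0" using add[of 0 0] by simp
  show "h 1 = 1" "h (a + b) = h a + h b" "h (a * b) = h a * h b" by (fact 1 add mult)+
  have neg: "h (- a) = - h a" for a using add[of a "- a"] 0 by (simp add: eq_neg_iff_add_eq_0 add.commute)
  then show "h (- a) = - h a" .
  show "h (a - b) = h a - h b" using add[of a "- b"] neg by simp
  show "h (a ^ n) = h a ^ n" by (induction n) (simp_all add: 1 mult)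
  have "h (of_nat m) = of_nat m" for m by (induction m) (simp_all add: 0 1 add)
  from this[of "numeral k"] show "h (numeral k) = numeral k" by simp
qed

lemma is_ring_hom_fps_map:
  assumes "is_ring_hom h" shows "is_ring_hom (fps_map h)"
proof -
  note h = is_ring_homD[OF assms]
  have sum: "h (sum f A) = (\<Sum>a\<in>A. h (f a))" for f and A :: "nat set"
    by (induction A rule: infinite_finite_induct) (simp_all add: h)
  show ?thesis
    unfolding is_ring_hom_def
    by (auto intro!: fps_ext simp: fps_map_def h fps_mult_nth sum fps_one_nth)
qed

lemma is_ring_hom_comp: "is_ring_hom g \<Longrightarrow> is_ring_hom h \<Longrightarrow> is_ring_hom (\<lambda>a. g (h a))"
  by (simp add: is_ring_hom_def)

lemma is_ring_hom_fps_eval: "fps_nth a 0 = 0 \<Longrightarrow> is_ring_hom (fps_eval a)"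
  unfolding is_ring_hom_def
  using fps_eval_const[of a 1] by (simp add: fps_eval_add fps_eval_mult)

lemma fps_map_const: "is_ring_hom h \<Longrightarrow> fps_map h (fps_const c) = fps_const (h c)"
  by (rule fps_ext) (simp add: fps_map_def is_ring_homD)

lemma fps_map_X: "is_ring_hom h \<Longrightarrow> fps_map h fps_X = fps_X"
  by (rule fps_ext) (simp add: fps_map_def is_ring_homD)

lemma fps_map_eval:
  assumes "is_ring_hom h"
  shows "fps_eval (fps_map h a) (fps_map (fps_map h) F) = fps_map h (fps_eval a F)"
proof (rule fps_ext)
  fix p
  note h = is_ring_homD[OF assms] and hm = is_ring_homD[OF is_ring_hom_fps_map[OF assms]]
  have sum: "h (sum f A) = (\<Sum>a\<in>A. h (f a))" for f and A :: "nat set"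
    by (induction A rule: infinite_finite_induct) (simp_all add: h)
  have "fps_nth (fps_map (fps_map h) F) n * fps_map h a ^ n = fps_map h (fps_nth F n * a ^ n)" for n
    by (simp add: hm) (simp add: fps_map_def)
  then show "fps_nth (fps_eval (fps_map h a) (fps_map (fps_map h) F)) p = fps_nth (fps_map h (fps_eval a F)) p"
    by (simp add: fps_eval_def) (simp add: fps_map_def sum)
qed

text \<open>Substituting \<open>y\<^sup>2\<close> for \<open>y\<close> makes \<open>\<surd>y\<close> available as the series \<open>y\<close>.\<close>

definition square_y :: "rat fps \<Rightarrow> rat fps" where
  "square_y f = f oo fps_X ^ 2"

lemma is_ring_hom_square_y: "is_ring_hom square_y"
  by (simp add: is_ring_hom_def square_y_def fps_compose_add_distrib fps_compose_mult_distrib)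

lemma square_y_inj: "square_y f = square_y g \<Longrightarrow> f = g"
proof (rule fps_ext)
  fix n assume "square_y f = square_y g"
  then have "fps_nth (square_y f) (2 * n) = fps_nth (square_y g) (2 * n)" by simp
  then show "fps_nth f n = fps_nth g n" by (simp add: square_y_def fps_nth_compose_X_power)
qed

lemma fps_map_square_y_inj: "fps_map square_y f = fps_map square_y g \<Longrightarrow> f = g"
  unfolding fps_map_def fps_eq_iff[of "Abs_fps _"] fps_nth_Abs_fps
  by (rule fps_ext) (simp add: square_y_inj)

section \<open>Rational values of the series\<close>

text \<open>These are closed forms of width series at a point \<open>s\<close>. A short tower has
  exactly two rows and a tall one at least two; \<open>F\<close> and \<open>T\<close> tell whether
  its outer side may still widen. In \<open>complete_F\<close> neither side of the base may.\<close>

definition short_F :: "'a::field \<Rightarrow> 'a \<Rightarrow> 'a" where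
  "short_F y s = y ^ 2 * s / (1 - s) ^ 4"

definition tall_F :: "'a::field \<Rightarrow> 'a \<Rightarrow> 'a" where
  "tall_F y s = y ^ 2 * s / ((1 - s) ^ 2 * ((1 - s) ^ 2 - y))"

definition complete_F :: "'a::field \<Rightarrow> 'a \<Rightarrow> 'a" where
  "complete_F y s =
     s * (1 - s) / ((1 - s) ^ 2 - y) * (2 * short_F y s * tall_F y s - short_F y s ^ 2)"

definition rows_T :: "'a::field \<Rightarrow> 'a \<Rightarrow> 'a \<Rightarrow> 'a" where
  "rows_T x y s = y * s / (1 - s) ^ 2 * (1 / (1 - x) + s / (1 - s))"

text \<open>\<open>d\<close> stands for \<open>(s - x) / s\<close>, which divides in the difference
  quotient. It is \<open>v\<close> at \<open>x / (1 - v)\<close>, \<open>- v\<close> at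
  \<open>x / (1 + v)\<close>, and \<open>Y\<close> at the root \<open>X\<close> of the other
  kernel.\<close>

definition short_T :: "'a::field \<Rightarrow> 'a \<Rightarrow> 'a \<Rightarrow> 'a \<Rightarrow> 'a" where
  "short_T x y d s = y * ((rows_T x y s - rows_T x y x) / d + y * s ^ 2 / (1 - s) ^ 4)"

text \<open>\<open>U\<close> is the value at \<open>s\<close> of the series of all lists with one
  widening side. Solving its equation for the difference quotient expresses the tall towers without
  a further unknown.\<close>

definition tall_T :: "'a::field \<Rightarrow> 'a \<Rightarrow> 'a \<Rightarrow> 'a \<Rightarrow> 'a" where
  "tall_T x y U s = (1 - s) * U - s - y * s / ((1 - s) * (1 - x)) - y * s ^ 2 / (1 - s) ^ 2"

definition pair_TF :: "'a::field \<Rightarrow> 'a \<Rightarrow> 'a \<Rightarrow> 'a \<Rightarrow> 'a" where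
  "pair_TF y S T s = s / (1 - s) * (S * tall_F y s + T * short_F y s - S * short_F y s)"

definition pair_TT :: "'a::field \<Rightarrow> 'a \<Rightarrow> 'a \<Rightarrow> 'a" where
  "pair_TT S T s = s / (1 - s) * (2 * S * T - S ^ 2)"

text \<open>At \<open>s = x / (1 - v)\<close> with \<open>v\<^sup>2 = y\<close> the kernel of the phase in which both boundaries grow
  vanishes.\<close>

definition lists_at :: "'a::field \<Rightarrow> 'a \<Rightarrow> 'a \<Rightarrow> 'a \<Rightarrow> 'a" where
  "lists_at u v y s = (s * ((1 - s) ^ 2 - y + y * s) - v * u * ((1 - s) ^ 2 - y))
     / ((1 - s - v) * ((1 - s) ^ 2 - y))"

text \<open>What remains when the kernel for two widening sides vanishes. \<open>u\<close> and
  \<open>g\<close> are the values at \<open>s = x\<close> of the series of lists and of completions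
  with one widening side; \<open>G\<close> is the latter series at \<open>s\<close>.\<close>

definition kernel_value :: "'a::field \<Rightarrow> 'a \<Rightarrow> 'a \<Rightarrow> 'a \<Rightarrow> 'a \<Rightarrow> 'a \<Rightarrow> 'a" where
  "kernel_value x y u g v s = (let
       S = short_T x y v s; T = tall_T x y (lists_at u v y s) s; P = pair_TF y S T s;
       G = ((1 - s) * P + y * s / (1 - s) * complete_F y s - v * g) / (1 - s - v)
     in pair_TT S T s + 2 * s * (G - P) - y * s ^ 2 / (1 - s) ^ 2 * complete_F y s)"

text \<open>Up to a common factor, \<open>root_rational + root_radical * \<Delta>\<^sup>1\<^sup>/\<^sup>2\<close> is the value of
  \<open>completion_gf 2 True False\<close> summed over all widths, and \<open>root_core\<close> is the same value in
  the parameters \<open>X\<close>, \<open>Y\<close>; see \<open>root_values\<close>.\<close>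

definition root_rational :: "'a::comm_ring_1 \<Rightarrow> 'a \<Rightarrow> 'a" where
  "root_rational x y =
    - 4 * (1 - x) ^ 9
    + (1 - x) ^ 7 * (16 + 18 * x) * y
    - (1 - x) ^ 5 * (24 + 24 * x + 30 * x ^ 2) * y ^ 2
    + (1 - x) ^ 3 * (16 - 7 * x - 12 * x ^ 2 + 21 * x ^ 3) * y ^ 3
    - (1 - x) * (4 - 16 * x - 3 * x ^ 2 - 28 * x ^ 3 + 3 * x ^ 4) * y ^ 4
    - x * (3 + x - 9 * x ^ 2 - 3 * x ^ 3) * y ^ 5
    - x ^ 2 * (1 + x) * y ^ 6"

definition root_radical :: "'a::comm_ring_1 \<Rightarrow> 'a \<Rightarrow> 'a" where
  "root_radical x y =
    4 * (1 - x) ^ 8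
    - (1 - x) ^ 6 * (12 + 14 * x) * y
    + (1 - x) ^ 4 * (12 + 6 * x + 16 * x ^ 2) * y ^ 2
    - (1 - x) ^ 2 * (4 - 9 * x - 14 * x ^ 2 + 5 * x ^ 3) * y ^ 3
    - x * (3 - 4 * x + 7 * x ^ 2 + 2 * x ^ 3) * y ^ 4
    + x ^ 2 * (1 + x) * y ^ 5"

text \<open>The numerators of \<open>kernel_value\<close> and its parts at \<open>s = x / (1 - v)\<close>; see
  \<open>kernel_value_at_conjugate\<close>.\<close>

definition conj_short :: "'a::comm_ring_1 \<Rightarrow> 'a \<Rightarrow> 'a" where
  "conj_short x v = (1 - v) ^ 2 + x * (1 - v) * (3 - v) - x ^ 2 * (3 - 2 * v) - x ^ 3"

definition conj_tall :: "'a::comm_ring_1 \<Rightarrow> 'a \<Rightarrow> 'a" where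
  "conj_tall x v = 1 - 3 * v + 4 * v ^ 2 - 3 * v ^ 3 + v ^ 4 - x * (2 - 3 * v + v ^ 3) + x ^ 2"

definition conj_pair :: "'a::comm_ring_1 \<Rightarrow> 'a \<Rightarrow> 'a" where
  "conj_pair x v = conj_short x v * (2 * conj_tall x v * (1 - v - x) * (1 - x) ^ 2 - v ^ 3 * conj_short x v * ((1 - v) ^ 2 - x))"

text \<open>The terms linear in \<open>u\<close> of the two kernel values, over a common
  denominator. Their part with \<open>root_rational\<close> will cancel against the contribution of
  \<open>g\<close>; \<open>A2c\<close> is what is left.\<close>

lemma conj_short_sum:
  fixes x v :: "'a::field"
  shows "x * v ^ 7 * (conj_short x (- v) * (1 - v - x) * ((1 - v) ^ 2 - x) ^ 2
      - conj_short x v * (1 + v - x) * ((1 + v) ^ 2 - x) ^ 2)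
    = 2 * (root_rational x (v ^ 2) * ((1 - x) ^ 2 - v ^ 2) - A2c x (v ^ 2))"
  unfolding conj_short_def root_rational_def A2c_def by algebra

definition root_core :: "'a::comm_ring_1 \<Rightarrow> 'a \<Rightarrow> 'a" where
  "root_core X Y = (1 - Y) * (1 + Y) + X * (1 - Y) * (1 + 5 * Y - Y ^ 2)
    - X ^ 2 * (8 - 2 * Y - 5 * Y ^ 2 + 3 * Y ^ 3) + X ^ 3 * (1 - Y) * (8 - 6 * Y + 3 * Y ^ 2)
    - X ^ 4 * (1 - Y) * (1 - 5 * Y + Y ^ 2) - X ^ 5 * (1 - Y) ^ 2"

text \<open>In the parameters \<open>X\<close> and \<open>Y\<close> the radical becomes
  \<open>1 - X - Y\<close>, so the splitting into a rational and a radical part is a polynomial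
  identity.\<close>

lemma root_core_split:
  fixes X Y :: "'a::field"
  assumes x: "x = X * (1 - Y)" and y: "y = Y * (1 - X)"
  shows "2 * X ^ 2 * Y ^ 6 * root_core X Y = root_rational x y + root_radical x y * (1 - X - Y)"
  unfolding root_core_def root_rational_def root_radical_def x y by algebra

text \<open>The terms free of \<open>u\<close> and \<open>g\<close>. Here the part with
  \<open>root_radical\<close> will cancel against \<open>g\<close>, and \<open>B2c\<close> is what
  is left.\<close>

lemma conj_pair_sum:
  fixes x v :: "'a::field"
  shows "x * v ^ 7 * (conj_pair x v * ((1 + v - x) * ((1 + v) ^ 2 - x)) ^ 3
      - conj_pair x (- v) * ((1 - v - x) * ((1 - v) ^ 2 - x)) ^ 3)
    = 4 * root_radical x (v ^ 2) * Delta x (v ^ 2) * (1 - x) ^ 3 * ((1 - x) ^ 2 - v ^ 2) ^ 3 - 2 * B2c x (v ^ 2) * (1 - x)"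
  unfolding conj_pair_def conj_short_def conj_tall_def root_radical_def B2c_def Delta_def by algebra

text \<open>With the corrections \<open>W\<close> and \<open>R\<close> the convolution terms factor, which keeps the numerators at
  \<open>s = x / (1 - v)\<close> small.\<close>

lemma kernel_value_combine:
  fixes s v f g S T :: "'a::field"
  assumes "1 - s \<noteq> 0" "1 - s - v \<noteq> 0" "1 - s + v \<noteq> 0"
    and t: "t = (1 - s) ^ 2 * f / ((1 - s - v) * (1 - s + v))"
    and C: "C = s * (1 - s) / ((1 - s - v) * (1 - s + v)) * (2 * f * t - f ^ 2)"
    and P: "P = s / (1 - s) * (S * t + T * f - S * f)"
    and W: "W = S + s * v / (1 - s - v) * f" and R: "R = T + s * v / (1 - s - v) * t"
  shows "s / (1 - s) * (2 * S * T - S ^ 2) + 2 * s * (((1 - s) * P + v ^ 2 * s / (1 - s) * C - v * g) / (1 - s - v) - P)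
      - v ^ 2 * s ^ 2 / (1 - s) ^ 2 * C
    = s / (1 - s) * W * (2 * R - W) - 2 * s * v * g / (1 - s - v)"
proof -
  define n p q where "n = 1 - s" and "p = 1 - s - v" and "q = 1 - s + v"
  have nz: "n \<noteq> 0" "p \<noteq> 0" "q \<noteq> 0" using assms(1-3) by (simp_all add: n_def p_def q_def)
  have q: "q = n + v" and p: "p = n - v" by (simp_all add: n_def p_def q_def)
  show ?thesis
    unfolding C P W R t n_def[symmetric] p[symmetric] q[symmetric]
    apply (simp add: divide_simps nz)
    unfolding q p apply algebra
    done
qed

text \<open>At \<open>s = x / (1 - v)\<close> the denominators split: \<open>1 - s\<close>,
  \<open>1 - s - v\<close>, \<open>1 - s + v\<close> become \<open>b / a\<close>,
  \<open>d / a\<close>, \<open>e / a\<close>. In \<open>W\<close> and \<open>R\<close> the factor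
  \<open>e\<close> and surplus powers of \<open>b\<close> cancel, so the result has neither.\<close>

lemma kernel_value_at_conjugate:
  fixes x v u g :: "'a::field"
  assumes a: "a = 1 - v" and b: "b = 1 - v - x" and c: "c = 1 - x" and d: "d = (1 - v) ^ 2 - x"
    and nz: "v \<noteq> 0" "a \<noteq> 0" "b \<noteq> 0" "c \<noteq> 0" "d \<noteq> 0" "1 - x - v ^ 2 \<noteq> 0"
  shows "kernel_value x (v ^ 2) u g v (x / a) =
    x ^ 3 * v ^ 5 * conj_pair x v / (c ^ 6 * b ^ 3 * d ^ 3)
    - 2 * x ^ 2 * v ^ 5 * conj_short x v * u / (c ^ 3 * b * d ^ 2) - 2 * x * v * g / d"
proof -
  define s e where "s = x / a" and "e = 1 - x - v ^ 2"
  have e: "e \<noteq> 0" using nz by (simp add: e_def)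
  have s1: "1 - s = b / a" using nz unfolding s_def a b by (simp add: field_simps)
  have sm: "b / a - v = d / a"
    apply (simp add: divide_simps nz) unfolding a b d by algebra
  have sp: "b / a + v = e / a"
    apply (simp add: divide_simps nz) unfolding a b e_def by algebra
  have q: "(1 - s) ^ 2 - v ^ 2 = (1 - s - v) * (1 - s + v)" by algebra
  have q': "(b / a) ^ 2 - v ^ 2 = d / a * (e / a)" unfolding sm[symmetric] sp[symmetric] by algebra
  have c': "1 - x = c" by (simp add: c)
  define W R where "W = short_T x (v ^ 2) v s + s * v / (1 - s - v) * short_F (v ^ 2) s"
    and "R = tall_T x (v ^ 2) (lists_at u v (v ^ 2) s) s + s * v / (1 - s - v) * tall_F (v ^ 2) s"
  have F: "tall_F (v ^ 2) s = (1 - s) ^ 2 * short_F (v ^ 2) s / ((1 - s - v) * (1 - s + v))"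
    using nz e unfolding tall_F_def short_F_def s1 sm sp q' by (simp add: divide_simps power4_eq_xxxx power2_eq_square)
  have H: "kernel_value x (v ^ 2) u g v s = s / (1 - s) * W * (2 * R - W) - 2 * s * v * g / (1 - s - v)"
    unfolding kernel_value_def Let_def pair_TT_def
  proof (rule kernel_value_combine[OF _ _ _ F _ _ W_def R_def])
    show "1 - s \<noteq> 0" "1 - s - v \<noteq> 0" "1 - s + v \<noteq> 0" unfolding s1 sm sp using nz e by simp_all
  qed (simp_all add: complete_F_def pair_TF_def q)
  \<comment> \<open>Termwise clearing needs \<open>b ^ 4\<close>, but the numerator turns out to
    have the factor \<open>b ^ 3\<close>, which is divided out below.\<close>
  have "W * (c ^ 3 * b ^ 4 * d) = x * v ^ 3 * (a * c ^ 2 * b ^ 2 * d + a * x * c ^ 3 * b * d - (1 + x) * b ^ 4 * d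
      + v * x * a ^ 2 * c ^ 3 * d + v ^ 2 * x * a ^ 3 * c ^ 3)"
    unfolding W_def short_T_def rows_T_def short_F_def sm s1 unfolding s_def c'
    apply (simp add: divide_simps nz) unfolding c by algebra
  also have "\<dots> = x * v ^ 3 * (v * conj_short x v * b ^ 3)"
    unfolding conj_short_def a b c d by algebra
  finally have "b ^ 3 * (W * (c ^ 3 * b * d)) = b ^ 3 * (x * v ^ 4 * conj_short x v)" by algebra
  then have W: "W = x * v ^ 4 * conj_short x v / (c ^ 3 * b * d)"
    using nz by (simp add: divide_simps)
  have "(R + v * b * u / d) * (a * b ^ 2 * c * d ^ 2 * e) = x * (b ^ 3 * c * (d * e + v ^ 2 * x * a)
      - b ^ 2 * c * d ^ 2 * e - v ^ 2 * a * b * d ^ 2 * e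
      - v ^ 2 * x * a * c * d ^ 2 * e + v ^ 5 * x * a ^ 4 * c)"
    unfolding R_def tall_T_def lists_at_def tall_F_def s1 sm q' unfolding s_def c'
    apply (simp add: divide_simps nz e) by algebra
  also have "\<dots> = x * (v * conj_tall x v * a * b ^ 2 * e)"
    unfolding conj_tall_def a b c d e_def by algebra
  finally have "a * b ^ 2 * e * ((R + v * b * u / d) * (c * d ^ 2)) = a * b ^ 2 * e * (x * v * conj_tall x v)"
    by algebra
  then have "R + v * b * u / d = x * v * conj_tall x v / (c * d ^ 2)"
    unfolding mult_cancel_left using nz e by (subst nonzero_eq_divide_eq) simp_all
  then have R: "R = x * v * conj_tall x v / (c * d ^ 2) - v * b * u / d" by (simp add: algebra_simps)
  have P: "conj_pair x v = conj_short x v * (2 * conj_tall x v * b * c ^ 2 - v ^ 3 * conj_short x v * d)"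
    by (simp add: conj_pair_def b c d)
  show ?thesis
    unfolding s_def[symmetric] H W R P sm s1 unfolding s_def
    apply (simp add: divide_simps nz) by algebra
qed

text \<open>With \<open>X\<close> and \<open>Y\<close> as parameters, \<open>x\<close>, \<open>y\<close> and the square root \<open>r\<close> of \<open>\<Delta>\<close> are
  polynomials.\<close>

lemma root_values:
  fixes X Y :: "'a::field"
  assumes x: "x = X * (1 - Y)" and y: "y = Y * (1 - X)"
    and n: "n = 1 - X" and c: "c = 1 - x" and r: "r = 1 - X - Y"
    and nz: "Y \<noteq> 0" "n \<noteq> 0" "c \<noteq> 0" "r \<noteq> 0"
    and u: "u = X / (1 - X) * (1 + y * X / ((1 - X) ^ 2 - y))"
    and m: "m = x + y * u + 2 - y"
    and U: "U = X * (X ^ 2 + (X - m) * X + ((1 - y) + x * (2 - y) + 2 * y * u - m * X + X ^ 2))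
      / ((1 - Y - X) * ((1 - X) ^ 2 - y))"
    and g: "g = pair_TF y (short_T x y Y X) (tall_T x y U X) X + y * X / (1 - X) ^ 2 * complete_F y X"
  shows "u = x / r" "2 * y ^ 2 * c ^ 3 * r ^ 3 * g = x * (root_rational x y + root_radical x y * r)"
proof -
  have n': "1 - X = n" "1 - x = c" "1 - Y - X = r" by (simp_all add: n c r)
  have q: "n ^ 2 - Y * n = n * r" unfolding n r by algebra
  have yn: "y = Y * n" by (simp add: y n)
  have "u * (n * r) = X * (r + Y * X)"
    unfolding u n' yn q using nz by (simp add: divide_simps)
  also have "\<dots> = X * ((1 - Y) * n)" unfolding n r by algebra
  finally show u': "u = x / r"
    using nz unfolding x by (simp add: divide_simps mult_ac)
  define w where "w = (1 - Y) ^ 2 * (1 - X * (2 + Y)) + X ^ 2 * (1 - Y + Y ^ 2)"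
  have "U * (r * (n * r)) = X * (X ^ 2 + (X - m) * X + ((1 - y) + x * (2 - y) + 2 * y * u - m * X + X ^ 2))"
    unfolding U n' yn q using nz by simp
  then have "U * (r * (n * r)) * r = X * (r * (3 * X ^ 2 - 2 * (x + 2 - y) * X + 1 - y + 2 * x - x * y)
      + 2 * y * n * (u * r))"
    unfolding m n by algebra
  also have "u * r = x" unfolding u' using nz by simp
  also have "X * (r * (3 * X ^ 2 - 2 * (x + 2 - y) * X + 1 - y + 2 * x - x * y) + 2 * y * n * x) = n * X * w"
    unfolding w_def r x y n by algebra
  finally have "n * (U * r ^ 3) = n * (X * w)" by algebra
  then have U': "U = X * w / r ^ 3" using nz by (simp add: divide_simps)
  define S where "S = 1 + X * (1 - Y) - 8 * X ^ 2 * (1 - Y) + X ^ 3 * (1 - Y) * (8 - 3 * Y)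
    - X ^ 4 * (1 - Y) * (1 - Y + Y ^ 2) - X ^ 5 * (1 - Y) ^ 2"
  define T where "T = (1 - Y) ^ 2 + X * (1 - Y) ^ 2 - X ^ 2 * (8 - 14 * Y + 6 * Y ^ 2 - Y ^ 3)
    + X ^ 3 * (1 - Y) * (8 - 5 * Y) - X ^ 4 * (1 - Y) ^ 2 - X ^ 5 * (1 - Y)"
  have "short_T x y Y X * (n ^ 2 * c ^ 3) = Y * (X * n ^ 2 * c ^ 2 + X ^ 2 * n * c ^ 3 - n ^ 4 * x * (1 + x)
      + Y * X ^ 2 * c ^ 3)"
    unfolding short_T_def rows_T_def n' yn by (simp add: divide_simps nz) algebra
  also have "\<dots> = Y * (X * Y * S)"
    unfolding S_def c n x by algebra
  finally have S: "short_T x y Y X = X * Y ^ 2 * S / (n ^ 2 * c ^ 3)"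
    using nz by (simp add: divide_simps power2_eq_square mult_ac)
  have "tall_T x y U X * (n * c * r ^ 3) = X * (n ^ 2 * c * w - r ^ 3 * n * c - Y * r ^ 3 * n - X * Y * r ^ 3 * c)"
    unfolding tall_T_def n' yn U' by (simp add: divide_simps nz) algebra
  also have "\<dots> = X * (Y ^ 2 * T)"
    unfolding T_def w_def c n r x by algebra
  finally have T: "tall_T x y U X = X * Y ^ 2 * T / (n * c * r ^ 3)"
    using nz by (simp add: divide_simps mult_ac)
  have F: "short_F y X = X * Y ^ 2 / n ^ 2" "tall_F y X = X * Y ^ 2 / (n * r)"
    unfolding short_F_def tall_F_def n' yn q
    using nz by (simp_all add: divide_simps power2_eq_square power4_eq_xxxx mult_ac)
  have "g * (n ^ 5 * c ^ 3 * r ^ 3) = X ^ 3 * Y ^ 4 * (n ^ 1 * c ^ 2 * T + S * r ^ 2 * Y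
      + X * Y * (2 * n - r) * c ^ 3 * r)"
    unfolding g complete_F_def pair_TF_def S T F unfolding n' yn q
    apply (simp add: divide_simps nz) unfolding n r by algebra
  also have "\<dots> = X ^ 3 * Y ^ 4 * (n ^ 3 * (1 - Y) * root_core X Y)"
    unfolding S_def T_def root_core_def n r c x by algebra
  finally have "n ^ 3 * (g * (n ^ 2 * c ^ 3 * r ^ 3)) = n ^ 3 * (X ^ 3 * Y ^ 4 * (1 - Y) * root_core X Y)" by algebra
  then have "g * (n ^ 2 * c ^ 3 * r ^ 3) = X ^ 3 * Y ^ 4 * (1 - Y) * root_core X Y" using nz by simp
  then have "2 * y ^ 2 * c ^ 3 * r ^ 3 * g = x * (2 * X ^ 2 * Y ^ 6 * root_core X Y)"
    unfolding yn x by algebra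
  then show "2 * y ^ 2 * c ^ 3 * r ^ 3 * g = x * (root_rational x y + root_radical x y * r)"
    unfolding root_core_split[OF x y] r .
qed

text \<open>Changing the sign of \<open>v\<close> exchanges \<open>b\<close> with \<open>b'\<close>
  and \<open>d\<close> with \<open>d'\<close>, whose products are \<open>(1 - x) ^ 2 - v ^ 2\<close>
  and \<open>\<Delta>\<close>. This is how the denominators of the formula arise.\<close>

lemma kernel_value_sum:
  fixes x v :: "'a::field"
  assumes r: "r ^ 2 = Delta x (v ^ 2)" and u: "u = x / r"
    and g: "2 * (v ^ 2) ^ 2 * (1 - x) ^ 3 * r ^ 3 * g = x * (root_rational x (v ^ 2) + root_radical x (v ^ 2) * r)"
    and nz: "(2 :: 'a) \<noteq> 0" "v \<noteq> 0" "1 - v \<noteq> 0" "1 + v \<noteq> 0" "1 - v - x \<noteq> 0" "1 + v - x \<noteq> 0" "1 - x \<noteq> 0"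
      "(1 - v) ^ 2 - x \<noteq> 0" "(1 + v) ^ 2 - x \<noteq> 0" "1 - x - v ^ 2 \<noteq> 0"
  shows "v ^ 2 * (kernel_value x (v ^ 2) u g v (x / (1 - v)) + kernel_value x (v ^ 2) u g (- v) (x / (1 + v))) / 2 =
    - (2 * x ^ 2 * A2c x (v ^ 2) / ((1 - x) ^ 3 * ((1 - x) ^ 2 - v ^ 2) * r ^ 5)
      + x ^ 2 * B2c x (v ^ 2) / ((1 - x) ^ 5 * ((1 - x) ^ 2 - v ^ 2) ^ 3 * (r ^ 2) ^ 3))"
proof -
  define b b' c d d' q where "b = 1 - v - x" and "b' = 1 + v - x" and "c = 1 - x"
    and "d = (1 - v) ^ 2 - x" and "d' = (1 + v) ^ 2 - x" and "q = (1 - x) ^ 2 - v ^ 2"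
  note defs = this
  have bb: "q = b * b'" and dd: "r ^ 2 = d * d'"
    unfolding r Delta_def defs by algebra+
  have ne: "b \<noteq> 0" "b' \<noteq> 0" "c \<noteq> 0" "d \<noteq> 0" "d' \<noteq> 0" using nz unfolding defs by simp_all
  have rne: "r \<noteq> 0" using dd ne by auto
  have qne: "q \<noteq> 0" using bb ne by auto
  note ne = nz(1,2) ne rne qne
  define h h' w w' R S A B where "h = conj_pair x v" and "h' = conj_pair x (- v)"
    and "w = conj_short x v" and "w' = conj_short x (- v)"
    and "R = root_rational x (v ^ 2)" and "S = root_radical x (v ^ 2)"
    and "A = A2c x (v ^ 2)" and "B = B2c x (v ^ 2)"
  note pdefs = this
  have K: "kernel_value x (v ^ 2) u g v (x / (1 - v)) =
      x ^ 3 * v ^ 5 * h / (c ^ 6 * b ^ 3 * d ^ 3) - 2 * x ^ 2 * v ^ 5 * w * u / (c ^ 3 * b * d ^ 2) - 2 * x * v * g / d"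
    unfolding pdefs by (rule kernel_value_at_conjugate[OF refl b_def c_def d_def]) (use nz ne in simp_all)
  have "kernel_value x ((- v) ^ 2) u g (- v) (x / (1 + v)) =
      x ^ 3 * (- v) ^ 5 * h' / (c ^ 6 * b' ^ 3 * d' ^ 3) - 2 * x ^ 2 * (- v) ^ 5 * w' * u / (c ^ 3 * b' * d' ^ 2)
      - 2 * x * (- v) * g / d'"
    unfolding pdefs by (rule kernel_value_at_conjugate) (use nz ne in \<open>simp_all add: defs\<close>)
  then have K': "kernel_value x (v ^ 2) u g (- v) (x / (1 + v)) =
      - (x ^ 3 * v ^ 5 * h' / (c ^ 6 * b' ^ 3 * d' ^ 3)) + 2 * x ^ 2 * v ^ 5 * w' * u / (c ^ 3 * b' * d' ^ 2)
      + 2 * x * v * g / d'" by simp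
  have pair: "x * v ^ 7 * (h * (b' * d') ^ 3 - h' * (b * d) ^ 3) = 4 * S * r ^ 2 * c ^ 3 * q ^ 3 - 2 * B * c"
    unfolding r pdefs defs by (rule conj_pair_sum)
  have short: "x * v ^ 7 * (w' * b * d ^ 2 - w * b' * d' ^ 2) = 2 * (R * q - A)"
    unfolding pdefs defs by (rule conj_short_sum)
  have dif: "d - d' = - 4 * v" unfolding defs by algebra
  have g': "2 * v ^ 4 * c ^ 3 * r ^ 3 * g = x * (R + S * r)"
    using g unfolding pdefs defs by (simp flip: power_mult)
  have 1: "x ^ 3 * v ^ 5 * h / (c ^ 6 * b ^ 3 * d ^ 3) - x ^ 3 * v ^ 5 * h' / (c ^ 6 * b' ^ 3 * d' ^ 3)
      = x ^ 3 * v ^ 5 * (h * (b' * d') ^ 3 - h' * (b * d) ^ 3) / (c ^ 6 * q ^ 3 * (r ^ 2) ^ 3)"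
    unfolding bb dd using ne by (simp add: divide_simps power_mult_distrib) algebra
  have 2: "2 * x ^ 2 * v ^ 5 * w' * u / (c ^ 3 * b' * d' ^ 2) - 2 * x ^ 2 * v ^ 5 * w * u / (c ^ 3 * b * d ^ 2)
      = 2 * x ^ 2 * v ^ 5 * u * (w' * b * d ^ 2 - w * b' * d' ^ 2) / (c ^ 3 * q * (r ^ 2) ^ 2)"
    unfolding bb dd using ne by (simp add: divide_simps power_mult_distrib) algebra
  have 3: "2 * x * v * g / d' - 2 * x * v * g / d = - (8 * x * v ^ 2 * g / r ^ 2)"
  proof -
    have "2 * x * v * g / d' - 2 * x * v * g / d = 2 * x * v * g * (d - d') / (d * d')"
      using ne by (simp add: divide_simps right_diff_distrib)
    then show ?thesis unfolding dif dd by (simp add: power2_eq_square mult_ac)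
  qed
  have "v ^ 2 * (kernel_value x (v ^ 2) u g v (x / (1 - v)) + kernel_value x (v ^ 2) u g (- v) (x / (1 + v))) / 2
    = v ^ 2 * ((x ^ 3 * v ^ 5 * h / (c ^ 6 * b ^ 3 * d ^ 3) - x ^ 3 * v ^ 5 * h' / (c ^ 6 * b' ^ 3 * d' ^ 3))
      + (2 * x ^ 2 * v ^ 5 * w' * u / (c ^ 3 * b' * d' ^ 2) - 2 * x ^ 2 * v ^ 5 * w * u / (c ^ 3 * b * d ^ 2))
      + (2 * x * v * g / d' - 2 * x * v * g / d)) / 2"
    unfolding K K' by (simp add: algebra_simps)
  also have "\<dots> = (x ^ 2 * (x * v ^ 7 * (h * (b' * d') ^ 3 - h' * (b * d) ^ 3)) / (c ^ 6 * q ^ 3 * (r ^ 2) ^ 3)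
      + 2 * x * u * (x * v ^ 7 * (w' * b * d ^ 2 - w * b' * d' ^ 2)) / (c ^ 3 * q * (r ^ 2) ^ 2)
      - 4 * x * (2 * v ^ 4 * c ^ 3 * r ^ 3 * g) / (c ^ 3 * r ^ 5)) / 2"
  proof -
    have split: "v ^ 2 * (p + q + - t) = v ^ 2 * p + v ^ 2 * q - v ^ 2 * t" for p q t
      by (simp add: algebra_simps)
    have e12: "v ^ 2 * (x ^ 3 * v ^ 5 * a / e) = x ^ 2 * (x * v ^ 7 * a) / e"
      "v ^ 2 * (2 * x ^ 2 * v ^ 5 * u * a / e) = 2 * x * u * (x * v ^ 7 * a) / e" for a e
      by (simp_all add: power2_eq_square power3_eq_cube eval_nat_numeral mult_ac)
    have e3: "v ^ 2 * (8 * x * v ^ 2 * g / r ^ 2) = 4 * x * (2 * v ^ 4 * c ^ 3 * r ^ 3 * g) / (c ^ 3 * r ^ 5)"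
      using ne by (simp add: divide_simps)
    show ?thesis unfolding 1 2 3 split e12 e3 ..
  qed
  \<comment> \<open>The terms \<open>R\<close> and \<open>S\<close> coming from \<open>g\<close>
    cancel those in \<open>short\<close> and \<open>pair\<close>; only \<open>A\<close> and
    \<open>B\<close> remain.\<close>
  also have "\<dots> = - (2 * x ^ 2 * A / (c ^ 3 * q * r ^ 5) + x ^ 2 * B / (c ^ 5 * q ^ 3 * (r ^ 2) ^ 3))"
    unfolding pair short g' u by (simp add: divide_simps ne) algebra
  finally show ?thesis unfolding pdefs defs .
qed

section \<open>Elimination in the functional equations\<close>

lemma kernel_factor:
  fixes s x y X Y i u UF UT G :: "'a::idom"
  assumes i: "i * (1 - s) = 1" and UF: "UF = s * i + y * i ^ 2 * UF"
    and UT: "UT = s * i + y * i * (G + s * i * UF)" and G: "(s - x) * G = s * (UT - u)"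
  shows "((1 - s) * (s - x) - y * s) * ((1 - s) ^ 2 - y) * UT
    = s * ((s - x) * ((1 - s) ^ 2 - y + y * s) - y * u * ((1 - s) ^ 2 - y))"
proof -
  define q where "q = (1 - s) ^ 2 - y"
  have "(1 - s) ^ 2 * UF = s * (i * (1 - s)) * (1 - s) + y * (i * (1 - s)) ^ 2 * UF"
    by (subst UF) (simp add: algebra_simps power2_eq_square)
  then have 1: "q * UF = s * (1 - s)" unfolding i q_def by (simp add: algebra_simps)
  have "(1 - s) * UT = s * (i * (1 - s)) + y * (i * (1 - s)) * (G + s * i * UF)"
    by (subst UT) (simp add: algebra_simps)
  then have "(1 - s) * UT = s + y * (G + s * i * UF)" unfolding i by simp
  then have "(1 - s) * (s - x) * q * UT = (s - x) * q * (s + y * (G + s * i * UF))"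
    by (metis (no_types, lifting) mult.assoc mult.commute)
  also have "\<dots> = (s - x) * q * s + y * q * ((s - x) * G) + y * s * (s - x) * (i * (q * UF))"
    by (simp add: algebra_simps)
  also have "i * (q * UF) = s" unfolding 1 using i by (simp add: mult.left_commute)
  finally have "(1 - s) * (s - x) * q * UT = (s - x) * q * s + y * q * (s * (UT - u)) + y * s * (s - x) * s"
    unfolding G .
  then show ?thesis unfolding q_def[symmetric] by (simp add: algebra_simps)
qed

text \<open>At \<open>s = X\<close> the equation reads \<open>0 = 0\<close> and does not give the
  series there. The remedy is to divide by \<open>s - X\<close> beforehand: the kernel is
  \<open>(s - X) * (1 - Y - s)\<close>, and by \<open>root\<close> the right-hand side is divisible
  as well.\<close>

lemma kernel_cancel:
  fixes s x y X Y u UT q :: "'a::idom"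
  assumes k: "((1 - s) * (s - x) - y * s) * q * UT = s * ((s - x) * (q + y * s) - y * u * q)"
    and q: "q = (1 - s) ^ 2 - y"
    and X: "x = X * (1 - Y)" "Y = X - x + y"
    and root: "(X - x) * ((1 - X) ^ 2 - y + y * X) - y * u * ((1 - X) ^ 2 - y) = 0"
    and m: "m = x + y * u + 2 - y"
    and ne: "s - X \<noteq> 0"
  shows "(1 - Y - s) * q * UT
    = s * (s ^ 2 + (X - m) * s + ((1 - y) + x * (2 - y) + 2 * y * u - m * X + X ^ 2))"
proof -
  have kappa: "(1 - s) * (s - x) - y * s = (s - X) * (1 - Y - s)"
  proof -
    have "(s - X) * (1 - Y - s) - ((1 - s) * (s - x) - y * s) = x - X * (1 - Y) + s * (X - x + y - Y)"
      by (simp add: algebra_simps)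
    moreover have "x - X * (1 - Y) = 0" using X(1) by simp
    moreover have "X - x + y - Y = 0" using X(2) by simp
    ultimately show ?thesis by simp
  qed
  \<comment> \<open>Synthetic division of a monic cubic in \<open>s\<close> by \<open>s - X\<close>;
    \<open>- m\<close> is the coefficient of \<open>s ^ 2\<close> in the cubic.\<close>
  define M where "M = s ^ 2 + (X - m) * s + ((1 - y) + x * (2 - y) + 2 * y * u - m * X + X ^ 2)"
  have "(s - x) * (q + y * s) - y * u * q =
      (s - X) * M + ((X - x) * ((1 - X) ^ 2 - y + y * X) - y * u * ((1 - X) ^ 2 - y))"
    unfolding q m M_def by algebra
  then have "(s - x) * (q + y * s) - y * u * q = (s - X) * M" unfolding root by simp
  then have "(s - X) * ((1 - Y - s) * q * UT) = s * ((s - X) * M)"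
    using k unfolding kappa by (simp only: mult.assoc)
  also have "\<dots> = (s - X) * (s * M)" by (rule mult.left_commute)
  finally show ?thesis using ne unfolding M_def by simp
qed

text \<open>With no widening side each recursive series satisfies a linear equation in itself and is
  found by \<open>solve\<close>. With one widening side the difference quotient survives:
  \<open>U1T\<close> is explicit, but \<open>TT\<close> is left in terms of \<open>UT\<close>, and
  \<open>ST\<close> in terms of the quotient \<open>g1\<close>.\<close>

lemma point_values:
  fixes a i x y c UF UT gU U1F U1T g1 SF ST TF TT CFF GFF :: "'a::field"
  assumes i: "i * (1 - a) = 1" and c: "c * (1 - x) = 1" and q: "(1 - a) ^ 2 - y \<noteq> 0"
    and UF: "UF = a * i + y * i ^ 2 * UF" and UT: "UT = a * i + y * i * (gU + a * i * UF)"
    and U1F: "U1F = y * i ^ 2 * (a * i)" and U1T: "U1T = y * i * (c * (a * i) + (a * i) ^ 2)"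
    and SF: "SF = y * i * U1F" and ST: "ST = y * (g1 + a * i * U1F)"
    and TF: "TF = y * i * (UF - a * i)" and TT: "TT = y * (gU - c * (a * i) + a * i * (UF - a * i))"
    and CFF: "CFF = a * i * (SF * TF + TF * SF - SF * SF)" and GFF: "GFF = CFF + y * i ^ 2 * GFF"
  shows "UF = a * (1 - a) / ((1 - a) ^ 2 - y)" "SF = short_F y a" "TF = tall_F y a"
    "GFF = complete_F y a" "U1T = rows_T x y a" "TT = tall_T x y UT a"
    "ST = y * (g1 + y * a ^ 2 / (1 - a) ^ 4)"
proof -
  have ne: "1 - a \<noteq> 0" "1 - x \<noteq> 0" using i c by auto
  then have i': "i = 1 / (1 - a)" and c': "c = 1 / (1 - x)" using i c by (simp_all add: field_simps)
  define n k where "n = 1 - a" and "k = n ^ 2 - y"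
  have ne': "n \<noteq> 0" "k \<noteq> 0" "1 - x \<noteq> 0" using ne q by (simp_all add: n_def k_def)
  have solve: "Z = W * (1 - a) ^ 2 / ((1 - a) ^ 2 - y)" if "Z = W + y * i ^ 2 * Z" for Z W
  proof -
    have "((1 - a) ^ 2 - y) * Z = W * (1 - a) ^ 2"
      using that ne unfolding i' by (simp add: field_simps)
    then show ?thesis using q by (simp add: field_simps)
  qed
  show UF': "UF = a * (1 - a) / ((1 - a) ^ 2 - y)"
    using solve[OF UF] ne unfolding i' by (simp add: power2_eq_square)
  show SF': "SF = short_F y a"
    unfolding SF U1F i' short_F_def using ne by (simp add: field_simps power2_eq_square power4_eq_xxxx)
  show TF': "TF = tall_F y a"
    unfolding TF UF' i' tall_F_def n_def[symmetric] k_def[symmetric]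
    by (simp add: divide_simps ne', unfold k_def, algebra)
  show "GFF = complete_F y a"
    unfolding solve[OF GFF] CFF SF' TF' i' complete_F_def n_def[symmetric] k_def[symmetric]
    by (simp add: divide_simps ne', algebra)
  show "U1T = rows_T x y a"
    unfolding U1T i' c' rows_T_def n_def[symmetric] using ne' by (simp add: divide_simps, algebra)
  show "ST = y * (g1 + y * a ^ 2 / (1 - a) ^ 4)"
    unfolding ST U1F i' n_def[symmetric] using ne' by (simp add: divide_simps, algebra)
  have "(1 - a) * UT = a * (i * (1 - a)) + y * (i * (1 - a)) * (gU + a * i * UF)"
    by (subst UT) (simp add: algebra_simps)
  then have "y * gU = (1 - a) * UT - a - y * a * i * UF" unfolding i by (simp add: algebra_simps)
  then show "TT = tall_T x y UT a"
    unfolding TT tall_T_def distrib_left right_diff_distrib i' c' UF' n_def[symmetric] k_def[symmetric]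
    by (simp add: divide_simps ne', algebra)
qed

section \<open>Functional equations and their solution\<close>

lemma list_gf_only_empty:
  assumes "\<And>k. Q k \<longleftrightarrow> k = 0"
  shows "list_gf Q = (\<lambda>_ _ _. 1)"
  by (intro ext fps_ext) (auto simp: list_gf_def assms num_lists_0)

text \<open>A tower with at least two rows carries a nonempty list on its first row.\<close>

lemma list_gf_nonempty: "list_gf (\<lambda>k. 2 \<le> Suc k) X Y n = list_gf (\<lambda>_. True) X Y n - 1"
  using list_gf_rec[of "\<lambda>k. 2 \<le> Suc k" X Y n] list_gf_rec[of "\<lambda>_. True" X Y n] by simp

lemma grow_diff: "grow (\<lambda>n. f n - g n) n = grow f n - (grow g n :: 'a::comm_ring_1 fps)"
  by (rule fps_ext) (simp add: grow_def sum_subtractf)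

lemma grow_one: "grow (\<lambda>_. 1) n = (geom :: rat fps fps)"
proof (rule fps_ext)
  fix w
  have "(\<Sum>d\<le>w. fps_nth (1 :: rat fps fps) (w - d)) = (\<Sum>d\<in>{w}. 1)"
    by (rule sum.mono_neutral_cong_right) auto
  then show "fps_nth (grow (\<lambda>_. 1 :: rat fps fps) n) w = fps_nth geom w"
    by (simp add: grow_def geom_def)
qed

lemma series_step_False: "series (step X False F) = geom * series (half_step X F)"
  unfolding step_False[abs_def] by (rule series_sums)

lemma series_half_step_False: "series (half_step False F) = geom * series (F False False)"
  unfolding half_step_def[abs_def] by (simp add: series_sums flip: One_nat_def)

lemma series_half_step_True:
  "series (half_step True F) = series (grow (F True False)) + fps_X * geom * series (F False False)"
  unfolding half_step_def[abs_def] by (simp add: series_add series_sums' flip: One_nat_def)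

lemma series_step_True:
  "series (step True True F) = series (grow (grow (F True True)))
    + fps_X * geom * (series (grow (F True False)) + series (grow (F False True)))
    + (fps_X * geom) ^ 2 * series (F False False)"
proof -
  have "series (step True True F) = series (\<lambda>n. grow (grow (F True True)) n
      + (\<Sum>a\<in>{1..<n}. grow (F True False) a) + (\<Sum>a\<in>{1..<n}. grow (F False True) a)
      + (\<Sum>a\<in>{1..<n}. \<Sum>j\<in>{1..<a}. F False False j))"
    by (rule series_cong) (rule step_True)
  also have "\<dots> = series (grow (grow (F True True)))
    + fps_X * geom * (series (grow (F True False)) + series (grow (F False True)))
    + (fps_X * geom) ^ 2 * series (F False False)"
    unfolding series_add series_sums' by (simp add: algebra_simps power2_eq_square)
  finally show ?thesis .
qed

lemma series_list_gf:
  "series (list_gf Q X Y) = (if Q 0 then fps_X * geom else 0)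
    + fps_const var_y * series (step X Y (list_gf (\<lambda>k. Q (Suc k))))"
proof -
  have "series (list_gf Q X Y)
      = series (\<lambda>n. (if Q 0 then 1 else 0) + var_y * step X Y (list_gf (\<lambda>k. Q (Suc k))) n)"
    by (rule series_cong) (rule list_gf_rec)
  also have "\<dots> = series (\<lambda>n. if Q 0 then 1 else 0)
      + fps_const var_y * series (step X Y (list_gf (\<lambda>k. Q (Suc k))))"
    by (simp only: series_add series_cmult)
  also have "series (\<lambda>n. if Q 0 then 1 else (0 :: rat fps fps)) = (if Q 0 then fps_X * geom else 0)"
  proof (cases "Q 0")
    case False
    then show ?thesis by (intro fps_ext) (simp add: series_def)
  qed (simp add: series_one)
  finally show ?thesis .
qed

lemma series_tower_gf:
  assumes "\<not> Q 0"
  shows "series (tower_gf Q X) = fps_const var_y * series (half_step X (list_gf (\<lambda>k. Q (Suc k))))"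
  unfolding series_cmult[symmetric] by (rule series_cong) (rule tower_gf_half_step[of Q, OF assms])

section \<open>The unknown series and their equations\<close>

definition list_series :: "bool \<Rightarrow> rat fps fps fps" where
  "list_series X = series (list_gf (\<lambda>_. True) X False)"

text \<open>The length condition has the form \<open>Suc k = 2\<close> because this single row
  stands on the first row of a short tower.\<close>

definition row_series :: "bool \<Rightarrow> rat fps fps fps" where
  "row_series X = series (list_gf (\<lambda>k. Suc k = 2) X False)"

definition short_series :: "bool \<Rightarrow> rat fps fps fps" where
  "short_series X = series (tower_gf (\<lambda>k. k = 2) X)"

definition tall_series :: "bool \<Rightarrow> rat fps fps fps" where
  "tall_series X = series (tower_gf (\<lambda>k. 2 \<le> k) X)"

definition pair_series :: "bool \<Rightarrow> bool \<Rightarrow> rat fps fps fps" where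
  "pair_series X Y = fps_X * geom * (short_series X * tall_series Y + tall_series X * short_series Y
     - short_series X * short_series Y)"

definition completion_series :: "bool \<Rightarrow> bool \<Rightarrow> rat fps fps fps" where
  "completion_series X Y = series (completion_gf 2 X Y)"

definition grow_list :: "rat fps fps fps" where
  "grow_list = series (grow (list_gf (\<lambda>_. True) True False))"

definition grow_row :: "rat fps fps fps" where
  "grow_row = series (grow (list_gf (\<lambda>k. Suc k = 2) True False))"

definition grow_completion :: "rat fps fps fps" where
  "grow_completion = series (grow (completion_gf 2 True False))"

definition grow_full :: "rat fps fps fps" where
  "grow_full = series (grow (completion_gf 2 True True))"

definition grow_grow_full :: "rat fps fps fps" where
  "grow_grow_full = series (grow (grow (completion_gf 2 True True)))"

lemma list_series_eqs:
  "list_series False = fps_X * geom + fps_const var_y * geom ^ 2 * list_series False"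
  "list_series True = fps_X * geom
    + fps_const var_y * geom * (grow_list + fps_X * geom * list_series False)"
  "(fps_X - fps_const var_x) * grow_list
    = fps_X * (list_series True - fps_const (sum_at_x (list_gf (\<lambda>_. True) True False)))"
proof -
  show "list_series False = fps_X * geom + fps_const var_y * geom ^ 2 * list_series False"
    using series_list_gf[of "\<lambda>_. True" False False]
    unfolding list_series_def series_step_False series_half_step_False
    by (simp add: power2_eq_square mult.assoc)
  show "list_series True = fps_X * geom
    + fps_const var_y * geom * (grow_list + fps_X * geom * list_series False)"
    using series_list_gf[of "\<lambda>_. True" True False]
    unfolding list_series_def grow_list_def series_step_False series_half_step_True
    by (simp add: mult.assoc)
  show "(fps_X - fps_const var_x) * grow_list
    = fps_X * (list_series True - fps_const (sum_at_x (list_gf (\<lambda>_. True) True False)))"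
    unfolding grow_list_def list_series_def by (rule series_grow)
qed

lemma row_series_eqs:
  "row_series False = fps_const var_y * geom ^ 2 * (fps_X * geom)"
  "row_series True = fps_const var_y * geom * (fps_const geom * (fps_X * geom) + (fps_X * geom) ^ 2)"
  "(fps_X - fps_const var_x) * grow_row
    = fps_X * (row_series True - fps_const (sum_at_x (list_gf (\<lambda>k. Suc k = 2) True False)))"
proof -
  have one: "list_gf (\<lambda>k. Suc (Suc k) = 2) = (\<lambda>_ _ _. 1)" by (rule list_gf_only_empty) simp
  have const: "series (\<lambda>n. geom :: rat fps fps) = fps_const geom * (fps_X * geom)"
    using series_cmult[of geom "\<lambda>_. 1"] by (simp add: series_one)
  show "row_series False = fps_const var_y * geom ^ 2 * (fps_X * geom)"
    using series_list_gf[of "\<lambda>k. Suc k = 2" False False]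
    unfolding row_series_def series_step_False series_half_step_False one series_one
    by (simp add: power2_eq_square mult.assoc)
  show "row_series True = fps_const var_y * geom * (fps_const geom * (fps_X * geom) + (fps_X * geom) ^ 2)"
    using series_list_gf[of "\<lambda>k. Suc k = 2" True False]
    unfolding row_series_def series_step_False series_half_step_True one series_one grow_one[abs_def] const
    by (simp add: power2_eq_square mult.assoc)
  show "(fps_X - fps_const var_x) * grow_row
    = fps_X * (row_series True - fps_const (sum_at_x (list_gf (\<lambda>k. Suc k = 2) True False)))"
    unfolding grow_row_def row_series_def by (rule series_grow)
qed

lemma tower_series_eqs:
  "short_series False = fps_const var_y * geom * row_series False"
  "short_series True = fps_const var_y * (grow_row + fps_X * geom * row_series False)"
  "tall_series False = fps_const var_y * geom * (list_series False - fps_X * geom)"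
  "tall_series True = fps_const var_y * (grow_list - fps_const geom * (fps_X * geom)
    + fps_X * geom * (list_series False - fps_X * geom))"
proof -
  show "short_series False = fps_const var_y * geom * row_series False"
    using series_tower_gf[of "\<lambda>k. k = 2" False]
    unfolding short_series_def row_series_def series_half_step_False by (simp add: mult.assoc)
  show "short_series True = fps_const var_y * (grow_row + fps_X * geom * row_series False)"
    using series_tower_gf[of "\<lambda>k. k = 2" True]
    unfolding short_series_def row_series_def grow_row_def series_half_step_True by simp
  have eq: "list_gf (\<lambda>k. 2 \<le> Suc k) X Y = (\<lambda>n. list_gf (\<lambda>_. True) X Y n - 1)" for X Y
    by (rule ext) (rule list_gf_nonempty)
  have const: "series (\<lambda>n. geom :: rat fps fps) = fps_const geom * (fps_X * geom)"
    using series_cmult[of geom "\<lambda>_. 1"] by (simp add: series_one)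
  show "tall_series False = fps_const var_y * geom * (list_series False - fps_X * geom)"
    using series_tower_gf[of "\<lambda>k. 2 \<le> k" False]
    unfolding tall_series_def list_series_def series_half_step_False eq series_diff series_one
    by (simp add: mult.assoc)
  show "tall_series True = fps_const var_y * (grow_list - fps_const geom * (fps_X * geom)
    + fps_X * geom * (list_series False - fps_X * geom))"
    using series_tower_gf[of "\<lambda>k. 2 \<le> k" True]
    unfolding tall_series_def list_series_def grow_list_def series_half_step_True eq series_diff
      series_one grow_diff[abs_def] grow_one[abs_def] const by simp
qed

lemma series_towers_above: "series (towers_above_gf 2 X Y) = pair_series X Y"
proof -
  have "series (towers_above_gf 2 X Y) = series (\<lambda>n. \<Sum>a\<in>{1..<n}. \<Sum>b\<in>{1..<n - a}.
      tower_gf (\<lambda>k. k = 2) X a * tower_gf (\<lambda>k. 2 \<le> k) Y b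
      + tower_gf (\<lambda>k. 2 \<le> k) X a * tower_gf (\<lambda>k. k = 2) Y b
      - tower_gf (\<lambda>k. k = 2) X a * tower_gf (\<lambda>k. k = 2) Y b)"
    by (rule series_cong) (rule towers_above_gf_product, simp)
  also have "\<dots> = pair_series X Y"
    unfolding sum.distrib sum_subtractf series_add series_diff series_convolution pair_series_def
      short_series_def tall_series_def by (simp add: algebra_simps)
  finally show ?thesis .
qed

text \<open>With two widening sides the difference quotient is iterated, so besides the wanted value
  at \<open>s = x\<close> the corresponding value for \<open>grow\<close> is unknown. Mirror
  symmetry merges the two mixed cases into the factor 2.\<close>

lemma completion_series_eqs:
  "completion_series False False
    = pair_series False False + fps_const var_y * geom ^ 2 * completion_series False False"
  "completion_series True False = pair_series True False
    + fps_const var_y * geom * (grow_completion + fps_X * geom * completion_series False False)"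
  "(fps_X - fps_const var_x) * grow_completion
    = fps_X * (completion_series True False - fps_const (sum_at_x (completion_gf 2 True False)))"
  "completion_series True True = pair_series True True + fps_const var_y * (grow_grow_full
    + 2 * (fps_X * geom) * grow_completion + (fps_X * geom) ^ 2 * completion_series False False)"
  "(fps_X - fps_const var_x) * grow_full
    = fps_X * (completion_series True True - fps_const (sum_at_x (completion_gf 2 True True)))"
  "(fps_X - fps_const var_x) * grow_grow_full
    = fps_X * (grow_full - fps_const (sum_at_x (grow (completion_gf 2 True True))))"
proof -
  have rec: "completion_series X Y = pair_series X Y + fps_const var_y * series (step X Y (completion_gf 2))"
    for X Y
    unfolding completion_series_def series_towers_above[symmetric] series_cmult[symmetric] series_add[symmetric]
    by (rule series_cong) (rule completion_gf_rec)
  show "completion_series False False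
    = pair_series False False + fps_const var_y * geom ^ 2 * completion_series False False"
    using rec[of False False] unfolding series_step_False series_half_step_False
    by (simp add: completion_series_def power2_eq_square mult.assoc)
  show "completion_series True False = pair_series True False
    + fps_const var_y * geom * (grow_completion + fps_X * geom * completion_series False False)"
    using rec[of True False] unfolding series_step_False series_half_step_True
    by (simp add: completion_series_def grow_completion_def mult.assoc)
  show "completion_series True True = pair_series True True + fps_const var_y * (grow_grow_full
    + 2 * (fps_X * geom) * grow_completion + (fps_X * geom) ^ 2 * completion_series False False)"
    using rec[of True True] unfolding series_step_True completion_gf_mirror[of 2 False True]
    by (simp add: completion_series_def grow_completion_def grow_grow_full_def algebra_simps)
qed (unfold grow_completion_def grow_full_def grow_grow_full_def completion_series_def, (rule series_grow)+)

section \<open>Passage to a field containing the square root of \<open>y\<close>\<close>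

lemma is_ring_hom_to_fract: "is_ring_hom (to_fract :: 'a::idom \<Rightarrow> 'a fract)"
  by (simp add: is_ring_hom_def)

text \<open>In the fraction field non-units such as \<open>x\<close> and \<open>v\<close> can be
  cancelled. The map is injective (\<open>to_field_inj\<close>), so an identity proved in the field
  holds for the series.\<close>

definition to_field :: "rat fps fps \<Rightarrow> rat fps fps fract" where
  "to_field F = to_fract (fps_map square_y F)"

definition field_eval :: "rat fps fps \<Rightarrow> rat fps fps fps \<Rightarrow> rat fps fps fract" where
  "field_eval a F = to_fract (fps_eval a (fps_map (fps_map square_y) F))"

lemma is_ring_hom_to_field: "is_ring_hom to_field"
  unfolding to_field_def[abs_def]
  by (rule is_ring_hom_comp[OF is_ring_hom_to_fract is_ring_hom_fps_map[OF is_ring_hom_square_y]])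

lemma is_ring_hom_field_eval: "fps_nth a 0 = 0 \<Longrightarrow> is_ring_hom (field_eval a)"
  unfolding field_eval_def[abs_def]
  by (intro is_ring_hom_comp[OF is_ring_hom_to_fract]
      is_ring_hom_comp[OF is_ring_hom_fps_eval is_ring_hom_fps_map] is_ring_hom_fps_map is_ring_hom_square_y)

lemma field_eval_const: "field_eval a (fps_const c) = to_field c"
  by (simp add: field_eval_def to_field_def fps_map_const is_ring_hom_fps_map is_ring_hom_square_y
      fps_eval_const)

lemma field_eval_X: "fps_nth a 0 = 0 \<Longrightarrow> field_eval a fps_X = to_fract a"
  by (simp add: field_eval_def fps_map_X is_ring_hom_fps_map is_ring_hom_square_y fps_eval_X)

lemma field_eval_series: "field_eval var_x (series f) = to_field (sum_at_x f)"
proof -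
  have "fps_map square_y var_x = var_x"
    by (simp add: var_x_def fps_map_X is_ring_hom_square_y)
  then have "fps_eval var_x (fps_map (fps_map square_y) (series f))
      = fps_map square_y (fps_eval var_x (series f))"
    using fps_map_eval[OF is_ring_hom_square_y, of var_x "series f"] by simp
  then show ?thesis by (simp add: field_eval_def to_field_def fps_eval_series)
qed

lemma to_field_inj: "to_field f = to_field g \<Longrightarrow> f = g"
  unfolding to_field_def by (simp add: fps_map_square_y_inj)

lemma to_fract_nonzero: "fps_nth (fps_nth f 0) 0 \<noteq> 0 \<Longrightarrow> to_fract f \<noteq> (0 :: rat fps fps fract)"
  by auto

text \<open>Because \<open>A - x = v * A\<close>, every difference quotient is a difference divided
  by \<open>v\<close>. Two of them turn \<open>y * gg\<close> into \<open>GTT - G - v * d\<close>,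
  and \<open>GTT\<close> drops out of its own equation: this is the vanishing of the kernel.\<close>

lemma kernel_value_eq:
  fixes A i x y v u g G d UT UF gU P Q S T GFF GTF gG GTT gF gg :: "'a::field"
  assumes i: "i * (1 - A) = 1" and y: "y = v ^ 2" and A: "A - x = v * A"
    and ne: "A \<noteq> 0" "v \<noteq> 0" "(1 - A) ^ 2 - y \<noteq> 0" "1 - A - v \<noteq> 0"
    and UF: "UF = A * i + y * i ^ 2 * UF"
    and UT: "UT = A * i + y * i * (gU + A * i * UF)" "(A - x) * gU = A * (UT - u)"
    and S: "S = short_T x y v A" and T: "T = tall_T x y UT A"
    and P: "P = pair_TF y S T A" and Q: "Q = pair_TT S T A" and GFF: "GFF = complete_F y A"
    and GTF: "GTF = P + y * i * (gG + A * i * GFF)" "(A - x) * gG = A * (GTF - g)"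
    and GTT: "GTT = Q + y * (gg + 2 * (A * i) * gG + (A * i) ^ 2 * GFF)"
      "(A - x) * gF = A * (GTT - G)" "(A - x) * gg = A * (gF - d)"
  shows "G + v * d = kernel_value x y u g v A"
proof -
  have ne1: "1 - A \<noteq> 0" using i by auto
  have i': "i = 1 / (1 - A)" using i ne1 by (simp add: field_simps)
  define q where "q = (1 - A) ^ 2 - y"
  have "((1 - A) * (v * A) - v ^ 2 * A) * q * UT = A * (v * A * (q + y * A) - v ^ 2 * u * q)"
    using kernel_factor[OF i UF UT] unfolding A q_def y by (simp add: mult.commute)
  then have "(v * A) * ((1 - A - v) * q * UT) = (v * A) * (A * (q + y * A) - v * u * q)"
    by (simp add: algebra_simps power2_eq_square)
  then have "(1 - A - v) * q * UT = A * (q + y * A) - v * u * q" using ne by simp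
  then have UT': "UT = lists_at u v y A"
    using ne unfolding lists_at_def q_def[symmetric]
    by (subst nonzero_eq_divide_eq) (simp_all add: mult_ac)
  have "A * (v * gG) = A * (GTF - g)" "A * (v * gF) = A * (GTT - G)" "A * (v * gg) = A * (gF - d)"
    using GTF(2) GTT(2,3) unfolding A by (simp_all add: mult_ac)
  then have vg: "v * gG = GTF - g" "v * gF = GTT - G" "v * gg = gF - d" using ne(1) by simp_all
  have "(1 - A) * GTF = (1 - A) * P + y * (i * (1 - A)) * (gG + A * i * GFF)"
    by (subst GTF(1)) (simp add: algebra_simps)
  then have 1: "(1 - A) * GTF = (1 - A) * P + y * gG + y * (A * i * GFF)" unfolding i by (simp add: algebra_simps)
  have "y * gG = v * (GTF - g)" unfolding y vg(1)[symmetric] by (simp add: power2_eq_square)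
  then have "(1 - A) * GTF = (1 - A) * P + v * (GTF - g) + y * (A * i * GFF)" using 1 by simp
  then have "(1 - A - v) * GTF = (1 - A) * P + y * A / (1 - A) * GFF - v * g"
    unfolding i' by (simp add: algebra_simps)
  then have GTF': "GTF = ((1 - A) * P + y * A / (1 - A) * GFF - v * g) / (1 - A - v)"
    using ne(4) by (simp add: field_simps)
  have "y * gg = v * (gF - d)" unfolding y vg(3)[symmetric] by (simp add: power2_eq_square)
  then have "y * gg = GTT - G - v * d" using vg(2) by (simp add: algebra_simps)
  then have "G + v * d = Q + 2 * (A * i) * (y * gG) + y * (A * i) ^ 2 * GFF"
    using GTT(1) by (simp add: algebra_simps)
  also have "y * gG = (1 - A) * (GTF - P) - y * (A * i * GFF)" using 1 by (simp add: algebra_simps)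
  also have "Q + 2 * (A * i) * ((1 - A) * (GTF - P) - y * (A * i * GFF)) + y * (A * i) ^ 2 * GFF
      = Q + 2 * A * (GTF - P) - y * A ^ 2 / (1 - A) ^ 2 * GFF"
    unfolding i' using ne1 by (simp add: divide_simps) algebra
  finally show ?thesis
    unfolding kernel_value_def Let_def UT'[symmetric] S[symmetric] T[symmetric] P[symmetric]
      Q[symmetric] GFF[symmetric] GTF'[symmetric] .
qed

definition vK :: "rat fps fps" where "vK = fps_const fps_X"

lemma to_field_var: "to_field var_x = to_fract var_x" "to_field var_y = to_fract vK ^ 2"
proof -
  have "fps_map square_y var_x = var_x" by (simp add: var_x_def fps_map_X is_ring_hom_square_y)
  then show "to_field var_x = to_fract var_x" by (simp add: to_field_def)
  have "fps_map square_y var_y = vK ^ 2"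
    by (simp add: var_y_def vK_def fps_map_const is_ring_hom_square_y square_y_def flip: fps_const_power)
  then show "to_field var_y = to_fract vK ^ 2"
    by (simp add: to_field_def is_ring_homD[OF is_ring_hom_to_fract])
qed

abbreviation "xL \<equiv> to_fract var_x"
abbreviation "vL \<equiv> to_fract vK"
abbreviation "yL \<equiv> to_fract vK ^ 2"
abbreviation "uL \<equiv> to_field (sum_at_x (list_gf (\<lambda>_. True) True False))"
abbreviation "gL \<equiv> to_field (sum_at_x (completion_gf 2 True False))"

lemma field_eval_equations:
  assumes a: "fps_nth a 0 = 0"
  defines "A \<equiv> to_fract a" and "h \<equiv> field_eval a"
  defines "i \<equiv> h geom"
  shows "i * (1 - A) = 1" "(1 - A) ^ 2 - yL \<noteq> 0"
    "h (list_series False) = A * i + yL * i ^ 2 * h (list_series False)"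
    "h (list_series True) = A * i + yL * i * (h grow_list + A * i * h (list_series False))"
    "(A - xL) * h grow_list = A * (h (list_series True) - uL)"
    "h (list_series False) = A * (1 - A) / ((1 - A) ^ 2 - yL)"
    "h (row_series True) = rows_T xL yL A"
    "(A - xL) * h grow_row = A * (h (row_series True) - to_field (sum_at_x (list_gf (\<lambda>k. Suc k = 2) True False)))"
    "h (short_series True) = yL * (h grow_row + yL * A ^ 2 / (1 - A) ^ 4)"
    "h (tall_series True) = tall_T xL yL (h (list_series True)) A"
    "h (pair_series True False) = pair_TF yL (h (short_series True)) (h (tall_series True)) A"
    "h (pair_series True True) = pair_TT (h (short_series True)) (h (tall_series True)) A"
    "h (completion_series False False) = complete_F yL A"
    "h (completion_series True False) = h (pair_series True False)
      + yL * i * (h grow_completion + A * i * h (completion_series False False))"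
    "(A - xL) * h grow_completion = A * (h (completion_series True False) - gL)"
    "h (completion_series True True) = h (pair_series True True) + yL * (h grow_grow_full
      + 2 * (A * i) * h grow_completion + (A * i) ^ 2 * h (completion_series False False))"
    "(A - xL) * h grow_full
      = A * (h (completion_series True True) - to_field (sum_at_x (completion_gf 2 True True)))"
    "(A - xL) * h grow_grow_full
      = A * (h grow_full - to_field (sum_at_x (grow (completion_gf 2 True True))))"
proof -
  note hom = is_ring_homD[OF is_ring_hom_field_eval[OF a], folded h_def]
  have X: "h fps_X = A" unfolding h_def A_def by (rule field_eval_X[OF a])
  have C: "h (fps_const c) = to_field c" for c unfolding h_def by (rule field_eval_const)
  note tr = hom X C to_field_var i_def[symmetric]
  have i: "i * (1 - A) = 1"
    using arg_cong[OF geom_inverse, of h] by (simp add: tr)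
  have ne1: "1 - A \<noteq> 0" using i by auto
  have i': "i = 1 / (1 - A)" using i ne1 by (simp add: field_simps)
  have "fps_nth (fps_nth ((1 - a) ^ 2 - vK ^ 2) 0) 0 \<noteq> 0"
    by (simp add: a vK_def fps_nth_power_0)
  then have "to_fract ((1 - a) ^ 2 - vK ^ 2) \<noteq> 0" by (rule to_fract_nonzero)
  then have q: "(1 - A) ^ 2 - yL \<noteq> 0"
    by (simp only: is_ring_homD[OF is_ring_hom_to_fract] A_def not_False_eq_True)
  note hg = is_ring_homD[OF is_ring_hom_to_field]
  have c: "to_field geom * (1 - xL) = 1"
  proof -
    have "geom * (1 - var_x) = 1" unfolding var_x_def by (rule geom_inverse)
    from arg_cong[OF this, of to_field] show ?thesis by (simp add: hg to_field_var)
  qed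
  note E = list_series_eqs[THEN arg_cong, of h] row_series_eqs[THEN arg_cong, of h]
    tower_series_eqs[THEN arg_cong, of h] completion_series_eqs[THEN arg_cong, of h]
    pair_series_def[of False False, THEN arg_cong, of h]
  note E' = E[unfolded tr]
  note PV = point_values[OF i c q E'(1,2,4,5,7,8,9,10) E'(17) E'(11)]
  show "i * (1 - A) = 1" "(1 - A) ^ 2 - yL \<noteq> 0" by (fact i q)+
  show "h (list_series False) = A * i + yL * i ^ 2 * h (list_series False)"
    "h (list_series True) = A * i + yL * i * (h grow_list + A * i * h (list_series False))"
    "(A - xL) * h grow_list = A * (h (list_series True) - uL)"
    by (fact E')+
  show "(A - xL) * h grow_row = A * (h (row_series True) - to_field (sum_at_x (list_gf (\<lambda>k. Suc k = 2) True False)))"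
    by (fact E')
  show "h (completion_series True False) = h (pair_series True False)
      + yL * i * (h grow_completion + A * i * h (completion_series False False))"
    "(A - xL) * h grow_completion = A * (h (completion_series True False) - gL)"
    "h (completion_series True True) = h (pair_series True True) + yL * (h grow_grow_full
      + 2 * (A * i) * h grow_completion + (A * i) ^ 2 * h (completion_series False False))"
    "(A - xL) * h grow_full
      = A * (h (completion_series True True) - to_field (sum_at_x (completion_gf 2 True True)))"
    "(A - xL) * h grow_grow_full
      = A * (h grow_full - to_field (sum_at_x (grow (completion_gf 2 True True))))"
    by (fact E')+
  show "h (list_series False) = A * (1 - A) / ((1 - A) ^ 2 - yL)"
    "h (row_series True) = rows_T xL yL A"
    "h (short_series True) = yL * (h grow_row + yL * A ^ 2 / (1 - A) ^ 4)"
    "h (tall_series True) = tall_T xL yL (h (list_series True)) A"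
    "h (completion_series False False) = complete_F yL A"
    by (fact PV)+
  have sF: "h (short_series False) = short_F yL A" and tF: "h (tall_series False) = tall_F yL A"
    by (fact PV)+
  show "h (pair_series True False) = pair_TF yL (h (short_series True)) (h (tall_series True)) A"
    unfolding pair_series_def pair_TF_def by (simp add: tr sF tF i')
  show "h (pair_series True True) = pair_TT (h (short_series True)) (h (tall_series True)) A"
    unfolding pair_series_def pair_TT_def by (simp add: tr i' power2_eq_square)
qed

text \<open>The series of single rows is explicit, so its value at \<open>s = x\<close> is found by
  evaluating there, without a kernel.\<close>

lemma short_series_at:
  assumes a: "fps_nth a 0 = 0" and d: "to_fract a - xL = d * to_fract a" "d \<noteq> 0" "a \<noteq> 0"
  shows "field_eval a (short_series True) = short_T xL yL d (to_fract a)"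
proof -
  have x0: "fps_nth var_x 0 = 0" by (simp add: var_x_def)
  have mu: "to_field (sum_at_x (list_gf (\<lambda>k. Suc k = 2) True False)) = rows_T xL yL xL"
    using field_eval_equations(7)[OF x0] unfolding row_series_def field_eval_series .
  note E = field_eval_equations[OF a]
  have "to_fract a * (d * field_eval a grow_row) = to_fract a * (rows_T xL yL (to_fract a) - rows_T xL yL xL)"
    using E(8) unfolding E(7) mu d(1) by (simp add: mult_ac)
  then have "d * field_eval a grow_row = rows_T xL yL (to_fract a) - rows_T xL yL xL"
    using d(3) by simp
  then have "field_eval a grow_row = (rows_T xL yL (to_fract a) - rows_T xL yL xL) / d"
    using d(2) by (simp add: field_simps)
  then show ?thesis unfolding E(9) short_T_def by simp
qed

lemma kernel_value_at:
  assumes a: "fps_nth a 0 = 0" and A: "to_fract a - xL = w * to_fract a" and w: "w ^ 2 = yL" "w \<noteq> 0"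
    and ne: "a \<noteq> 0" "1 - to_fract a - w \<noteq> 0"
  shows "to_field (sum_at_x (completion_gf 2 True True))
      + w * to_field (sum_at_x (grow (completion_gf 2 True True)))
    = kernel_value xL yL uL gL w (to_fract a)"
proof -
  note E = field_eval_equations[OF a]
  show ?thesis
    by (rule kernel_value_eq[OF E(1) w(1)[symmetric] A _ w(2) E(2) ne(2) E(3,4,5)
          short_series_at[OF a A w(2) ne(1)] E(10,11,12,13,14,15,16,17,18)])
      (use ne(1) in simp)
qed

section \<open>The root of the kernel for one widening side\<close>

definition rootK :: "rat fps fps" where
  "rootK = fps_const (fps_const (1 / 2)) * (1 + var_x - var_y - sqrt_series (Delta var_x var_y))"

lemma rootK_sqrt: "sqrt_series (Delta var_x var_y) = 1 + var_x - var_y - 2 * rootK"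
proof -
  have "2 * fps_const (fps_const (1 / 2 :: rat)) = (1 :: rat fps fps)"
    by (simp add: fps_numeral_fps_const)
  then have "2 * rootK = 1 + var_x - var_y - sqrt_series (Delta var_x var_y)"
    unfolding rootK_def mult.assoc[symmetric] by simp
  then show ?thesis by simp
qed

lemma rootK_kernel: "(1 - rootK) * (rootK - var_x) = var_y * rootK"
proof -
  have "(1 + var_x - var_y - 2 * rootK) ^ 2 = Delta var_x var_y"
    using sqrt_series_Delta(1) unfolding rootK_sqrt .
  then have "4 * ((1 - rootK) * (rootK - var_x) - var_y * rootK) = 0"
    unfolding Delta_def by (simp add: algebra_simps power2_eq_square)
  then show ?thesis by simp
qed

text \<open>Only a series without constant term in \<open>x\<close> may be substituted for
  \<open>s\<close>. Of the two roots of the quadratic this one qualifies: at \<open>x = 0\<close>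
  the discriminant \<open>\<Delta>\<close> is \<open>(1 - y) ^ 2\<close>, with square root
  \<open>1 - y\<close>.\<close>

lemma rootK_nth_0: "fps_nth rootK 0 = 0"
proof -
  let ?s = "fps_nth (sqrt_series (Delta var_x var_y)) 0"
  have "?s ^ 2 = fps_nth (Delta var_x var_y) 0"
    using arg_cong[OF sqrt_series_Delta(1), of "\<lambda>f. fps_nth f 0"] by (simp add: fps_nth_power_0)
  also have "\<dots> = (1 - fps_X) ^ 2"
    by (simp add: Delta_def var_x_def var_y_def power2_eq_square algebra_simps fps_numeral_fps_const)
  finally have "?s = 1 - fps_X \<or> ?s = - (1 - fps_X)" by (simp add: power2_eq_iff)
  moreover have "?s \<noteq> - (1 - fps_X)"
  proof
    assume "?s = - (1 - fps_X)"
    then have "fps_nth ?s 0 = - 1" by simp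
    then show False using sqrt_series_Delta(2) by simp
  qed
  ultimately have "?s = 1 - fps_X" by blast
  then show ?thesis by (simp add: rootK_def var_x_def var_y_def)
qed

text \<open>The parametrization \<open>x = X * (1 - Y)\<close>, \<open>y = Y * (1 - X)\<close>, with
  \<open>X - x + y\<close> in place of \<open>Y\<close>.\<close>

lemma var_y_eq: "var_y = (rootK - var_x + var_y) * (1 - rootK)" "var_x = rootK * (1 - (rootK - var_x + var_y))"
  using rootK_kernel by (simp_all add: algebra_simps)

definition rootV :: "rat fps fps" where "rootV = fps_map square_y rootK"

abbreviation "XL \<equiv> to_fract rootV"
abbreviation "YL \<equiv> XL - xL + yL"

lemma rootV_nth_0: "fps_nth rootV 0 = 0"
  by (simp add: rootV_def fps_map_def rootK_nth_0 is_ring_homD[OF is_ring_hom_square_y])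

lemma to_field_rootK: "to_field rootK = XL"
  by (simp add: to_field_def rootV_def)

text \<open>At a root the term with the difference quotient equals \<open>U - u\<close>. So
  \<open>U\<close> drops out and the equation becomes a formula for \<open>u\<close>.\<close>

lemma kernel_root_elim:
  fixes X x y i U V W G u :: "'a::field"
  assumes "X \<noteq> 0" "i * (1 - X) = 1" "(1 - X) * (X - x) = y * X"
    and "U = W + y * i * (G + X * i * V)" "(X - x) * G = X * (U - u)"
  shows "u = W + y * X * i ^ 2 * V"
proof -
  have "X * (y * i * G) = i * (y * X) * G" by (simp add: mult_ac)
  also have "\<dots> = i * (1 - X) * ((X - x) * G)" unfolding assms(3)[symmetric] by (simp add: mult_ac)
  also have "\<dots> = X * (U - u)" unfolding assms(2,5) by simp
  finally have "y * i * G = U - u" using assms(1) by simp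
  then show ?thesis using assms(4) by (simp add: algebra_simps power2_eq_square)
qed

text \<open>This identifies the divisor \<open>d\<close> of \<open>short_T\<close> at the root as
  \<open>Y\<close>.\<close>

lemma kernel_root_diff:
  fixes X x y :: "'a::comm_ring_1"
  assumes "(1 - X) * (X - x) = y * X"
  shows "X - x = (X - x + y) * X"
proof -
  have "(X - x + y) * X = (X - x) * X + y * X" by (rule distrib_right)
  also have "\<dots> = X - x" unfolding assms[symmetric] by (simp add: algebra_simps)
  finally show ?thesis by (rule sym)
qed

lemma root_value_simplify:
  fixes X y :: "'a::field"
  assumes "1 - X \<noteq> 0" "(1 - X) ^ 2 - y \<noteq> 0"
  shows "X * (1 / (1 - X)) + y * X * (1 / (1 - X)) ^ 2 * (X * (1 - X) / ((1 - X) ^ 2 - y))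
      = X / (1 - X) * (1 + y * X / ((1 - X) ^ 2 - y))"
    and "y * (X / (1 - X) * (1 + y * X / ((1 - X) ^ 2 - y))) * ((1 - X) ^ 2 - y)
      = y * X / (1 - X) * ((1 - X) ^ 2 - y + y * X)"
  using assms by (simp_all add: divide_simps power2_eq_square) (simp add: distrib_left mult_ac)

lemma root_relations:
  "1 - XL \<noteq> 0" "vL \<noteq> 0" "xL \<noteq> 0" "XL \<noteq> 0" "(1 - XL) * (XL - xL) = yL * XL"
  "YL = yL / (1 - XL)" "xL = XL * (1 - XL - yL) / (1 - XL)" "to_field (sqrt_series (Delta var_x var_y)) = 1 - XL - YL"
proof -
  note hg = is_ring_homD[OF is_ring_hom_to_field] and hf = is_ring_homD[OF is_ring_hom_to_fract]
  have "to_fract (1 - rootV) \<noteq> 0"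
    by (rule to_fract_nonzero) (simp add: rootV_nth_0)
  then show X: "1 - XL \<noteq> 0" by (simp only: hf not_False_eq_True)
  have "vK \<noteq> 0" by (simp add: vK_def)
  then show v: "vL \<noteq> 0" by simp
  have "var_x \<noteq> 0" by (simp add: var_x_def)
  then show x: "xL \<noteq> 0" by simp
  show K: "(1 - XL) * (XL - xL) = yL * XL"
    using arg_cong[OF rootK_kernel, of to_field] by (simp add: hg to_field_var to_field_rootK)
  have "YL * (1 - XL) = yL" using K by (simp add: algebra_simps)
  then show Y: "YL = yL / (1 - XL)" using X by (simp add: field_simps)
  have "xL * (1 - XL) = XL * (1 - XL - yL)" using K by (simp add: algebra_simps)
  then show xX: "xL = XL * (1 - XL - yL) / (1 - XL)" using X by (simp add: field_simps)
  show "XL \<noteq> 0" using x xX by auto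
  show "to_field (sqrt_series (Delta var_x var_y)) = 1 - XL - YL"
    unfolding rootK_sqrt by (simp add: hg to_field_var to_field_rootK)
qed

lemma YL_nonzero: "YL \<noteq> 0"
  unfolding root_relations(6) using root_relations(1,2) by simp

lemma uL_value: "uL = XL / (1 - XL) * (1 + yL * XL / ((1 - XL) ^ 2 - yL))"
proof -
  note E = field_eval_equations[OF rootV_nth_0] and R = root_relations
  have i: "field_eval rootV geom = 1 / (1 - XL)" using E(1) R(1) by (simp add: field_simps)
  show ?thesis
    using kernel_root_elim[OF R(4) E(1) R(5) E(4,5)]
    unfolding i E(6) root_value_simplify(1)[OF R(1) E(2)] .
qed

text \<open>The tall towers in \<open>gL\<close> require this value. \<open>kernel_cancel\<close> is
  applied while \<open>s\<close> is an indeterminate over the series in \<open>x\<close> and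
  \<open>y\<close>, and only the quotient is evaluated at the root.\<close>

lemma list_series_at_root:
  defines "m \<equiv> xL + yL * uL + 2 - yL"
  shows "field_eval rootV (list_series True) = XL * (XL ^ 2 + (XL - m) * XL
      + ((1 - yL) + xL * (2 - yL) + 2 * yL * uL - m * XL + XL ^ 2)) / ((1 - YL - XL) * ((1 - XL) ^ 2 - yL))"
proof -
  note E = field_eval_equations[OF rootV_nth_0] and R = root_relations
  note hg = is_ring_homD[OF is_ring_hom_to_field]
  note he = is_ring_homD[OF is_ring_hom_field_eval[OF rootV_nth_0]]
  let ?u = "sum_at_x (list_gf (\<lambda>_. True) True False)"
  let ?m = "var_x + var_y * ?u + 2 - var_y"
  have q: "(1 - XL) ^ 2 - yL \<noteq> 0" by (rule E(2))
  \<comment> \<open>\<open>uL\<close> is known in the field; injectivity brings the divisibility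
    condition back to the series, where the factor is cancelled.\<close>
  have "to_field ((rootK - var_x) * ((1 - rootK) ^ 2 - var_y + var_y * rootK) - var_y * ?u * ((1 - rootK) ^ 2 - var_y)) = to_field 0"
  proof -
    have "yL * uL * ((1 - XL) ^ 2 - yL) = yL * XL / (1 - XL) * ((1 - XL) ^ 2 - yL + yL * XL)"
      unfolding uL_value by (rule root_value_simplify(2)[OF R(1) q])
    also have "yL * XL / (1 - XL) = XL - xL" using R(1,5) by (simp add: field_simps)
    finally show ?thesis by (simp add: hg to_field_var to_field_rootK)
  qed
  then have root: "(rootK - var_x) * ((1 - rootK) ^ 2 - var_y + var_y * rootK) - var_y * ?u * ((1 - rootK) ^ 2 - var_y) = 0"
    by (rule to_field_inj)
  have c: "fps_const (a * b) = fps_const a * fps_const b" "fps_const (a + b) = fps_const a + fps_const b"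
    "fps_const (a - b) = fps_const a - fps_const b" "fps_const (a ^ n) = fps_const a ^ n"
    "fps_const 1 = 1" "fps_const 0 = 0" "fps_const (numeral k) = numeral k"
    for a b :: "rat fps fps" and n k
    by (simp_all add: fps_numeral_fps_const)
  \<comment> \<open>This holds for the indeterminate \<open>s\<close> and fails after evaluation at
    the root.\<close>
  have ne: "fps_X - fps_const rootK \<noteq> 0"
  proof
    assume "fps_X - fps_const rootK = 0"
    then have "fps_nth (fps_X - fps_const rootK) 1 = 0" by simp
    then show False by simp
  qed
  have K: "(1 - fps_const (rootK - var_x + var_y) - fps_X) * ((1 - fps_X) ^ 2 - fps_const var_y) * list_series True
    = fps_X * (fps_X ^ 2 + (fps_const rootK - fps_const ?m) * fps_X + ((1 - fps_const var_y)
      + fps_const var_x * (2 - fps_const var_y) + 2 * fps_const var_y * fps_const ?u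
      - fps_const ?m * fps_const rootK + fps_const rootK ^ 2))"
  proof (rule kernel_cancel[OF kernel_factor[OF geom_inverse list_series_eqs] refl])
    show "fps_const var_x = fps_const rootK * (1 - fps_const (rootK - var_x + var_y))"
      using arg_cong[OF var_y_eq(2), of fps_const] unfolding c .
    show "fps_const (rootK - var_x + var_y) = fps_const rootK - fps_const var_x + fps_const var_y"
      unfolding c ..
    show "(fps_const rootK - fps_const var_x) * ((1 - fps_const rootK) ^ 2 - fps_const var_y + fps_const var_y * fps_const rootK)
      - fps_const var_y * fps_const ?u * ((1 - fps_const rootK) ^ 2 - fps_const var_y) = 0"
      using arg_cong[OF root, of fps_const] unfolding c .
    show "fps_const ?m = fps_const var_x + fps_const var_y * fps_const ?u + 2 - fps_const var_y"
      unfolding c ..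
  qed (rule ne)
  have "(1 - YL - XL) * ((1 - XL) ^ 2 - yL) * field_eval rootV (list_series True)
    = XL * (XL ^ 2 + (XL - m) * XL + ((1 - yL) + xL * (2 - yL) + 2 * yL * uL - m * XL + XL ^ 2))"
    using arg_cong[OF K, of "field_eval rootV"]
    unfolding he field_eval_const field_eval_X[OF rootV_nth_0] hg to_field_var to_field_rootK m_def .
  moreover have "(1 - YL - XL) * ((1 - XL) ^ 2 - yL) \<noteq> 0"
  proof -
    have "(1 - YL - XL) * (1 - XL) = (1 - XL) ^ 2 - yL"
      unfolding R(6) using R(1) by (simp add: field_simps power2_eq_square)
    then have "1 - YL - XL \<noteq> 0" using q by auto
    then show ?thesis using q by simp
  qed
  ultimately show ?thesis by (subst nonzero_eq_divide_eq) (simp_all add: mult_ac)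
qed

lemma gL_value:
  "gL = pair_TF yL (short_T xL yL YL XL) (tall_T xL yL (field_eval rootV (list_series True)) XL) XL
    + yL * XL / (1 - XL) ^ 2 * complete_F yL XL"
proof -
  note E = field_eval_equations[OF rootV_nth_0] and R = root_relations
  have i: "field_eval rootV geom = 1 / (1 - XL)" using E(1) R(1) by (simp add: field_simps)
  have i2: "yL * XL * (1 / (1 - XL)) ^ 2 = yL * XL / (1 - XL) ^ 2" by (simp add: power_one_over)
  have r0: "rootV \<noteq> 0" using R(4) by auto
  show ?thesis
    using kernel_root_elim[OF R(4) E(1) R(5) E(14,15)]
    unfolding i i2 E(11,13)
      short_series_at[OF rootV_nth_0 kernel_root_diff[OF R(5)] YL_nonzero r0] E(10) .
qed

section \<open>The two conjugate points and the final formula\<close>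

lemma field_nonzeroI:
  "to_fract f = L \<Longrightarrow> fps_nth (fps_nth f 0) 0 \<noteq> 0 \<Longrightarrow> L \<noteq> (0 :: rat fps fps fract)"
  by auto

text \<open>\<open>1 - c * v\<close> has constant term 1 and is a unit, so
  \<open>x / (1 - c * v)\<close> is a series in \<open>x\<close> and \<open>v\<close> that can be
  substituted for \<open>s\<close>. The cases in use are \<open>c = 1\<close> and
  \<open>c = - 1\<close>.\<close>

lemma conjugate_points:
  fixes c :: rat
  assumes "c \<noteq> 0"
  defines "a \<equiv> var_x * fps_const (inverse (1 - fps_const c * fps_X))"
  shows "fps_nth a 0 = 0" "a * (1 - fps_const (fps_const c) * vK) = var_x" "a \<noteq> 0"
proof -
  show "fps_nth a 0 = 0" by (simp add: a_def var_x_def)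
  have "inverse (1 - fps_const c * fps_X) * (1 - fps_const c * fps_X) = 1"
    by (rule inverse_mult_eq_1) simp
  then have "fps_const (inverse (1 - fps_const c * fps_X)) * (1 - fps_const (fps_const c) * vK) = 1"
    by (simp add: vK_def flip: fps_const_1_eq_1 del: fps_const_1_eq_1)
  then show 1: "a * (1 - fps_const (fps_const c) * vK) = var_x"
    unfolding a_def mult.assoc by simp
  show "a \<noteq> 0"
  proof
    assume "a = 0"
    with 1 have "var_x = 0" by simp
    then show False by (simp add: var_x_def)
  qed
qed

lemma bimodal_gf_field:
  "to_field (bimodal_gf 2) =
    - (2 * xL ^ 2 * A2c xL yL / ((1 - xL) ^ 3 * ((1 - xL) ^ 2 - yL) * (1 - XL - YL) ^ 5)
      + xL ^ 2 * B2c xL yL / ((1 - xL) ^ 5 * ((1 - xL) ^ 2 - yL) ^ 3 * ((1 - XL - YL) ^ 2) ^ 3))"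
proof -
  note hf = is_ring_homD[OF is_ring_hom_to_fract] and R = root_relations
  note eps = vK_def var_x_def fps_nth_power_0
  let ?G = "to_field (sum_at_x (completion_gf 2 True True))"
  let ?d = "to_field (sum_at_x (grow (completion_gf 2 True True)))"
  have nz: "to_fract (1 - vK) \<noteq> 0" "to_fract (1 + vK) \<noteq> 0"
    "to_fract (1 - vK - var_x) \<noteq> 0" "to_fract (1 + vK - var_x) \<noteq> 0" "to_fract (1 - var_x) \<noteq> 0"
    "to_fract ((1 - vK) ^ 2 - var_x) \<noteq> 0" "to_fract ((1 + vK) ^ 2 - var_x) \<noteq> 0"
    "to_fract (1 - var_x - vK ^ 2) \<noteq> 0"
    by (rule to_fract_nonzero, simp add: eps)+
  note nz = nz[unfolded hf]
  have "to_fract (2 :: rat fps fps) \<noteq> 0" by (rule to_fract_nonzero) simp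
  then have two: "(2 :: rat fps fps fract) \<noteq> 0" by (simp only: hf not_False_eq_True)
  have rd: "(1 - XL - YL) ^ 2 = Delta xL yL"
    using arg_cong[OF sqrt_series_Delta(1), of to_field] R(8)
    unfolding Delta_def by (simp only: is_ring_homD[OF is_ring_hom_to_field] to_field_var)
  have "fps_nth (fps_nth (sqrt_series (Delta var_x var_y)) 0) 0 \<noteq> 0"
    using sqrt_series_Delta(2) by simp
  then have rne: "1 - XL - YL \<noteq> 0"
    unfolding R(8)[symmetric] using to_field_inj[of "sqrt_series (Delta var_x var_y)" 0]
    by (auto simp: is_ring_homD[OF is_ring_hom_to_field])
  have "xL = XL * (1 - YL)" "yL = YL * (1 - XL)"
    using R(5) by (simp_all add: algebra_simps)
  note RV = this refl refl refl YL_nonzero R(1) nz(5) rne uL_value refl list_series_at_root gL_value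
  have sum: "yL * (kernel_value xL yL uL gL vL (xL / (1 - vL)) + kernel_value xL yL uL gL (- vL) (xL / (1 + vL))) / 2 =
    - (2 * xL ^ 2 * A2c xL yL / ((1 - xL) ^ 3 * ((1 - xL) ^ 2 - yL) * (1 - XL - YL) ^ 5)
      + xL ^ 2 * B2c xL yL / ((1 - xL) ^ 5 * ((1 - xL) ^ 2 - yL) ^ 3 * ((1 - XL - YL) ^ 2) ^ 3))"
    by (rule kernel_value_sum[OF rd root_values(1)[OF RV] root_values(2)[OF RV] two R(2) nz])
  define ap where "ap = var_x * fps_const (inverse (1 - fps_const 1 * fps_X))"
  define am where "am = var_x * fps_const (inverse (1 - fps_const (- 1) * fps_X))"
  note p = conjugate_points[of 1, folded ap_def, simplified]
    and n = conjugate_points[of "- 1", folded am_def, simplified]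
  have neg: "fps_const (fps_const (- 1)) = (- 1 :: rat fps fps)"
    by (simp flip: fps_const_neg)
  have P: "to_fract ap * (1 - vL) = xL" and N: "to_fract am * (1 + vL) = xL"
    using arg_cong[OF p(2), of to_fract] arg_cong[OF n(2), of to_fract] by (simp_all add: hf neg)
  have p': "?G + vL * ?d = kernel_value xL yL uL gL vL (to_fract ap)"
  proof (rule kernel_value_at[OF p(1) _ refl R(2) p(3)])
    show "to_fract ap - xL = vL * to_fract ap" unfolding P[symmetric] by (simp add: algebra_simps)
    show "1 - to_fract ap - vL \<noteq> 0"
      by (rule field_nonzeroI[of "1 - ap - vK"]) (simp_all add: p(1) vK_def)
  qed
  have ap: "to_fract ap = xL / (1 - vL)" using P nz(1) by (simp add: field_simps)
  have n': "?G + - vL * ?d = kernel_value xL yL uL gL (- vL) (to_fract am)"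
  proof (rule kernel_value_at[OF n(1) _ _ _ n(3)])
    show "to_fract am - xL = - vL * to_fract am" unfolding N[symmetric] by (simp add: algebra_simps)
    show "1 - to_fract am - - vL \<noteq> 0"
      by (rule field_nonzeroI[of "1 - am + vK"]) (simp_all add: n(1) vK_def)
  qed (use R(2) in simp_all)
  have am: "to_fract am = xL / (1 + vL)" using N nz(2) by (simp add: field_simps)
  have "kernel_value xL yL uL gL vL (xL / (1 - vL)) + kernel_value xL yL uL gL (- vL) (xL / (1 + vL))
      = (?G + vL * ?d) + (?G + - vL * ?d)"
    unfolding p' n' unfolding ap am ..
  also have "\<dots> = 2 * ?G" by simp
  finally have "yL * ?G = yL * (kernel_value xL yL uL gL vL (xL / (1 - vL)) + kernel_value xL yL uL gL (- vL) (xL / (1 + vL))) / 2"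
    using two by simp
  also note sum
  finally show ?thesis
    unfolding bimodal_gf_completion_gf[OF pos2] sum_at_x_def[symmetric]
      is_ring_homD(4)[OF is_ring_hom_to_field] to_field_var .
qed

theorem mainTheorem4:
  shows "bimodal_gf 2 =
    (let x = var_x; y = var_y; \<Delta> = Delta x y in
      - (2 * x ^ 2 * A2c x y /
           ((1 - x) ^ 3 * ((1 - x) ^ 2 - y) * sqrt_series \<Delta> ^ 5)
         + x ^ 2 * B2c x y /
           ((1 - x) ^ 5 * ((1 - x) ^ 2 - y) ^ 3 * \<Delta> ^ 3)))"
proof -
  note hg = is_ring_homD[OF is_ring_hom_to_field]
  let ?s = "sqrt_series (Delta var_x var_y)"
  let ?D1 = "(1 - var_x) ^ 3 * ((1 - var_x) ^ 2 - var_y) * ?s ^ 5"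
  let ?D2 = "(1 - var_x) ^ 5 * ((1 - var_x) ^ 2 - var_y) ^ 3 * Delta var_x var_y ^ 3"
  let ?N1 = "2 * var_x ^ 2 * A2c var_x var_y" and ?N2 = "var_x ^ 2 * B2c var_x var_y"
  have D: "fps_nth (fps_nth ?D1 0) 0 = 1" "fps_nth (fps_nth ?D2 0) 0 = 1"
    using sqrt_series_Delta(2)
    by (simp_all add: var_x_def var_y_def fps_nth_power_0 Delta_def fps_numeral_fps_const)
  \<comment> \<open>Division of series becomes division in the field only where it multiplies back,
    which the constant term 1 of the denominator ensures.\<close>
  have div: "to_field (f / g) = to_field f / to_field g" if "fps_nth (fps_nth g 0) 0 = 1" for f g
  proof -
    have "to_field (f / g) * to_field g = to_field f"
      using arg_cong[OF series_divide_mult[OF that, of f], of to_field] by (simp add: hg)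
    moreover have "to_field g \<noteq> 0"
      using that to_field_inj[of g 0] by (auto simp: hg)
    ultimately show ?thesis by (simp add: field_simps)
  qed
  have A: "to_field (A2c var_x var_y) = A2c xL yL" and B: "to_field (B2c var_x var_y) = B2c xL yL"
    unfolding A2c_def B2c_def by (simp_all only: hg to_field_var)
  have s: "to_field ?s = 1 - XL - YL" by (rule root_relations(8))
  have Delta: "to_field (Delta var_x var_y) = (1 - XL - YL) ^ 2"
    by (subst sqrt_series_Delta(1)[symmetric]) (simp only: hg s)
  have N: "to_field ?N1 = 2 * xL ^ 2 * A2c xL yL" "to_field ?N2 = xL ^ 2 * B2c xL yL"
    by (simp_all only: hg A B to_field_var)
  have E: "to_field ?D1 = (1 - xL) ^ 3 * ((1 - xL) ^ 2 - yL) * (1 - XL - YL) ^ 5"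
    "to_field ?D2 = (1 - xL) ^ 5 * ((1 - xL) ^ 2 - yL) ^ 3 * ((1 - XL - YL) ^ 2) ^ 3"
    by (simp_all only: hg s Delta to_field_var)
  have "to_field (- (?N1 / ?D1 + ?N2 / ?D2))
      = - (to_field ?N1 / to_field ?D1 + to_field ?N2 / to_field ?D2)"
    by (simp only: hg(3,5) div[OF D(1)] div[OF D(2)])
  then have "to_field (bimodal_gf 2) = to_field (- (?N1 / ?D1 + ?N2 / ?D2))"
    unfolding bimodal_gf_field N E by (rule sym)
  then show ?thesis unfolding Let_def by (rule to_field_inj)
qed

end
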